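(* Let $U,V\subset\mathbb R^3$ be domains, $(s,t)\subset\mathbb R$ an open interval, $\underline a=\sum_{i=1}^3a_ie_i\in C^1(U,V)$ a diffeomorphism with real-valued components, and $a:(s,t)\times U\to(s,t)\times V$, $a(x)=x_0+\underline a(\underline x)$. Let $u_i=\sum_{j=1}^3a_j\big(\frac{\partial(a^{-1})_i}{\partial y_j}\circ a\big)$ for $i=1,2,3$, and $D_uf=\frac{\partial f}{\partial x_0}+\sum_{j=1}^3u_j\frac{\partial f}{\partial x_j}$. Let $\Omega\subset(s,t)\times U$ be a domain such that $\overline{a(\Omega)}\subset(s,t)\times V$, $\partial\Omega$ and $\partial(a(\Omega))$ are 3-dimensional compact smooth surfaces, and $\overline{a(\Omega)}\subset\mathbb H\setminus\mathbb R$. Then for all $f,g\in C^1(\overline\Omega,\mathbb H)$, $$\int_{\partial\Omega}g\,J_a\nu_{a(x)}\,f=4\int_\Omega g\,\frac{\underline a(\underline x)}{\|\underline a(\underline x)\|^2}\,f\,M_a\,dx$$ $$-2\int_\Omega\frac1{\|\underline a(\underline x)\|^2}\Big[\frac{\partial g}{\partial x_0}(x)(1+\underline a(\underline x))\,\underline a(\underline x)\,f(x)+g(x)\,\underline a(\underline x)(1+\underline a(\underline x))\frac{\partial f}{\partial x_0}(x)\Big]M_a\,dx$$ $$+2\int_\Omega\frac1{\|\underline a(\underline x)\|^2}\big[D_ug(x)\,\underline a(\underline x)\,f(x)+g(x)\,\underline a(\underline x)\,D_uf(x)\big]M_a\,dx.$$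
   Context: $\mathbb H$ is the skew-field of quaternions with imaginary units $e_1,e_2,e_3$; $x=x_0+\underline x$, $\underline x=\sum_{k=1}^3x_ke_k$, $\|\cdot\|$ the Euclidean norm; $\mathbb R\times\mathbb R^3=\mathbb H$. "Diffeomorphism" means a $C^1$ bijection with $C^1$ inverse; $(a^{-1})_j$ is the $j$-th real component of $(\underline a)^{-1}$. For $x\in\mathbb H\setminus\mathbb R$, $\nu_x=2\,d\hat x_0+2\frac{\underline x}{\|\underline x\|^2}\sum_{k=1}^3x_k\,d\hat x_k$, where $d\hat x_k$ is the 3-form with $dx_k\wedge d\hat x_k=dx_0\wedge dx_1\wedge dx_2\wedge dx_3$; on a boundary surface with outward unit normal $(n_0,\dots,n_3)$ and surface measure $dS$ it restricts to $n_k\,dS$. $M_a=|\det Da|$, with $Da$ the Jacobian matrix of $a$, and $J_a\nu_{a(x)}$ is $\nu$ transported to $\partial\Omega$ by the change of variables $a$: for continuous $\varphi,\psi$ on $\partial\Omega$, $\int_{\partial\Omega}\varphi\,J_a\nu_{a(x)}\,\psi=\int_{\partial a(\Omega)}(\varphi\circ a^{-1})\,\nu\,(\psi\circ a^{-1})$. $C^1(\overline\Omega,\mathbb H)$ denotes functions continuously differentiable up to the boundary. *)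

theory Defs
  imports "HOL-Analysis.Analysis"
begin

subsection \<open>Quaternions\<close>

text \<open>
  Quaternions are realised on the Euclidean space \<open>real^4\<close>, with components \<open>x $ 0, \<dots>, x $ 3\<close>
  (in the index type \<open>4\<close> the literal \<open>4\<close> equals \<open>0\<close>; likewise \<open>3 = 0\<close> in the index type \<open>3\<close>).
  The class operations \<open>*\<close> and \<open>1\<close> of \<open>real^4\<close> are componentwise and are not used;
  the Hamilton product is \<open>\<odot>\<close>, its unit is \<open>qone\<close>.
\<close>

type_synonym quat = "real^4"

definition Quat :: "real \<Rightarrow> real \<Rightarrow> real \<Rightarrow> real \<Rightarrow> quat" where
  "Quat t x y z = (\<chi> k. if k = 0 then t else if k = 1 then x else if k = 2 then y else z)"

lemma Quat_nth [simp]: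
  "Quat t x y z $ 0 = t" "Quat t x y z $ 1 = x" "Quat t x y z $ 2 = y" "Quat t x y z $ 3 = z"
  by (simp_all add: Quat_def)

lemma quat_eq_iff:
  "p = q \<longleftrightarrow> p $ 0 = q $ 0 \<and> p $ 1 = q $ 1 \<and> p $ 2 = q $ 2 \<and> p $ 3 = q $ 3" for p q :: quat
proof -
  have four: "(4::4) = 0"
    by simp
  show ?thesis
    unfolding vec_eq_iff forall_4 four by blast
qed

definition qmul :: "quat \<Rightarrow> quat \<Rightarrow> quat"  (infixl "\<odot>" 70) where
  "p \<odot> q = Quat
     (p $ 0 * q $ 0 - p $ 1 * q $ 1 - p $ 2 * q $ 2 - p $ 3 * q $ 3)
     (p $ 0 * q $ 1 + p $ 1 * q $ 0 + p $ 2 * q $ 3 - p $ 3 * q $ 2)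
     (p $ 0 * q $ 2 - p $ 1 * q $ 3 + p $ 2 * q $ 0 + p $ 3 * q $ 1)
     (p $ 0 * q $ 3 + p $ 1 * q $ 2 - p $ 2 * q $ 1 + p $ 3 * q $ 0)"

definition qone :: quat where
  "qone = Quat 1 0 0 0"

lemma qmul_assoc: "(p \<odot> q) \<odot> r = p \<odot> (q \<odot> r)"
  by (simp add: quat_eq_iff qmul_def algebra_simps)

lemma qmul_qone: "qone \<odot> p = p" "p \<odot> qone = p"
  by (simp_all add: quat_eq_iff qmul_def qone_def)

lemma qmul_units:
  "axis 1 1 \<odot> axis 2 1 = (axis 3 1 :: quat)"
  "axis 2 1 \<odot> axis 3 1 = (axis 1 1 :: quat)"
  "axis 3 1 \<odot> axis 1 1 = (axis 2 1 :: quat)"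
  "axis 1 1 \<odot> axis 1 1 = - qone"
  "axis 2 1 \<odot> axis 2 1 = - qone"
  "axis 3 1 \<odot> axis 3 1 = - qone"
  by (simp_all add: quat_eq_iff qmul_def qone_def axis_def)

definition join :: "real \<Rightarrow> real^3 \<Rightarrow> quat" where
  "join t v = Quat t (v $ 1) (v $ 2) (v $ 3)"

definition vpart :: "quat \<Rightarrow> real^3" where
  "vpart x = vector [x $ 1, x $ 2, x $ 3]"

definition pure :: "real^3 \<Rightarrow> quat" where
  "pure v = join 0 v"

definition qreals :: "quat set" where
  "qreals = range (\<lambda>t. t *\<^sub>R qone)"

definition cylinder :: "ereal \<Rightarrow> ereal \<Rightarrow> (real^3) set \<Rightarrow> quat set" where
  "cylinder s t U = {x. x $ 0 \<in> einterval s t \<and> vpart x \<in> U}"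


subsection \<open>Differentiability\<close>

definition C1_on :: "'a::real_normed_vector set \<Rightarrow> ('a \<Rightarrow> 'b::real_normed_vector) \<Rightarrow> bool" where
  "C1_on S f \<longleftrightarrow> (\<exists>f'. continuous_on S f' \<and>
     (\<forall>x\<in>S. (f has_derivative blinfun_apply (f' x)) (at x)))"

text \<open>
  Continuously differentiable up to the boundary: \<open>f\<close> is continuous on the closure, and its
  derivative on the open set \<open>S\<close> extends continuously to the closure.
\<close>

definition C1_closure :: "'a::real_normed_vector set \<Rightarrow> ('a \<Rightarrow> 'b::real_normed_vector) \<Rightarrow> bool" where
  "C1_closure S f \<longleftrightarrow> continuous_on (closure S) f \<and>
     (\<exists>f'. continuous_on (closure S) f' \<and>
       (\<forall>x\<in>S. (f has_derivative blinfun_apply (f' x)) (at x)))"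

definition C1_diffeo :: "'a::real_normed_vector set \<Rightarrow> 'b::real_normed_vector set \<Rightarrow> ('a \<Rightarrow> 'b) \<Rightarrow> bool" where
  "C1_diffeo U V a \<longleftrightarrow> bij_betw a U V \<and> C1_on U a \<and> C1_on V (inv_into U a)"

definition pderiv_at :: "'i::finite \<Rightarrow> (real^'i \<Rightarrow> 'b::real_normed_vector) \<Rightarrow> real^'i \<Rightarrow> 'b" where
  "pderiv_at j f x = vector_derivative (\<lambda>h. f (x + h *\<^sub>R axis j 1)) (at 0)"


subsection \<open>Hypersurfaces in \<open>\<real>\<^sup>4\<close> and surface measure\<close>

definition local_param :: "quat set \<Rightarrow> (real^3) set \<Rightarrow> (real^3 \<Rightarrow> quat) \<Rightarrow> bool" where
  "local_param S W \<phi> \<longleftrightarrow> open W \<and> openin (top_of_set S) (\<phi> ` W) \<and>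
     (\<exists>\<psi>. homeomorphism W (\<phi> ` W) \<phi> \<psi>) \<and> C1_on W \<phi> \<and>
     (\<forall>w\<in>W. inj (frechet_derivative \<phi> (at w)))"

text \<open>
  An embedded 3-dimensional surface without boundary. Only class \<open>C\<^sup>1\<close> is required, so
  surfaces of any higher smoothness class are covered.
\<close>

definition smooth_surface :: "quat set \<Rightarrow> bool" where
  "smooth_surface S \<longleftrightarrow> (\<forall>y\<in>S. \<exists>W \<phi>. local_param S W \<phi> \<and> y \<in> \<phi> ` W)"

text \<open>
  The surface measure is the Borel measure concentrated on \<open>S\<close> that is given by
  \<open>sqrt (det (D\<phi>\<^sup>T D\<phi>)) dw\<close> in every local parametrization \<open>\<phi>\<close>.
\<close>

definition is_surface_measure :: "quat set \<Rightarrow> quat measure \<Rightarrow> bool" where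
  "is_surface_measure S \<sigma> \<longleftrightarrow> sets \<sigma> = sets borel \<and>
     (\<forall>A\<in>sets borel. A \<inter> S = {} \<longrightarrow> emeasure \<sigma> A = 0) \<and>
     (\<forall>W \<phi> A. local_param S W \<phi> \<and> A \<in> sets borel \<and> A \<subseteq> \<phi> ` W \<longrightarrow>
        emeasure \<sigma> A = (\<integral>\<^sup>+ w \<in> W \<inter> \<phi> -` A.
          ennreal (sqrt (det (transpose (jacobian \<phi> (at w)) ** jacobian \<phi> (at w)))) \<partial>lborel))"

definition surface_measure :: "quat set \<Rightarrow> quat measure" where
  "surface_measure S = (THE \<sigma>. is_surface_measure S \<sigma>)"

definition tangent_vectors :: "quat set \<Rightarrow> quat \<Rightarrow> quat set" where
  "tangent_vectors S y = {v. \<exists>c. c 0 = y \<and> (\<forall>\<^sub>F h in nhds 0. c h \<in> S) \<and>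
     (c has_vector_derivative v) (at (0::real))}"

definition is_outward_unit_normal :: "quat set \<Rightarrow> quat \<Rightarrow> quat \<Rightarrow> bool" where
  "is_outward_unit_normal G y n \<longleftrightarrow> norm n = 1 \<and>
     (\<forall>v\<in>tangent_vectors (frontier G) y. n \<bullet> v = 0) \<and>
     (\<forall>\<^sub>F h in at_right 0. y - h *\<^sub>R n \<in> G \<and> y + h *\<^sub>R n \<notin> closure G)"

text \<open>
  Where no outward unit normal exists the value is \<open>0\<close> (the convention for Federer's exterior
  normal). For a domain bounded by a compact smooth surface without boundary this does not
  occur, since each component of the surface separates \<open>\<real>\<^sup>4\<close>.
\<close>

definition outward_unit_normal :: "quat set \<Rightarrow> quat \<Rightarrow> quat" where
  "outward_unit_normal G y =
     (if \<exists>n. is_outward_unit_normal G y n then THE n. is_outward_unit_normal G y n else 0)"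


subsection \<open>The form \<open>\<nu>\<close> and its transport\<close>

text \<open>
  On a boundary surface with outward unit normal \<open>n\<close> the 3-form
  \<open>\<nu> = 2 dx0^ + 2 (vec y / |vec y|^2) (\<Sum>k=1..3. yk dxk^)\<close> restricts to \<open>nu_density n y dS\<close>,
  because \<open>dxk^\<close> restricts to \<open>nk dS\<close>.
\<close>

definition nu_density :: "quat \<Rightarrow> quat \<Rightarrow> quat" where
  "nu_density n y = (2 * n $ 0) *\<^sub>R qone +
     (2 / (norm (vpart y))\<^sup>2 * (\<Sum>k\<in>{1,2,3}. y $ k * n $ k)) *\<^sub>R pure (vpart y)"

definition nu_integral :: "quat set \<Rightarrow> (quat \<Rightarrow> quat) \<Rightarrow> (quat \<Rightarrow> quat) \<Rightarrow> quat" where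
  "nu_integral G \<phi> \<psi> = (LINT y : frontier G | surface_measure (frontier G).
     \<phi> y \<odot> nu_density (outward_unit_normal G y) y \<odot> \<psi> y)"

text \<open>The map \<open>x0 + vec x \<mapsto> x0 + a (vec x)\<close> on quaternions.\<close>

definition lift :: "(real^3 \<Rightarrow> real^3) \<Rightarrow> quat \<Rightarrow> quat" where
  "lift a x = join (x $ 0) (a (vpart x))"

text \<open>
  The integral of \<open>\<phi> J\<^sub>a\<nu>\<^sub>a\<^sub>(\<^sub>x\<^sub>) \<psi>\<close> over the boundary of \<open>\<Omega>\<close>, defined through the change of
  variables \<open>A\<close>, a bijection on the set \<open>X\<close> containing the closure of \<open>\<Omega>\<close>.
\<close>

definition transported_nu_integral ::
  "quat set \<Rightarrow> (quat \<Rightarrow> quat) \<Rightarrow> quat set \<Rightarrow> (quat \<Rightarrow> quat) \<Rightarrow> (quat \<Rightarrow> quat) \<Rightarrow> quat" where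
  "transported_nu_integral X A \<Omega> \<phi> \<psi> =
     nu_integral (A ` \<Omega>) (\<phi> \<circ> inv_into X A) (\<psi> \<circ> inv_into X A)"

definition abs_jac :: "(quat \<Rightarrow> quat) \<Rightarrow> quat \<Rightarrow> real" where
  "abs_jac A x = \<bar>det (jacobian A (at x))\<bar>"

definition u_coeff :: "(real^3) set \<Rightarrow> (real^3 \<Rightarrow> real^3) \<Rightarrow> 3 \<Rightarrow> quat \<Rightarrow> real" where
  "u_coeff U a i x =
     (\<Sum>j\<in>UNIV. a (vpart x) $ j * pderiv_at j (\<lambda>y. inv_into U a y $ i) (a (vpart x)))"

definition D_u :: "(real^3) set \<Rightarrow> (real^3 \<Rightarrow> real^3) \<Rightarrow> (quat \<Rightarrow> quat) \<Rightarrow> quat \<Rightarrow> quat" where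
  "D_u U a f x = pderiv_at 0 f x + u_coeff U a 1 x *\<^sub>R pderiv_at 1 f x
     + u_coeff U a 2 x *\<^sub>R pderiv_at 2 f x + u_coeff U a 3 x *\<^sub>R pderiv_at 3 f x"

end

theory Submission
  imports Defs
begin

text \<open>
  Pushing \<open>\<Omega>\<close> forward by \<open>a\<close> and writing \<open>F = f \<circ> a\<inverse>\<close>, \<open>P = g \<circ> a\<inverse>\<close>, the left-hand side is the flux of a
  vector field with components \<open>2 P F\<close> and \<open>2 y\<^sub>k P (vec y / |vec y|\<^sup>2) F\<close> for \<open>k = 1, 2, 3\<close>. Since
  \<open>vec y / |vec y|\<^sup>2\<close> is homogeneous of degree \<open>-1\<close>, its divergence is
  \<open>4 P w F + 2 (\<partial>\<^sub>0P F + P \<partial>\<^sub>0F) + 2 (EP w F + P w EF)\<close> with \<open>w = vec y / |vec y|\<^sup>2\<close> and \<open>E = \<Sum> y\<^sub>k \<partial>\<^sub>k\<close>.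
  Pulled back by \<open>a\<close>, the operator \<open>\<partial>\<^sub>0 + E\<close> becomes \<open>D\<^sub>u\<close>, and \<open>(1 + vec a) vec a = vec a - |vec a|\<^sup>2\<close>
  rearranges the integrand into the stated form. The image of \<open>\<Omega>\<close> is bounded because it misses the real
  axis, which meets the unbounded component of the complement of its compact boundary.

  The divergence theorem is local by a partition of unity. Near a boundary point choose a constant vector
  \<open>N\<close> transversal to the surface; in the coordinates \<open>\<phi>(w) + \<tau> N\<close> the Jacobian does not depend on \<open>\<tau>\<close>, so
  the volume integral of the derivative in direction \<open>N\<close> reduces to the fundamental theorem of calculus
  in \<open>\<tau>\<close>. Transversal vectors span, which gives all directions. If the domain lies on both sides of the
  surface, the two contributions cancel, in accordance with the normal being \<open>0\<close> there, so no global
  separation theorem is needed.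
\<close>

subsection \<open>The generalized cross product in dimension four\<close>

text \<open>The surfaces are only of class C1, so their unit normal is merely continuous and moving
  along it would not give a C1 chart. This is why the transversal direction is a constant vector
  \<open>N\<close>. Nothing is lost, because one vector carries all the data: if \<open>c\<close> is
  \<open>cross4\<close> of the Jacobian matrix of a parametrization, its length is the surface
  density, its direction is the normal, and \<open>c \<bullet> N\<close> is the Jacobian determinant
  of the straightened chart. Density times normal component is therefore, up to sign, the volume
  density, and both integrals live on the same parameter ball.

  The surface measure is introduced by a definite description, so existence and uniqueness must be
  proved before any surface integral can be computed. This requires differentiable transition maps,
  while \<open>local_param\<close> supplies only homeomorphisms; straightening one of the two
  parametrizations provides the derivative.\<close>

lemma four_eq_zero: "(4::4) = 0" by simp

lemma sum_quat: "sum f (UNIV::4 set) = f 0 + f 1 + f 2 + f 3"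
  by (simp add: sum_4 four_eq_zero add_ac)

lemma vpart_nth [simp]: "vpart x $ 1 = x $ 1" "vpart x $ 2 = x $ 2" "vpart x $ 3 = x $ 3"
  by (simp_all add: vpart_def)

lemma join_nth [simp]: "join t v $ 0 = t" "join t v $ 1 = v $ 1" "join t v $ 2 = v $ 2" "join t v $ 3 = v $ 3"
  by (simp_all add: join_def)

text \<open>Laplace expansion along column \<open>0\<close>. The cofactors are then literally the
  components of \<open>cross4\<close>, so that \<open>det_matrix_cross4\<close> becomes a matter of
  simplification.\<close>

lemma det_quat:
  fixes A :: "real^4^4"
  shows "det A =
    A$0$0 * (A$1$1 * (A$2$2 * A$3$3 - A$2$3 * A$3$2) - A$1$2 * (A$2$1 * A$3$3 - A$2$3 * A$3$1)
              + A$1$3 * (A$2$1 * A$3$2 - A$2$2 * A$3$1))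
  - A$1$0 * (A$0$1 * (A$2$2 * A$3$3 - A$2$3 * A$3$2) - A$0$2 * (A$2$1 * A$3$3 - A$2$3 * A$3$1)
              + A$0$3 * (A$2$1 * A$3$2 - A$2$2 * A$3$1))
  + A$2$0 * (A$0$1 * (A$1$2 * A$3$3 - A$1$3 * A$3$2) - A$0$2 * (A$1$1 * A$3$3 - A$1$3 * A$3$1)
              + A$0$3 * (A$1$1 * A$3$2 - A$1$2 * A$3$1))
  - A$3$0 * (A$0$1 * (A$1$2 * A$2$3 - A$1$3 * A$2$2) - A$0$2 * (A$1$1 * A$2$3 - A$1$3 * A$2$1)
              + A$0$3 * (A$1$1 * A$2$2 - A$1$2 * A$2$1))"
proof -
  have U: "(UNIV::4 set) = {0,1,2,3}" using UNIV_4 four_eq_zero by auto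
  have f: "finite {1::4,2,3}" "0 \<notin> {1::4,2,3}" "finite {2::4, 3}" "1 \<notin> {2::4, 3}" "finite {3::4}" "2 \<notin> {3::4}"
    by auto
  show ?thesis
    unfolding det_def U
    unfolding sum_over_permutations_insert[OF f(1,2)]
    unfolding sum_over_permutations_insert[OF f(3,4)]
    unfolding sum_over_permutations_insert[OF f(5,6)]
    unfolding permutes_sing
    by (simp add: sign_swap_id sign_id permutation_swap_id permutation_compose sign_compose swap_id_eq algebra_simps)
qed

text \<open>The cofactors of the column \<open>N\<close> in the \<open>4 \<times> 4\<close> determinant \<open>det [N, A]\<close>, with columns numbered from \<open>0\<close>.\<close>

definition cross4 :: "real^3^4 \<Rightarrow> quat" where
  "cross4 A = Quat
     (A$1$1 * (A$2$2 * A$3$3 - A$2$3 * A$3$2) - A$1$2 * (A$2$1 * A$3$3 - A$2$3 * A$3$1)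
              + A$1$3 * (A$2$1 * A$3$2 - A$2$2 * A$3$1))
     (- (A$0$1 * (A$2$2 * A$3$3 - A$2$3 * A$3$2) - A$0$2 * (A$2$1 * A$3$3 - A$2$3 * A$3$1)
              + A$0$3 * (A$2$1 * A$3$2 - A$2$2 * A$3$1)))
     (A$0$1 * (A$1$2 * A$3$3 - A$1$3 * A$3$2) - A$0$2 * (A$1$1 * A$3$3 - A$1$3 * A$3$1)
              + A$0$3 * (A$1$1 * A$3$2 - A$1$2 * A$3$1))
     (- (A$0$1 * (A$1$2 * A$2$3 - A$1$3 * A$2$2) - A$0$2 * (A$1$1 * A$2$3 - A$1$3 * A$2$1)
              + A$0$3 * (A$1$1 * A$2$2 - A$1$2 * A$2$1)))"

text \<open>By Laplace expansion this is the determinant of \<open>[A *v v, A]\<close>, whose first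
  column is a combination of the others.\<close>

lemma cross4_orthogonal: "cross4 A \<bullet> (A *v v) = 0"
  by (simp add: cross4_def inner_vec_def sum_quat matrix_vector_mult_def sum_3 algebra_simps)

text \<open>Cauchy-Binet: a Gram determinant is the sum of the squares of the maximal minors, and
  these are the components of \<open>cross4\<close> up to sign.\<close>

lemma det_transpose_mult_self: "det (transpose A ** A) = cross4 A \<bullet> cross4 A" for A :: "real^3^4"
  by (simp add: cross4_def inner_vec_def det_3 sum_quat matrix_matrix_mult_def transpose_def) algebra

text \<open>The matrix is \<open>[N, A]\<close>, since \<open>z $ 0\<close> multiplies
  \<open>N\<close>. It will be the Jacobian matrix of the straightened chart, into which the
  transversal coordinate does not enter.\<close>

lemma det_matrix_cross4:
  fixes A :: "real^3^4"
  shows "det (matrix (\<lambda>z. A *v vpart z + (z$0) *\<^sub>R N)) = cross4 A \<bullet> N"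
  by (simp add: det_quat matrix_def cross4_def inner_vec_def sum_quat matrix_vector_mult_def sum_3 axis_def algebra_simps)

subsection \<open>Splitting off the real coordinate\<close>

lemma vpart_join [simp]: "vpart (join t v) = v"
  by (simp add: vec_eq_iff forall_3)

lemma join_vpart [simp]: "join (x $ 0) (vpart x) = x"
  by (simp add: quat_eq_iff)

lemma vpart_add: "vpart (x + y) = vpart x + vpart y"
  and vpart_scaleR: "vpart (c *\<^sub>R x) = c *\<^sub>R vpart x"
  by (simp_all add: vec_eq_iff forall_3)

lemma join_add: "join (s + t) (v + w) = join s v + join t w"
  and join_scaleR: "join (c * s) (c *\<^sub>R v) = c *\<^sub>R join s v"
  by (simp_all add: quat_eq_iff)

lemma bounded_linear_vpart: "bounded_linear vpart"
  by (simp add: linear_conv_bounded_linear[symmetric] linear_iff vpart_add vpart_scaleR)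

lemma bounded_linear_join: "bounded_linear (\<lambda>p. join (fst p) (snd p))"
  by (simp add: linear_conv_bounded_linear[symmetric] linear_iff join_add join_scaleR)

lemmas has_derivative_vpart [derivative_intros] = bounded_linear.has_derivative[OF bounded_linear_vpart]
lemmas continuous_on_vpart [continuous_intros] = bounded_linear.continuous_on[OF bounded_linear_vpart]

lemma has_derivative_join [derivative_intros]:
  "(f has_derivative f') (at x within S) \<Longrightarrow> (g has_derivative g') (at x within S) \<Longrightarrow>
    ((\<lambda>x. join (f x) (g x)) has_derivative (\<lambda>h. join (f' h) (g' h))) (at x within S)"
  using bounded_linear.has_derivative[OF bounded_linear_join has_derivative_Pair, of f f' x S g g'] unfolding fst_conv snd_conv .

lemma continuous_on_join [continuous_intros]:
  "continuous_on S f \<Longrightarrow> continuous_on S g \<Longrightarrow> continuous_on S (\<lambda>x. join (f x) (g x))"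
  using bounded_linear.continuous_on[OF bounded_linear_join continuous_on_Pair, of S f g] by simp

section \<open>Lebesgue measure as a product of the real and the vector coordinates\<close>

lemma prod_Basis_cart: "(\<Prod>b\<in>Basis. (x::real^'n) \<bullet> b) = (\<Prod>i\<in>UNIV. x $ i)"
proof -
  have B: "(Basis :: (real^'n) set) = (\<lambda>i. axis i 1) ` UNIV"
    by (auto simp: Basis_vec_def)
  have "inj (\<lambda>i. axis i (1::real) :: real^'n)"
    by (simp add: inj_on_def axis_eq_axis)
  from prod.reindex[OF this, of "\<lambda>b. x \<bullet> b"] show ?thesis
    unfolding B o_def by (simp add: inner_axis)
qed

lemma prod_quat: "prod f (UNIV::4 set) = f 0 * (f 1 * f 2 * f 3)"
proof -
  have U: "(UNIV::4 set) = {0,1,2,3}" using UNIV_4 four_eq_zero by auto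
  show ?thesis unfolding U by (simp add: mult.assoc)
qed

text \<open>Lebesgue measure is determined by its values on boxes, and \<open>join\<close> turns a
  product of boxes into a box.\<close>

lemma lborel_join: "distr (lborel \<Otimes>\<^sub>M lborel) borel (\<lambda>p. join (fst p) (snd p)) = (lborel :: quat measure)"
proof (rule lborel_eqI[symmetric])
  have m: "(\<lambda>p. join (fst p) (snd p)) \<in> (lborel \<Otimes>\<^sub>M lborel) \<rightarrow>\<^sub>M borel"
    by (auto simp: lborel_prod intro!: borel_measurable_continuous_onI continuous_intros)
  fix l u :: quat
  assume le: "\<And>b. b \<in> Basis \<Longrightarrow> l \<bullet> b \<le> u \<bullet> b"
  have le': "l $ i \<le> u $ i" for i
    using le[of "axis i 1"] by (auto simp: Basis_vec_def inner_axis)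
  have le3: "vpart l $ i \<le> vpart u $ i" for i
    using exhaust_3[of i] le'[of 1] le'[of 2] le'[of 3] by (elim disjE) simp_all
  have eq: "(\<lambda>p. join (fst p) (snd p)) -` box l u = box (l$0) (u$0) \<times> box (vpart l) (vpart u)"
    by (auto simp: mem_box_cart forall_4 forall_3 four_eq_zero)
  have "emeasure (distr (lborel \<Otimes>\<^sub>M lborel) borel (\<lambda>p. join (fst p) (snd p))) (box l u)
      = emeasure (lborel \<Otimes>\<^sub>M lborel) (box (l$0) (u$0) \<times> box (vpart l) (vpart u))"
    by (subst emeasure_distr[OF m]) (simp_all add: eq space_pair_measure)
  also have "\<dots> = emeasure lborel (box (l$0) (u$0)) * emeasure lborel (box (vpart l) (vpart u))"
    by (simp add: lborel.emeasure_pair_measure_Times)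
  also have "emeasure lborel (box (vpart l) (vpart u)) = ennreal (\<Prod>b\<in>Basis. (vpart u - vpart l) \<bullet> b)"
  proof (rule emeasure_lborel_box)
    fix b :: "real^3" assume "b \<in> Basis"
    then obtain i where "b = axis i 1" by (auto simp: Basis_vec_def)
    then show "vpart l \<bullet> b \<le> vpart u \<bullet> b" using le3 by (simp add: inner_axis)
  qed
  also have "(\<Prod>b\<in>Basis. (vpart u - vpart l) \<bullet> b) = ((u$1 - l$1) * (u$2 - l$2) * (u$3 - l$3))"
    unfolding prod_Basis_cart UNIV_3 by (simp add: mult.assoc)
  also have "emeasure lborel (box (l$0) (u$0)) * ennreal ((u$1 - l$1) * (u$2 - l$2) * (u$3 - l$3))
      = ennreal (\<Prod>b\<in>Basis. (u - l) \<bullet> b)"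
    by (simp add: prod_Basis_cart prod_quat le' ennreal_mult mult.assoc)
  finally show "emeasure (distr (lborel \<Otimes>\<^sub>M lborel) borel (\<lambda>p. join (fst p) (snd p))) (box l u)
      = (\<Prod>b\<in>Basis. (u - l) \<bullet> b)" .
qed simp

text \<open>The inner integral runs over the real coordinate, because after straightening this is
  the direction \<open>N\<close> in which the fundamental theorem of calculus applies.\<close>

lemma integral_lborel_quat:
  fixes F :: "quat \<Rightarrow> 'b::euclidean_space"
  assumes "integrable lborel F"
  shows "integral\<^sup>L lborel F = (LINT v|lborel. LINT t|lborel. F (join t v))"
proof -
  have m: "(\<lambda>p. join (fst p) (snd p)) \<in> (lborel \<Otimes>\<^sub>M lborel) \<rightarrow>\<^sub>M borel"
    by (auto simp: lborel_prod intro!: borel_measurable_continuous_onI continuous_intros)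
  have F: "F \<in> borel_measurable borel"
    using borel_measurable_integrable[OF assms] by simp
  have "integrable (lborel \<Otimes>\<^sub>M lborel) (\<lambda>p. F (join (fst p) (snd p)))"
    using assms integrable_distr_eq[OF m F] by (simp add: lborel_join)
  moreover have "integral\<^sup>L lborel F = integral\<^sup>L (lborel \<Otimes>\<^sub>M lborel) (\<lambda>p. F (join (fst p) (snd p)))"
    using integral_distr[OF m F] by (simp add: lborel_join)
  ultimately show ?thesis
    using lborel_pair.integral_snd[of "\<lambda>t v. F (join t v)"] by (simp add: case_prod_beta')
qed

subsection \<open>Straightening a hypersurface\<close>

lemma
  fixes f :: "real^'n \<Rightarrow> real^'m"
  assumes "C1_on S f"
  shows C1_on_has_jacobian: "\<And>x. x \<in> S \<Longrightarrow> (f has_derivative (\<lambda>h. jacobian f (at x) *v h)) (at x)"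
    and continuous_on_jacobian: "continuous_on S (\<lambda>x. jacobian f (at x))"
proof -
  obtain f' where f': "continuous_on S f'"
    "\<And>x. x \<in> S \<Longrightarrow> (f has_derivative blinfun_apply (f' x)) (at x)"
    using assms by (auto simp: C1_on_def)
  show "(f has_derivative (\<lambda>h. jacobian f (at x) *v h)) (at x)" if "x \<in> S" for x
    using f'(2)[OF that] jacobian_works[of f "at x"] by (auto simp: differentiable_def)
  have "jacobian f (at x) = (\<chi> i j. blinfun_apply (f' x) (axis j 1) $ i)" if "x \<in> S" for x
    using frechet_derivative_at[OF f'(2)[OF that]] by (simp add: jacobian_def matrix_def)
  moreover have "continuous_on S (\<lambda>x. (\<chi> i j. blinfun_apply (f' x) (axis j 1) $ i))"
    by (intro continuous_on_vec_lambda continuous_intros f'(1))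
  ultimately show "continuous_on S (\<lambda>x. jacobian f (at x))"
    by (simp cong: continuous_on_cong)
qed

lemma continuous_on_cross4 [continuous_intros]:
  assumes "continuous_on S A" shows "continuous_on S (\<lambda>x. cross4 (A x))"
proof -
  have "continuous_on S (\<lambda>x. A x $ i $ j)" for i j
    by (intro continuous_intros assms)
  note c = this
  show ?thesis
    unfolding cross4_def Quat_def
  proof (rule continuous_on_vec_lambda, goal_cases)
    case (1 k)
    show ?case by (cases "k = 0"; cases "k = 1"; cases "k = 2") (auto intro!: continuous_intros c)
  qed
qed

text \<open>The transversal coordinate occupies the real slot, so that \<open>N\<close> becomes
  column \<open>0\<close> of the Jacobian matrix.\<close>

definition straight :: "(real^3 \<Rightarrow> quat) \<Rightarrow> quat \<Rightarrow> quat \<Rightarrow> quat" where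
  "straight \<phi> N z = \<phi> (vpart z) + (z $ 0) *\<^sub>R N"

text \<open>Radius and height are separate parameters: supports will be confined to half the height
  over the full ball.\<close>

definition tube :: "real^3 \<Rightarrow> real \<Rightarrow> real \<Rightarrow> quat set" where
  "tube w r e = {z. vpart z \<in> ball w r \<and> \<bar>z $ 0\<bar> < e}"

lemma straight_join [simp]: "straight \<phi> N (join t w) = \<phi> w + t *\<^sub>R N"
  by (simp add: straight_def)

lemma join_in_tube [simp]: "join t v \<in> tube w r e \<longleftrightarrow> v \<in> ball w r \<and> \<bar>t\<bar> < e"
  by (simp add: tube_def)

lemma open_tube: "open (tube w r e)"
  unfolding tube_def mem_ball by (intro open_Collect_conj open_Collect_less continuous_intros)

lemma tube_mono: "r \<le> r' \<Longrightarrow> e \<le> e' \<Longrightarrow> tube w r e \<subseteq> tube w r' e'"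
  by (auto simp: tube_def)

lemma tube_subset_open:
  assumes "open T" "join 0 w \<in> T"
  obtains d where "d > 0" "tube w d d \<subseteq> T"
proof -
  have "open ((\<lambda>p. join (fst p) (snd p)) -` T)"
    by (rule open_vimage[OF assms(1)]) (intro continuous_intros)
  moreover have "(0, w) \<in> (\<lambda>p. join (fst p) (snd p)) -` T" using assms(2) by simp
  ultimately obtain P Q where PQ: "open P" "open Q" "0 \<in> P" "w \<in> Q" "P \<times> Q \<subseteq> (\<lambda>p. join (fst p) (snd p)) -` T"
    by (auto elim!: open_prod_elim)
  obtain d1 where d1: "d1 > 0" "ball 0 d1 \<subseteq> P" using PQ open_contains_ball by metis
  obtain d2 where d2: "d2 > 0" "ball w d2 \<subseteq> Q" using PQ open_contains_ball by metis
  show thesis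
  proof
    show "min d1 d2 > 0" using d1 d2 by simp
    show "tube w (min d1 d2) (min d1 d2) \<subseteq> T"
    proof
      fix z assume "z \<in> tube w (min d1 d2) (min d1 d2)"
      then have "z $ 0 \<in> P" "vpart z \<in> Q" using d1(2) d2(2) by (auto simp: tube_def)
      then have "join (z $ 0) (vpart z) \<in> T" using PQ(5) by fastforce
      then show "z \<in> T" by simp
    qed
  qed
qed

lemma has_derivative_straight:
  assumes "(\<phi> has_derivative (\<lambda>h. A *v h)) (at (vpart z))"
  shows "(straight \<phi> N has_derivative (\<lambda>h. A *v vpart h + (h $ 0) *\<^sub>R N)) (at z)"
proof -
  have "(vpart has_derivative vpart) (at z)"
    by (rule bounded_linear.has_derivative[OF bounded_linear_vpart has_derivative_ident])
  from has_derivative_compose[OF this assms]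
  have "((\<lambda>x. \<phi> (vpart x)) has_derivative (\<lambda>h. A *v vpart h)) (at z)" .
  then show ?thesis unfolding straight_def
    by (intro has_derivative_add bounded_linear.has_derivative[OF bounded_linear_scaleR_left]
        bounded_linear.has_derivative[OF bounded_linear_vec_nth] has_derivative_ident)
qed

lemma straight_inverse_linear:
  assumes "cross4 A \<bullet> N \<noteq> 0"
  obtains g where "linear g" "(\<lambda>h. A *v vpart h + (h $ 0) *\<^sub>R N) \<circ> g = id"
    "g \<circ> (\<lambda>h. A *v vpart h + (h $ 0) *\<^sub>R N) = id"
proof -
  let ?f = "\<lambda>h. A *v vpart h + (h $ 0) *\<^sub>R N"
  have "linear ?f"
    by (auto simp: linear_iff vpart_add vpart_scaleR matrix_vector_right_distrib
        matrix_vector_mult_scaleR algebra_simps)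
  moreover have "invertible (matrix ?f)"
    using assms by (simp add: invertible_det_nz det_matrix_cross4)
  ultimately have "\<exists>g. linear g \<and> ?f \<circ> g = id \<and> g \<circ> ?f = id"
    using matrix_invertible[of ?f] by blast
  then show thesis
    using that by blast
qed

text \<open>The closed ball lies in \<open>W\<close> so that functions continuous on
  \<open>W\<close> are bounded, hence integrable, on the parameter ball.\<close>

locale straightening =
  fixes W :: "(real^3) set" and \<phi> :: "real^3 \<Rightarrow> quat" and N :: quat and w0 :: "real^3" and r e :: real
  assumes open_W: "open W" and C1: "C1_on W \<phi>" and r: "0 < r" and e: "0 < e"
    and cball_W: "cball w0 r \<subseteq> W"
    and inj: "inj_on (straight \<phi> N) (tube w0 r e)"
    and transversal: "\<And>w. w \<in> ball w0 r \<Longrightarrow> cross4 (jacobian \<phi> (at w)) \<bullet> N \<noteq> 0"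

text \<open>Transversality makes the derivative at \<open>join 0 w0\<close> invertible, so the
  inverse function theorem gives injectivity on a tube. The set \<open>T\<close> lets the tube be
  shrunk further, either to exclude other sheets of a surface or to stay inside a domain.\<close>

lemma straightening_exists:
  assumes W: "open W" and C1: "C1_on W \<phi>" and w0: "w0 \<in> W"
    and N: "cross4 (jacobian \<phi> (at w0)) \<bullet> N \<noteq> 0" and T: "open T" "join 0 w0 \<in> T"
  obtains d where "straightening W \<phi> N w0 d d" "tube w0 d d \<subseteq> T"
proof -
  obtain \<phi>' where \<phi>': "continuous_on W \<phi>'"
    "\<And>w. w \<in> W \<Longrightarrow> (\<phi> has_derivative blinfun_apply (\<phi>' w)) (at w)"
    using C1 by (auto simp: C1_on_def)
  \<comment> \<open>The inverse function theorem expects the derivative as a continuous family of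
    bounded linear maps, hence the packaging by \<open>Blinfun\<close>.\<close>
  define L where "L = (\<lambda>z. (\<phi>' (vpart z) o\<^sub>L Blinfun vpart) + Blinfun (\<lambda>h. h $ 0 *\<^sub>R N))"
  have bl: "bounded_linear (\<lambda>h::quat. h $ 0 *\<^sub>R N)"
    by (rule bounded_linear_scaleR_const) (rule bounded_linear_vec_nth)
  have app: "blinfun_apply (L z) = (\<lambda>h. blinfun_apply (\<phi>' (vpart z)) (vpart h) + h $ 0 *\<^sub>R N)" for z
    by (simp add: L_def fun_eq_iff blinfun.add_left bounded_linear_Blinfun_apply[OF bl]
        bounded_linear_Blinfun_apply[OF bounded_linear_vpart])
  have jac: "blinfun_apply (\<phi>' w) = (\<lambda>h. jacobian \<phi> (at w) *v h)" if "w \<in> W" for w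
    using has_derivative_unique[OF \<phi>'(2)[OF that] C1_on_has_jacobian[OF C1 that]] .
  let ?U = "{z. vpart z \<in> W}"
  have oU: "open ?U"
  proof -
    have "?U = vpart -` W" by auto
    then show ?thesis using open_vimage[OF W, of vpart] continuous_on_vpart[OF continuous_on_id] by simp
  qed
  have der: "(straight \<phi> N has_derivative blinfun_apply (L z)) (at z)" if "z \<in> ?U" for z
    using has_derivative_straight[OF C1_on_has_jacobian[OF C1, of "vpart z"]] that
    by (simp add: app jac)
  have cont: "continuous_on ?U L"
    unfolding L_def
    by (intro continuous_intros bounded_bilinear.continuous_on[OF bounded_bilinear_blinfun_compose]
        continuous_on_compose2[OF \<phi>'(1)]) auto
  obtain g where g: "linear g" "(\<lambda>h. jacobian \<phi> (at w0) *v vpart h + (h $ 0) *\<^sub>R N) \<circ> g = id"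
    "g \<circ> (\<lambda>h. jacobian \<phi> (at w0) *v vpart h + (h $ 0) *\<^sub>R N) = id"
    using straight_inverse_linear[OF N] by blast
  have g': "bounded_linear g" using g(1) by (simp add: linear_conv_bounded_linear)
  have inv: "Blinfun g o\<^sub>L L (join 0 w0) = id_blinfun"
    using g(3) w0 by (intro blinfun_eqI)
      (simp add: app jac bounded_linear_Blinfun_apply[OF g'] fun_eq_iff)
  obtain U' V' G G' where U': "open U'" "join 0 w0 \<in> U'" "homeomorphism U' V' (straight \<phi> N) G"
    using inverse_function_theorem[OF oU der cont _ inv] w0 by (metis mem_Collect_eq vpart_join)
  have "open {w \<in> W. cross4 (jacobian \<phi> (at w)) \<bullet> N \<noteq> 0}"
  proof -
    have "continuous_on W (\<lambda>w. cross4 (jacobian \<phi> (at w)) \<bullet> N)"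
      by (intro continuous_intros continuous_on_jacobian[OF C1])
    then have "open (W \<inter> (\<lambda>w. cross4 (jacobian \<phi> (at w)) \<bullet> N) -` (- {0}))"
      using continuous_open_preimage[OF _ W] by blast
    moreover have "W \<inter> (\<lambda>w. cross4 (jacobian \<phi> (at w)) \<bullet> N) -` (- {0}) =
      {w \<in> W. cross4 (jacobian \<phi> (at w)) \<bullet> N \<noteq> 0}" by auto
    ultimately show ?thesis by simp
  qed
  then obtain d1 where d1: "d1 > 0" "cball w0 d1 \<subseteq> {w \<in> W. cross4 (jacobian \<phi> (at w)) \<bullet> N \<noteq> 0}"
    unfolding open_contains_cball using w0 N by blast
  obtain d2 where d2: "d2 > 0" "tube w0 d2 d2 \<subseteq> U' \<inter> T"
    using tube_subset_open[of "U' \<inter> T" w0] U' T by blast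
  show thesis
  proof
    show "straightening W \<phi> N w0 (min d1 d2) (min d1 d2)"
    proof
      show "cball w0 (min d1 d2) \<subseteq> W" using d1 by auto
      have "inj_on (straight \<phi> N) U'" using U'(3) by (metis homeomorphism_def inj_on_inverseI)
      moreover have "tube w0 (min d1 d2) (min d1 d2) \<subseteq> U'"
        using tube_mono[of "min d1 d2" d2 "min d1 d2" d2 w0] d2 by auto
      ultimately show "inj_on (straight \<phi> N) (tube w0 (min d1 d2) (min d1 d2))"
        by (rule inj_on_subset)
      show "cross4 (jacobian \<phi> (at w)) \<bullet> N \<noteq> 0" if "w \<in> ball w0 (min d1 d2)" for w
        using that subsetD[OF d1(2), of w] by simp
    qed (use W C1 d1 d2 in auto)
    show "tube w0 (min d1 d2) (min d1 d2) \<subseteq> T"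
      using tube_mono[of "min d1 d2" d2 "min d1 d2" d2 w0] d2 by auto
  qed
qed

context straightening
begin

lemma ball_W: "ball w0 r \<subseteq> W" using cball_W by auto

lemma deriv_straight: "z \<in> tube w0 r e \<Longrightarrow>
  (straight \<phi> N has_derivative (\<lambda>h. jacobian \<phi> (at (vpart z)) *v vpart h + (h $ 0) *\<^sub>R N)) (at z)"
  by (rule has_derivative_straight[OF C1_on_has_jacobian[OF C1]]) (use ball_W in \<open>auto simp: tube_def\<close>)

lemma continuous_straight: "continuous_on (tube w0 r e) (straight \<phi> N)"
  by (rule has_derivative_continuous_on[OF has_derivative_at_withinI[OF deriv_straight]])

lemma open_straight_image: "open T \<Longrightarrow> T \<subseteq> tube w0 r e \<Longrightarrow> open (straight \<phi> N ` T)"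
  using continuous_on_subset[OF continuous_straight] inj_on_subset[OF inj] by (intro invariance_of_domain) auto

text \<open>The equations say that \<open>vpart (g y)\<close> and \<open>g y $ 0\<close> are the
  coordinates of \<open>y\<close> in the splitting of space into the tangent space of the
  parametrized sheet and the line spanned by \<open>N\<close>.\<close>

lemma inverse_straight_deriv:
  assumes "z \<in> tube w0 r e"
  obtains g where "linear g"
    "(inv_into (tube w0 r e) (straight \<phi> N) has_derivative g) (at (straight \<phi> N z))"
    "\<And>v. g (jacobian \<phi> (at (vpart z)) *v v) = join 0 v"
    "g N = axis 0 1"
    "\<And>y. jacobian \<phi> (at (vpart z)) *v vpart (g y) + (g y $ 0) *\<^sub>R N = y"
proof -
  have "cross4 (jacobian \<phi> (at (vpart z))) \<bullet> N \<noteq> 0" using assms transversal by (auto simp: tube_def)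
  from straight_inverse_linear[OF this] obtain g where g: "linear g"
    "(\<lambda>h. jacobian \<phi> (at (vpart z)) *v vpart h + (h $ 0) *\<^sub>R N) \<circ> g = id"
    "g \<circ> (\<lambda>h. jacobian \<phi> (at (vpart z)) *v vpart h + (h $ 0) *\<^sub>R N) = id" .
  show thesis
  proof
    show "linear g" by fact
    show "(inv_into (tube w0 r e) (straight \<phi> N) has_derivative g) (at (straight \<phi> N z))"
      by (rule has_derivative_inverse_strong[OF open_tube assms continuous_straight _ deriv_straight[OF assms] g(2)])
        (simp add: inj)
    have g3: "g (jacobian \<phi> (at (vpart z)) *v vpart h + (h $ 0) *\<^sub>R N) = h" for h
      using g(3) by (simp add: fun_eq_iff)
    show "g (jacobian \<phi> (at (vpart z)) *v v) = join 0 v" for v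
      using g3[of "join 0 v"] by simp
    have "vpart (axis 0 1) = 0" by (simp add: vec_eq_iff forall_3 axis_def)
    then show "g N = axis 0 1"
      using g3[of "axis 0 1"] by (simp add: axis_def)
    show "jacobian \<phi> (at (vpart z)) *v vpart (g y) + (g y $ 0) *\<^sub>R N = y" for y
      using g(2) by (simp add: fun_eq_iff)
  qed
qed

end

text \<open>A tube could be crossed by other sheets of \<open>S\<close>. A parametrized piece is
  relatively open, hence cut out of \<open>S\<close> by an open set \<open>B\<close>, and a tube
  mapped into \<open>B\<close> meets no other sheet.\<close>

lemma surface_straightening:
  assumes lp: "local_param S W \<phi>" and w0: "w0 \<in> W"
    and N: "cross4 (jacobian \<phi> (at w0)) \<bullet> N \<noteq> 0"
  obtains d where "straightening W \<phi> N w0 d d" "straight \<phi> N ` tube w0 d d \<inter> S = \<phi> ` ball w0 d"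
proof -
  have W: "open W" and C1: "C1_on W \<phi>" and op: "openin (top_of_set S) (\<phi> ` W)"
    using lp by (auto simp: local_param_def)
  obtain \<psi> where hom: "homeomorphism W (\<phi> ` W) \<phi> \<psi>" using lp by (auto simp: local_param_def)
  obtain d0 where d0: "straightening W \<phi> N w0 d0 d0"
    using straightening_exists[OF W C1 w0 N open_UNIV] by auto
  interpret s0: straightening W \<phi> N w0 d0 d0 by fact
  have "openin (top_of_set (\<phi> ` W)) (\<phi> ` ball w0 d0)"
    using s0.ball_W by (intro homeomorphism_imp_open_map[OF hom]) (simp add: open_openin_trans W open_subset)
  then have "openin (top_of_set S) (\<phi> ` ball w0 d0)"
    using op openin_trans by blast
  then obtain B where B: "open B" "\<phi> ` ball w0 d0 = S \<inter> B" by (auto simp: openin_open)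
  define T where "T = tube w0 d0 d0 \<inter> straight \<phi> N -` B"
  have "open T" unfolding T_def
    by (rule continuous_open_preimage[OF s0.continuous_straight open_tube B(1)])
  moreover have "join 0 w0 \<in> T" using s0.r B(2) by (auto simp: T_def)
  ultimately obtain d where d: "straightening W \<phi> N w0 d d" "tube w0 d d \<subseteq> T"
    using straightening_exists[OF W C1 w0 N] by metis
  interpret s1: straightening W \<phi> N w0 d d by fact
  have "straight \<phi> N ` tube w0 d d \<inter> S = \<phi> ` ball w0 d"
  proof safe
    fix z assume z: "z \<in> tube w0 d d" "straight \<phi> N z \<in> S"
    then have "straight \<phi> N z \<in> \<phi> ` ball w0 d0" "z \<in> tube w0 d0 d0" using d(2) B(2) by (auto simp: T_def)
    then obtain w where w: "w \<in> ball w0 d0" "straight \<phi> N z = \<phi> w" by blast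
    then have "straight \<phi> N z = straight \<phi> N (join 0 w)" by simp
    \<comment> \<open>The point \<open>w\<close> is only known to lie in the larger ball, so
      injectivity on the larger tube is used; it then places \<open>w\<close> in the smaller
      ball.\<close>
    then have "z = join 0 w"
      using inj_onD[OF s0.inj, of z "join 0 w"] \<open>z \<in> tube w0 d0 d0\<close> w s0.e by simp
    then show "straight \<phi> N z \<in> \<phi> ` ball w0 d" using z by auto
  next
    fix w assume w: "w \<in> ball w0 d"
    then have *: "join 0 w \<in> tube w0 d d" using s1.e by simp
    show "\<phi> w \<in> straight \<phi> N ` tube w0 d d" by (rule image_eqI[OF _ *]) simp
    have "tube w0 d d \<subseteq> tube w0 d0 d0" using d(2) by (simp add: T_def)
    from subsetD[OF this *] show "\<phi> w \<in> S" using B(2) by auto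
  qed
  with d(1) that show thesis by blast
qed

subsection \<open>The surface measure\<close>

text \<open>A bridge from extended nonnegative integrals to absolute integrability, the language of
  the change of variables theorem. The conjunct \<open>0 \<le> b\<close> is there because
  \<open>ennreal\<close> maps every negative number to \<open>0\<close>.\<close>

lemma set_nn_integral_eq_ennreal_iff:
  fixes g :: "'a::euclidean_space \<Rightarrow> real"
  assumes m: "(\<lambda>x. indicator S x * g x) \<in> borel_measurable borel" and nn: "\<And>x. x \<in> S \<Longrightarrow> 0 \<le> g x"
  shows "(\<integral>\<^sup>+x\<in>S. g x \<partial>lborel) = ennreal b \<and> 0 \<le> b \<longleftrightarrow> g absolutely_integrable_on S \<and> integral S g = b"
proof -
  let ?k = "\<lambda>x. indicator S x * g x"
  have "(\<integral>\<^sup>+x\<in>S. g x \<partial>lborel) = (\<integral>\<^sup>+x. ennreal (?k x) \<partial>lborel)"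
    by (intro nn_integral_cong) (auto simp: indicator_def)
  also have "\<dots> = (\<integral>\<^sup>+x. ennreal (?k x) \<partial>lebesgue)"
    using m by (simp add: nn_integral_completion)
  finally have eq: "(\<integral>\<^sup>+x\<in>S. g x \<partial>lborel) = (\<integral>\<^sup>+x. ennreal (?k x) \<partial>lebesgue)" .
  have "?k = (\<lambda>x. if x \<in> S then g x else 0)" by (auto simp: indicator_def)
  then have "(?k has_integral b) UNIV \<longleftrightarrow> (g has_integral b) S"
    using has_integral_restrict_UNIV by metis
  moreover have "?k \<in> borel_measurable lebesgue"
    using m by (simp add: measurable_completion)
  ultimately show ?thesis
    unfolding eq using has_integral_iff_nn_integral_lebesgue[of ?k b] nn
    by (auto simp: absolutely_integrable_on_iff_nonneg has_integral_iff indicator_def)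
qed

text \<open>The change of variables theorem concerns vector-valued functions, so scalars pass
  through \<open>real^1\<close>. It shows that both sides have the same finite values; if one side
  is infinite, the other cannot be finite.\<close>

lemma nn_integral_change_of_variables:
  fixes T :: "real^'n::{finite,wellorder} \<Rightarrow> real^'n::_" and f h :: "real^'n::_ \<Rightarrow> real"
  assumes S: "S \<in> sets borel"
    and der: "\<And>x. x \<in> S \<Longrightarrow> (T has_derivative T' x) (at x within S)" and inj: "inj_on T S"
    and f: "(\<lambda>y. indicator (T ` S) y * f y) \<in> borel_measurable borel" "\<And>y. y \<in> T ` S \<Longrightarrow> 0 \<le> f y"
    and h: "(\<lambda>x. indicator S x * h x) \<in> borel_measurable borel"
    and eq: "\<And>x. x \<in> S \<Longrightarrow> h x = \<bar>det (matrix (T' x))\<bar> * f (T x)"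
  shows "(\<integral>\<^sup>+x\<in>S. h x \<partial>lborel) = (\<integral>\<^sup>+y\<in>T ` S. f y \<partial>lborel)"
proof -
  let ?d = "\<lambda>x. \<bar>det (matrix (T' x))\<bar>"
  have S': "S \<in> sets lebesgue" using S by simp
  have "(\<lambda>x. ?d x *\<^sub>R (vec (f (T x)) :: real^1)) absolutely_integrable_on S \<and>
      integral S (\<lambda>x. ?d x *\<^sub>R (vec (f (T x)) :: real^1)) = vec b \<longleftrightarrow>
      (\<lambda>y. vec (f y) :: real^1) absolutely_integrable_on (T ` S) \<and>
      integral (T ` S) (\<lambda>y. vec (f y) :: real^1) = vec b" for b
    using has_absolute_integral_change_of_variables[OF S' der inj, of "\<lambda>y. vec (f y)" "vec b"] .
  then have "(\<lambda>x. ?d x * f (T x)) absolutely_integrable_on S \<and> integral S (\<lambda>x. ?d x * f (T x)) = b \<longleftrightarrow>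
      f absolutely_integrable_on (T ` S) \<and> integral (T ` S) f = b" for b
    by (simp add: absolutely_integrable_on_1_iff integral_on_1_eq vec_eq_iff)
  moreover have "h absolutely_integrable_on S \<longleftrightarrow> (\<lambda>x. ?d x * f (T x)) absolutely_integrable_on S"
    by (intro set_integrable_cong) (simp_all add: eq)
  moreover have "integral S h = integral S (\<lambda>x. ?d x * f (T x))"
    by (intro Henstock_Kurzweil_Integration.integral_cong) (simp add: eq)
  moreover have "\<And>x. x \<in> S \<Longrightarrow> 0 \<le> h x" using eq f(2) by simp
  ultimately have iff: "(\<integral>\<^sup>+x\<in>S. h x \<partial>lborel) = ennreal b \<and> 0 \<le> b \<longleftrightarrow>
      (\<integral>\<^sup>+y\<in>T ` S. f y \<partial>lborel) = ennreal b \<and> 0 \<le> b" for b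
    using set_nn_integral_eq_ennreal_iff[OF h] set_nn_integral_eq_ennreal_iff[OF f] by simp
  show ?thesis
  proof (cases "\<integral>\<^sup>+x\<in>S. h x \<partial>lborel")
    case (real b)
    then show ?thesis using iff[of b] by simp
  next
    case top
    then show ?thesis
    proof (cases "\<integral>\<^sup>+y\<in>T ` S. f y \<partial>lborel")
      case (real b)
      then show ?thesis using iff[of b] by simp
    qed simp
  qed
qed

lemma local_paramD:
  assumes "local_param S W \<phi>"
  shows "open W" "openin (top_of_set S) (\<phi> ` W)" "C1_on W \<phi>" "inj_on \<phi> W" "continuous_on W \<phi>"
    "continuous_on (\<phi> ` W) (inv_into W \<phi>)"
proof -
  obtain \<psi> where hom: "homeomorphism W (\<phi> ` W) \<phi> \<psi>" using assms by (auto simp: local_param_def)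
  show "open W" "openin (top_of_set S) (\<phi> ` W)" "C1_on W \<phi>"
    using assms by (auto simp: local_param_def)
  show inj: "inj_on \<phi> W" using hom by (metis homeomorphism_def inj_on_inverseI)
  show "continuous_on W \<phi>" using hom by (simp add: homeomorphism_def)
  have "inv_into W \<phi> y = \<psi> y" if "y \<in> \<phi> ` W" for y
    using that hom inj by (auto simp: homeomorphism_def)
  then show "continuous_on (\<phi> ` W) (inv_into W \<phi>)"
    using hom by (simp add: homeomorphism_def cong: continuous_on_cong)
qed

text \<open>If \<open>A\<close> is injective, so is its Gram matrix, because \<open>v\<close> paired
  with the Gram matrix applied to \<open>v\<close> is the squared length of \<open>A *v v\<close>.
  The Gram determinant is the squared length of \<open>cross4 A\<close>.\<close>

lemma local_param_cross4_nonzero: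
  assumes "local_param S W \<phi>" "w \<in> W"
  shows "cross4 (jacobian \<phi> (at w)) \<noteq> 0"
proof -
  let ?A = "jacobian \<phi> (at w)"
  have "inj (frechet_derivative \<phi> (at w))" using assms by (auto simp: local_param_def)
  then have inj: "inj (\<lambda>h. ?A *v h)"
    using frechet_derivative_at[OF C1_on_has_jacobian[OF local_paramD(3)[OF assms(1)] assms(2)]] by simp
  have "v = 0" if "(transpose ?A ** ?A) *v v = 0" for v
  proof -
    have "(transpose ?A ** ?A) *v v = (?A *v v) v* ?A"
      by (simp only: matrix_vector_mul_assoc[symmetric] transpose_matrix_vector)
    then have "0 = ((?A *v v) v* ?A) \<bullet> v" using that by simp
    also have "\<dots> = (?A *v v) \<bullet> (?A *v v)"
      by (rule dot_lmul_matrix)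
    finally have "?A *v v = ?A *v 0" by simp
    then show "v = 0" using injD[OF inj] by blast
  qed
  then have "invertible (transpose ?A ** ?A)"
    using matrix_left_invertible_ker invertible_left_inverse by blast
  then have "det (transpose ?A ** ?A) \<noteq> 0" by (simp add: invertible_det_nz)
  then show ?thesis by (auto simp: det_transpose_mult_self)
qed

section \<open>Patch measures and their compatibility\<close>

lemma sqrt_gram: "sqrt (det (transpose A ** A)) = norm (cross4 A)" for A :: "real^3^4"
  by (simp add: det_transpose_mult_self norm_eq_sqrt_inner)

text \<open>The Gram determinant picks up \<open>det B\<close> twice. This is the transformation law
  of the surface density under reparametrization.\<close>

lemma norm_cross4_mult: "norm (cross4 (A ** B)) = \<bar>det B\<bar> * norm (cross4 A)" for A :: "real^3^4" and B :: "real^3^3"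
proof -
  have "det (transpose (A ** B) ** (A ** B)) = det (transpose B ** (transpose A ** A) ** B)"
    by (simp add: matrix_transpose_mul matrix_mul_assoc)
  also have "\<dots> = (det B)\<^sup>2 * det (transpose A ** A)"
    by (simp add: det_mul power2_eq_square)
  finally show ?thesis
    by (simp add: sqrt_gram[symmetric] real_sqrt_mult)
qed

text \<open>The space is restricted to \<open>W\<close> because \<open>\<phi>\<close> is controlled
  only there and need not be measurable as a function on all of \<open>real^3\<close>.\<close>

definition patch_measure :: "(real^3) set \<Rightarrow> (real^3 \<Rightarrow> quat) \<Rightarrow> quat measure" where
  "patch_measure W \<phi> =
     distr (density (restrict_space lborel W) (\<lambda>w. ennreal (norm (cross4 (jacobian \<phi> (at w)))))) borel \<phi>"

lemma sets_patch_measure [simp]: "sets (patch_measure W \<phi>) = sets borel"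
  by (simp add: patch_measure_def)

lemma measurable_on_restrict_lborel:
  "W \<in> sets borel \<Longrightarrow> continuous_on W f \<Longrightarrow> f \<in> restrict_space lborel W \<rightarrow>\<^sub>M borel"
  using borel_measurable_continuous_on_restrict[of W f]
  by (subst measurable_cong_sets[OF sets_restrict_space_cong[OF sets_lborel] refl])

lemma patch_density_measurable:
  assumes "open W" "C1_on W \<phi>"
  shows "(\<lambda>w. norm (cross4 (jacobian \<phi> (at w)))) \<in> borel_measurable (restrict_space lborel W)"
    "\<phi> \<in> restrict_space lborel W \<rightarrow>\<^sub>M borel"
proof -
  show "(\<lambda>w. norm (cross4 (jacobian \<phi> (at w)))) \<in> borel_measurable (restrict_space lborel W)"
    using assms by (intro measurable_on_restrict_lborel continuous_intros continuous_on_jacobian) auto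
  have "continuous_on W \<phi>"
    by (rule has_derivative_continuous_on[OF has_derivative_at_withinI[OF C1_on_has_jacobian[OF assms(2)]]])
  then show "\<phi> \<in> restrict_space lborel W \<rightarrow>\<^sub>M borel"
    using assms by (intro measurable_on_restrict_lborel) auto
qed

lemma emeasure_patch_measure:
  assumes "open W" "C1_on W \<phi>" and A: "A \<in> sets borel"
  shows "emeasure (patch_measure W \<phi>) A =
    (\<integral>\<^sup>+w\<in>W \<inter> \<phi> -` A. ennreal (norm (cross4 (jacobian \<phi> (at w)))) \<partial>lborel)"
proof -
  note [measurable] = patch_density_measurable[OF assms(1,2)]
  have W: "W \<inter> space lborel \<in> sets lborel" using assms(1) by simp
  have "\<phi> -` A \<inter> space (restrict_space lborel W) \<in> sets (restrict_space lborel W)"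
    using A by (intro measurable_sets[OF patch_density_measurable(2)[OF assms(1,2)]])
  then have m: "\<phi> -` A \<inter> W \<in> sets (restrict_space lborel W)" by (simp add: space_restrict_space)
  have "emeasure (patch_measure W \<phi>) A =
    (\<integral>\<^sup>+w. ennreal (norm (cross4 (jacobian \<phi> (at w)))) * indicator (\<phi> -` A \<inter> W) w \<partial>restrict_space lborel W)"
    unfolding patch_measure_def using A m
    by (subst emeasure_distr) (auto simp: space_restrict_space emeasure_density)
  also have "\<dots> = (\<integral>\<^sup>+w. ennreal (norm (cross4 (jacobian \<phi> (at w)))) * indicator (\<phi> -` A \<inter> W) w * indicator W w \<partial>lborel)"
    by (rule nn_integral_restrict_space[OF W])
  also have "\<dots> = (\<integral>\<^sup>+w\<in>W \<inter> \<phi> -` A. ennreal (norm (cross4 (jacobian \<phi> (at w)))) \<partial>lborel)"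
    by (intro nn_integral_cong) (auto simp: indicator_def)
  finally show ?thesis .
qed

text \<open>The inverse of a parametrization lives on a surface and cannot be differentiated
  directly. The inverse of the straightened \<open>\<phi>2\<close> lives on an open set of
  \<open>real^4\<close>, and composed with \<open>\<phi>1\<close> it is the transition map with real
  coordinate \<open>0\<close>.\<close>

lemma transition_derivative:
  assumes lp1: "local_param S W1 \<phi>1" and lp2: "local_param S W2 \<phi>2"
    and w: "w \<in> W1" "\<phi>1 w \<in> \<phi>2 ` W2"
  obtains T' where "((\<lambda>w. inv_into W2 \<phi>2 (\<phi>1 w)) has_derivative T') (at w)"
    "norm (cross4 (jacobian \<phi>1 (at w))) =
      \<bar>det (matrix T')\<bar> * norm (cross4 (jacobian \<phi>2 (at (inv_into W2 \<phi>2 (\<phi>1 w)))))"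
proof -
  note 1 = local_paramD[OF lp1] and 2 = local_paramD[OF lp2]
  obtain v where v: "v \<in> W2" "\<phi>1 w = \<phi>2 v" using w by auto
  have v': "inv_into W2 \<phi>2 (\<phi>1 w) = v" using v 2(4) by simp
  define A1 where "A1 = jacobian \<phi>1 (at w)"
  define A2 where "A2 = jacobian \<phi>2 (at v)"
  \<comment> \<open>The cross product is transversal to its own surface, since
    \<open>N \<bullet> N\<close> is positive.\<close>
  define N where "N = cross4 A2"
  have "cross4 (jacobian \<phi>2 (at v)) \<bullet> N \<noteq> 0"
    using local_param_cross4_nonzero[OF lp2 v(1)] by (simp add: N_def A2_def)
  from surface_straightening[OF lp2 v(1) this] obtain d where d: "straightening W2 \<phi>2 N v d d"
    "straight \<phi>2 N ` tube v d d \<inter> S = \<phi>2 ` ball v d" .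
  interpret s: straightening W2 \<phi>2 N v d d by fact
  let ?\<Phi> = "straight \<phi>2 N" and ?\<Psi> = "inv_into (tube v d d) (straight \<phi>2 N)"
  have z: "join 0 v \<in> tube v d d" using s.e by simp
  from s.inverse_straight_deriv[OF z, unfolded straight_join vpart_join scaleR_zero_left add_0_right, folded A2_def]
  obtain g where g: "linear g" "(?\<Psi> has_derivative g) (at (\<phi>2 v))"
    "\<And>u. g (A2 *v u) = join 0 u" "g N = axis 0 1" "\<And>y. A2 *v vpart (g y) + (g y $ 0) *\<^sub>R N = y"
    by blast
  have "(?\<Psi> has_derivative g) (at (\<phi>1 w))" using g(2) v(2) by simp
  from has_derivative_compose[OF C1_on_has_jacobian[OF 1(3) w(1)] this]
  have der: "((\<lambda>w. ?\<Psi> (\<phi>1 w)) has_derivative (\<lambda>h. g (A1 *v h))) (at w)" by (simp add: A1_def)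
  define B where "B = W1 \<inter> \<phi>1 -` (?\<Phi> ` tube v d d)"
  have B: "open B" unfolding B_def
    by (rule continuous_open_preimage[OF 1(5) 1(1) s.open_straight_image]) (auto simp: open_tube)
  have wB: "w \<in> B" using w v z by (auto simp: B_def intro!: image_eqI[of _ _ "join 0 v"])
  have onB: "?\<Psi> (\<phi>1 u) = join 0 (inv_into W2 \<phi>2 (\<phi>1 u))" if u: "u \<in> B" for u
  proof -
    have "\<phi>1 u \<in> S" using u 1(2) by (auto simp: B_def dest: openin_imp_subset)
    then have "\<phi>1 u \<in> \<phi>2 ` ball v d" using u d(2) by (auto simp: B_def)
    then obtain x where x: "x \<in> ball v d" "\<phi>1 u = \<phi>2 x" by blast
    have "?\<Psi> (?\<Phi> (join 0 x)) = join 0 x" using x s.e by (intro inv_into_f_f s.inj) simp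
    moreover have "inv_into W2 \<phi>2 (\<phi>2 x) = x" using x(1) s.ball_W 2(4) by (intro inv_into_f_f) auto
    ultimately show ?thesis by (simp add: x(2))
  qed
  have ev: "\<forall>\<^sub>F u in at w. u \<in> B" using B wB by (simp add: eventually_at_topological) blast
  define T' where "T' = (\<lambda>h. vpart (g (A1 *v h)))"
  have T': "((\<lambda>u. inv_into W2 \<phi>2 (\<phi>1 u)) has_derivative T') (at w)"
    unfolding T'_def
  proof (rule has_derivative_transform_eventually[OF has_derivative_vpart[OF der]])
    show "\<forall>\<^sub>F u in at w. vpart (?\<Psi> (\<phi>1 u)) = inv_into W2 \<phi>2 (\<phi>1 u)"
      using ev by eventually_elim (simp add: onB)
  qed (simp_all add: onB wB)
  \<comment> \<open>The real coordinate is constantly \<open>0\<close> near \<open>w\<close>, so its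
    derivative vanishes. Hence the tangent vectors of \<open>\<phi>1\<close> have no
    \<open>N\<close>-component and factor through \<open>A2\<close>.\<close>
  have "((\<lambda>u. ?\<Psi> (\<phi>1 u) $ 0) has_derivative (\<lambda>h. g (A1 *v h) $ 0)) (at w)"
    by (rule bounded_linear.has_derivative[OF bounded_linear_vec_nth der])
  moreover have "((\<lambda>u. ?\<Psi> (\<phi>1 u) $ 0) has_derivative (\<lambda>h. 0)) (at w)"
  proof (rule has_derivative_transform_eventually[OF has_derivative_const])
    show "\<forall>\<^sub>F u in at w. 0 = ?\<Psi> (\<phi>1 u) $ 0" using ev by eventually_elim (simp add: onB)
  qed (simp_all add: onB wB)
  ultimately have "(\<lambda>h. g (A1 *v h) $ 0) = (\<lambda>h. 0)" by (rule has_derivative_unique)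
  then have "A2 *v T' h = A1 *v h" for h
    using g(5)[of "A1 *v h"] by (simp add: T'_def fun_eq_iff)
  moreover have "T' h = matrix T' *v h" for h
    using has_derivative_linear[OF T'] by (simp add: matrix_works)
  ultimately have "(A2 ** matrix T') *v h = A1 *v h" for h
    by (simp add: matrix_vector_mul_assoc[symmetric])
  then have "A1 = A2 ** matrix T'" by (simp add: matrix_eq)
  then have "norm (cross4 A1) = \<bar>det (matrix T')\<bar> * norm (cross4 A2)" by (simp add: norm_cross4_mult)
  with T' show thesis using that v' by (simp add: A1_def A2_def)
qed

text \<open>Change of variables along the transition map, whose Jacobian is exactly the quotient of
  the two densities. This makes the surface measure independent of the parametrization.\<close>

lemma patch_measure_unique:
  assumes lp1: "local_param S W1 \<phi>1" and lp2: "local_param S W2 \<phi>2"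
    and A: "A \<in> sets borel" "A \<subseteq> \<phi>1 ` W1" "A \<subseteq> \<phi>2 ` W2"
  shows "emeasure (patch_measure W1 \<phi>1) A = emeasure (patch_measure W2 \<phi>2) A"
proof -
  note 1 = local_paramD[OF lp1] and 2 = local_paramD[OF lp2]
  define D where "D = W1 \<inter> \<phi>1 -` A"
  define E where "E = W2 \<inter> \<phi>2 -` A"
  define T where "T w = inv_into W2 \<phi>2 (\<phi>1 w)" for w
  define J1 where "J1 w = norm (cross4 (jacobian \<phi>1 (at w)))" for w
  define J2 where "J2 w = norm (cross4 (jacobian \<phi>2 (at w)))" for w
  have D: "D \<in> sets borel" unfolding D_def Int_commute[of W1]
    using borel_measurable_continuous_on_restrict[OF 1(5)] A(1) 1(1)
    by (auto simp: measurable_restrict_space1 sets_restrict_space_iff space_restrict_space dest!: measurable_sets)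
  have E: "E \<in> sets borel" unfolding E_def Int_commute[of W2]
    using borel_measurable_continuous_on_restrict[OF 2(5)] A(1) 2(1)
    by (auto simp: measurable_restrict_space1 sets_restrict_space_iff space_restrict_space dest!: measurable_sets)
  have \<phi>2T: "\<phi>2 (T w) = \<phi>1 w" "T w \<in> W2" if "w \<in> D" for w
    using that A(3) by (auto simp: T_def D_def intro!: f_inv_into_f inv_into_into)
  have TD: "T ` D = E"
  proof safe
    fix w assume "w \<in> D" then show "T w \<in> E" using \<phi>2T[of w] by (auto simp: E_def D_def)
  next
    fix v assume v: "v \<in> E"
    then obtain w where w: "w \<in> W1" "\<phi>2 v = \<phi>1 w" using A(2) by (auto simp: E_def)
    then have "w \<in> D" "T w = v" using v 2(4) by (auto simp: E_def D_def T_def w(2)[symmetric])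
    then show "v \<in> T ` D" by blast
  qed
  have inj: "inj_on T D"
  proof (rule inj_onI)
    fix u w assume "u \<in> D" "w \<in> D" "T u = T w"
    then have "\<phi>1 u = \<phi>1 w" using \<phi>2T by metis
    then show "u = w" using \<open>u \<in> D\<close> \<open>w \<in> D\<close> 1(4) by (auto simp: D_def dest: inj_onD)
  qed
  have "\<exists>T'. (T has_derivative T') (at w) \<and> J1 w = \<bar>det (matrix T')\<bar> * J2 (T w)" if "w \<in> D" for w
  proof -
    have "w \<in> W1" "\<phi>1 w \<in> \<phi>2 ` W2" using that A(3) by (auto simp: D_def)
    from transition_derivative[OF lp1 lp2 this] show ?thesis unfolding T_def J1_def J2_def by metis
  qed
  then obtain T' where T': "\<And>w. w \<in> D \<Longrightarrow> (T has_derivative T' w) (at w)"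
    "\<And>w. w \<in> D \<Longrightarrow> J1 w = \<bar>det (matrix (T' w))\<bar> * J2 (T w)"
    by metis
  have cont: "continuous_on D J1" "continuous_on E J2" unfolding J1_def J2_def D_def E_def
    using continuous_on_subset[OF continuous_on_jacobian[OF 1(3)]]
      continuous_on_subset[OF continuous_on_jacobian[OF 2(3)]] by (intro continuous_intros; simp)+
  have "(\<integral>\<^sup>+x\<in>D. J1 x \<partial>lborel) = (\<integral>\<^sup>+y\<in>T ` D. J2 y \<partial>lborel)"
  proof (rule nn_integral_change_of_variables[OF D _ inj])
    show "(T has_derivative T' x) (at x within D)" if "x \<in> D" for x
      using T'(1)[OF that] by (rule has_derivative_at_withinI)
    show "(\<lambda>y. indicator (T ` D) y * J2 y) \<in> borel_measurable borel"
      using borel_measurable_continuous_on_indicator[OF E cont(2)] by (simp add: TD)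
    show "(\<lambda>y. indicator D y * J1 y) \<in> borel_measurable borel"
      using borel_measurable_continuous_on_indicator[OF D cont(1)] by simp
    show "0 \<le> J2 y" for y by (simp add: J2_def)
  qed (rule T'(2))
  then show ?thesis
    using emeasure_patch_measure[OF 1(1,3) A(1)] emeasure_patch_measure[OF 2(1,3) A(1)]
    unfolding TD by (simp add: D_def E_def J1_def J2_def)
qed

lemma is_surface_measure_iff:
  "is_surface_measure S \<sigma> \<longleftrightarrow> sets \<sigma> = sets borel \<and>
     (\<forall>A\<in>sets borel. A \<inter> S = {} \<longrightarrow> emeasure \<sigma> A = 0) \<and>
     (\<forall>W \<phi> A. local_param S W \<phi> \<and> A \<in> sets borel \<and> A \<subseteq> \<phi> ` W \<longrightarrow>
        emeasure \<sigma> A = emeasure (patch_measure W \<phi>) A)"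
  unfolding is_surface_measure_def sqrt_gram using local_paramD(1,3) emeasure_patch_measure
  by (intro conj_cong refl all_cong1 imp_cong) (auto simp del: emeasure_patch_measure)

text \<open>Lindelof gives countably many parametrized pieces covering \<open>S\<close>; removing
  from each the earlier ones makes them disjoint, so that measures can be added over them.\<close>

lemma surface_patches:
  assumes "compact S" "smooth_surface S"
  obtains W :: "nat \<Rightarrow> (real^3) set" and \<phi> :: "nat \<Rightarrow> real^3 \<Rightarrow> quat" and B :: "nat \<Rightarrow> quat set"
  where "\<And>n. local_param S (W n) (\<phi> n)" "\<And>n. B n \<in> sets borel" "\<And>n. B n \<subseteq> \<phi> n ` W n"
    "disjoint_family B" "(\<Union>n. B n) = S"
proof -
  define F where "F = {\<phi> ` W | W \<phi>. local_param S W \<phi>}"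
  \<comment> \<open>The empty piece is a legitimate parametrized piece. It is added so that the
    cover can be enumerated by all natural numbers even when the countable subfamily is
    empty.\<close>
  have "local_param S {} (\<lambda>_. 0)"
    by (auto simp: local_param_def homeomorphism_def C1_on_def)
  then have e: "{} \<in> F" unfolding F_def by blast
  have op: "openin (top_of_set S) U" if "U \<in> F" for U using that by (auto simp: F_def local_param_def)
  then obtain F' where F': "F' \<subseteq> F" "countable F'" "\<Union>F' = \<Union>F"
    using Lindelof_openin[of F S] by blast
  have UF: "\<Union>F = S"
  proof
    show "\<Union>F \<subseteq> S" using op openin_imp_subset by blast
    show "S \<subseteq> \<Union>F"
    proof
      fix y assume "y \<in> S"
      then obtain W \<phi> where *: "local_param S W \<phi>" "y \<in> \<phi> ` W" using assms(2) by (auto simp: smooth_surface_def)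
      from *(1) have "\<phi> ` W \<in> F" unfolding F_def by blast
      then show "y \<in> \<Union>F" using *(2) by (rule UnionI)
    qed
  qed
  define U where "U = from_nat_into (insert {} F')"
  have rU: "range U = insert {} F'" unfolding U_def
    using F'(2) by (intro range_from_nat_into) auto
  have "U n \<in> F" for n using rU F'(1) e by (metis insert_subset rangeI subsetD)
  then have "\<exists>W \<phi>. local_param S W \<phi> \<and> U n = \<phi> ` W" for n unfolding F_def by blast
  then obtain W \<phi> where W\<phi>: "\<And>n. local_param S (W n) (\<phi> n)" "\<And>n. U n = \<phi> n ` W n" by metis
  have bU: "U n \<in> sets borel" for n
  proof -
    have "openin (top_of_set S) (U n)" using local_paramD(2)[OF W\<phi>(1)] W\<phi>(2) by simp
    then obtain T where "open T" "U n = S \<inter> T" by (auto simp: openin_open)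
    then show ?thesis using compact_imp_closed[OF assms(1)] by (simp add: sets.Int)
  qed
  show thesis
  proof (rule that[of W \<phi> "disjointed U"])
    show "disjointed U n \<in> sets borel" for n
      using sets.range_disjointed_sets[of U borel] bU by auto
    show "disjointed U n \<subseteq> \<phi> n ` W n" for n using disjointed_subset[of U n] W\<phi>(2) by auto
    show "disjoint_family (disjointed U)" by (rule disjoint_family_disjointed)
    show "(\<Union>n. disjointed U n) = S" using rU F'(3) UF by (simp add: UN_disjointed_eq)
  qed (rule W\<phi>(1))
qed

lemma surface_measure_exists:
  assumes "compact S" "smooth_surface S"
  shows "\<exists>\<sigma>. is_surface_measure S \<sigma>"
proof -
  obtain W :: "nat \<Rightarrow> (real^3) set" and \<phi> :: "nat \<Rightarrow> real^3 \<Rightarrow> quat" and B :: "nat \<Rightarrow> quat set"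
  where P: "\<And>n. local_param S (W n) (\<phi> n)" "\<And>n. B n \<in> sets borel" "\<And>n. B n \<subseteq> \<phi> n ` W n"
    "disjoint_family B" "(\<Union>n. B n) = S" by (rule surface_patches[OF assms]) (rule that; assumption)
  define m where "m n A = emeasure (patch_measure (W n) (\<phi> n)) (A \<inter> B n)" for n A
  \<comment> \<open>Writing the sum over patches as an integral against counting measure reduces
    countable additivity to the interchange of a series with a nonnegative integral.\<close>
  define \<sigma> where "\<sigma> = measure_of UNIV (sets borel) (\<lambda>A. \<integral>\<^sup>+n. m n A \<partial>count_space UNIV)"
  have sets: "sets \<sigma> = sets borel"
    unfolding \<sigma>_def using sets.sigma_sets_eq[of borel] by (simp add: sets_measure_of_conv)
  have ca: "countably_additive (sets \<sigma>) (\<lambda>A. \<integral>\<^sup>+n. m n A \<partial>count_space UNIV)"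
  proof (rule countably_additiveI)
    fix A :: "nat \<Rightarrow> quat set" assume A: "range A \<subseteq> sets \<sigma>" "disjoint_family A"
    have "(\<Sum>i. m n (A i)) = m n (\<Union>i. A i)" for n
    proof -
      have "range (\<lambda>i. A i \<inter> B n) \<subseteq> sets (patch_measure (W n) (\<phi> n))"
        using A(1) P(2) by (auto simp: sets)
      moreover have "disjoint_family (\<lambda>i. A i \<inter> B n)" using A(2) by (auto simp: disjoint_family_on_def)
      ultimately show ?thesis unfolding m_def by (subst suminf_emeasure) (simp_all add: Int_UN_distrib2)
    qed
    then show "(\<Sum>i. \<integral>\<^sup>+n. m n (A i) \<partial>count_space UNIV) = (\<integral>\<^sup>+n. m n (\<Union>i. A i) \<partial>count_space UNIV)"
      by (subst nn_integral_suminf[symmetric]) simp_all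
  qed
  have \<sigma>: "emeasure \<sigma> A = (\<integral>\<^sup>+n. m n A \<partial>count_space UNIV)" if "A \<in> sets borel" for A
    by (rule emeasure_measure_of[OF \<sigma>_def]) (use ca that in \<open>auto simp: sets positive_def m_def\<close>)
  have "is_surface_measure S \<sigma>"
    unfolding is_surface_measure_iff
  proof (intro conjI ballI allI impI sets; (elim conjE)?)
    fix A assume A: "A \<in> sets borel" "A \<inter> S = {}"
    then have "A \<inter> B n = {}" for n using P(5) by blast
    then show "emeasure \<sigma> A = 0" using A by (simp add: \<sigma> m_def)
  next
    fix W' \<phi>' A assume lp: "local_param S W' \<phi>'" and A: "A \<in> sets borel" "A \<subseteq> \<phi>' ` W'"
    have AS: "A \<subseteq> S" using A(2) local_paramD(2)[OF lp] openin_imp_subset by blast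
    have "m n A = emeasure (patch_measure W' \<phi>') (A \<inter> B n)" for n
      unfolding m_def using A P(2,3)[of n] by (intro patch_measure_unique[OF P(1) lp]) auto
    then have "emeasure \<sigma> A = (\<Sum>n. emeasure (patch_measure W' \<phi>') (A \<inter> B n))"
      using A by (simp add: \<sigma> nn_integral_count_space_nat)
    also have "\<dots> = emeasure (patch_measure W' \<phi>') (\<Union>n. A \<inter> B n)"
    proof (rule suminf_emeasure)
      show "disjoint_family (\<lambda>n. A \<inter> B n)" using P(4) unfolding disjoint_family_on_def by blast
    qed (use A P(2) in auto)
    also have "(\<Union>n. A \<inter> B n) = A" using AS P(5) by blast
    finally show "emeasure \<sigma> A = emeasure (patch_measure W' \<phi>') A" .
  qed
  then show ?thesis by blast
qed

text \<open>A Borel set splits into a part off \<open>S\<close>, which is null, and countably many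
  pieces inside single patches, where the value is prescribed. With existence, this gives the
  definite description its meaning.\<close>

lemma surface_measure_unique:
  assumes "compact S" "smooth_surface S" "is_surface_measure S \<sigma>1" "is_surface_measure S \<sigma>2"
  shows "\<sigma>1 = \<sigma>2"
proof -
  obtain W :: "nat \<Rightarrow> (real^3) set" and \<phi> :: "nat \<Rightarrow> real^3 \<Rightarrow> quat" and B :: "nat \<Rightarrow> quat set"
  where P: "\<And>n. local_param S (W n) (\<phi> n)" "\<And>n. B n \<in> sets borel" "\<And>n. B n \<subseteq> \<phi> n ` W n"
    "disjoint_family B" "(\<Union>n. B n) = S" by (rule surface_patches[OF assms(1,2)]) (rule that; assumption)
  have S: "S \<in> sets borel" using compact_imp_closed[OF assms(1)] by simp
  have *: "emeasure \<sigma> A = (\<Sum>n. emeasure (patch_measure (W n) (\<phi> n)) (A \<inter> B n))"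
    if \<sigma>: "is_surface_measure S \<sigma>" and A: "A \<in> sets borel" for \<sigma> A
  proof -
    have sets: "sets \<sigma> = sets borel" and 0: "emeasure \<sigma> (A - S) = 0"
      and lp: "\<And>n. emeasure \<sigma> (A \<inter> B n) = emeasure (patch_measure (W n) (\<phi> n)) (A \<inter> B n)"
      using \<sigma> A S P(2,3) P(1) unfolding is_surface_measure_iff by (auto simp: le_infI2)
    have "emeasure \<sigma> A = emeasure \<sigma> (A - S) + emeasure \<sigma> (A \<inter> S)"
      using A S by (subst plus_emeasure) (auto simp: sets Un_Diff_Int)
    also have "A \<inter> S = (\<Union>n. A \<inter> B n)" using P(5) by blast
    also have "emeasure \<sigma> (\<Union>n. A \<inter> B n) = (\<Sum>n. emeasure \<sigma> (A \<inter> B n))"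
    proof (rule suminf_emeasure[symmetric])
      show "disjoint_family (\<lambda>n. A \<inter> B n)" using P(4) unfolding disjoint_family_on_def by blast
    qed (use A P(2) in \<open>auto simp: sets\<close>)
    finally show ?thesis by (simp add: 0 lp)
  qed
  show ?thesis
  proof (rule measure_eqI)
    show "sets \<sigma>1 = sets \<sigma>2" using assms(3,4) by (simp add: is_surface_measure_iff)
    show "emeasure \<sigma>1 A = emeasure \<sigma>2 A" if "A \<in> sets \<sigma>1" for A
      using that *[OF assms(3)] *[OF assms(4)] assms(3) by (simp add: is_surface_measure_iff)
  qed
qed

lemma is_surface_measure_surface_measure:
  assumes "compact S" "smooth_surface S"
  shows "is_surface_measure S (surface_measure S)"
  unfolding surface_measure_def
  using surface_measure_exists[OF assms] surface_measure_unique[OF assms] by (metis theI')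

lemma sets_surface_measure:
  "compact S \<Longrightarrow> smooth_surface S \<Longrightarrow> sets (surface_measure S) = sets borel"
  using is_surface_measure_surface_measure by (simp add: is_surface_measure_iff)

lemma density_surface_measure_patch:
  assumes S: "compact S" "smooth_surface S" and lp: "local_param S W \<phi>"
  shows "\<phi> ` W \<in> sets borel" "density (surface_measure S) (indicator (\<phi> ` W)) = patch_measure W \<phi>"
proof -
  let ?\<sigma> = "surface_measure S"
  obtain T where "open T" "\<phi> ` W = S \<inter> T" using local_paramD(2)[OF lp] by (auto simp: openin_open)
  then show P: "\<phi> ` W \<in> sets borel" using compact_imp_closed[OF S(1)] by (simp add: sets.Int)
  have sets: "sets ?\<sigma> = sets borel" by (rule sets_surface_measure[OF S])
  show "density ?\<sigma> (indicator (\<phi> ` W)) = patch_measure W \<phi>"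
  proof (rule measure_eqI)
    show "sets (density ?\<sigma> (indicator (\<phi> ` W))) = sets (patch_measure W \<phi>)" by (simp add: sets)
    fix A assume "A \<in> sets (density ?\<sigma> (indicator (\<phi> ` W)))"
    then have A: "A \<in> sets borel" by (simp add: sets)
    have "emeasure (density ?\<sigma> (indicator (\<phi> ` W))) A = (\<integral>\<^sup>+x. indicator (\<phi> ` W) x * indicator A x \<partial>?\<sigma>)"
      using P A by (intro emeasure_density borel_measurable_indicator) (simp_all add: sets)
    also have "\<dots> = (\<integral>\<^sup>+x. indicator (\<phi> ` W \<inter> A) x \<partial>?\<sigma>)"
      by (intro nn_integral_cong) (auto simp: indicator_def)
    also have "\<dots> = emeasure ?\<sigma> (\<phi> ` W \<inter> A)" using P A by (simp add: sets)
    also have "\<dots> = emeasure (patch_measure W \<phi>) (\<phi> ` W \<inter> A)"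
      using is_surface_measure_surface_measure[OF S] lp P A unfolding is_surface_measure_iff by blast
    also have "\<dots> = emeasure (patch_measure W \<phi>) A"
    proof -
      have "W \<inter> \<phi> -` (\<phi> ` W \<inter> A) = W \<inter> \<phi> -` A" by auto
      then show ?thesis
        using emeasure_patch_measure[OF local_paramD(1,3)[OF lp]] A P by (simp add: sets.Int)
    qed
    finally show "emeasure (density ?\<sigma> (indicator (\<phi> ` W))) A = emeasure (patch_measure W \<phi>) A" .
  qed
qed

text \<open>On one patch the surface measure is the image of a measure with density, so this is
  substitution. Integrability is transported too, because \<open>gauss_at\<close> has to certify it.
  Continuity on the patch makes the extension of \<open>h\<close> by \<open>0\<close> Borel
  measurable.\<close>

lemma surface_integral_patch:
  fixes h :: "quat \<Rightarrow> 'b::euclidean_space"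
  assumes S: "compact S" "smooth_surface S" and lp: "local_param S W \<phi>"
    and h: "continuous_on (\<phi> ` W) h"
  shows "set_integrable (surface_measure S) (\<phi> ` W) h \<longleftrightarrow>
      set_integrable lborel W (\<lambda>w. norm (cross4 (jacobian \<phi> (at w))) *\<^sub>R h (\<phi> w))"
    "(LINT y:\<phi> ` W|surface_measure S. h y) =
      (LINT w:W|lborel. norm (cross4 (jacobian \<phi> (at w))) *\<^sub>R h (\<phi> w))"
proof -
  let ?\<sigma> = "surface_measure S" and ?J = "\<lambda>w. norm (cross4 (jacobian \<phi> (at w)))"
  define k where "k y = indicator (\<phi> ` W) y *\<^sub>R h y" for y
  note P = density_surface_measure_patch[OF S lp] and lpD = local_paramD[OF lp]
  note J = patch_density_measurable[OF lpD(1,3)]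
  have W: "W \<inter> space lborel \<in> sets lborel" using lpD(1) by simp
  have k: "k \<in> borel_measurable borel"
    unfolding k_def by (rule borel_measurable_continuous_on_indicator[OF P(1) h])
  have k\<sigma>: "k \<in> borel_measurable ?\<sigma>" using k sets_surface_measure[OF S]
    by (simp cong: measurable_cong_sets)
  have i\<sigma>: "indicator (\<phi> ` W) \<in> borel_measurable ?\<sigma>" using P(1) sets_surface_measure[OF S] by simp
  have k\<phi>: "(\<lambda>w. k (\<phi> w)) \<in> borel_measurable (restrict_space lborel W)"
    using J(2) k by (rule measurable_compose)
  have k\<phi>': "(\<lambda>w. k (\<phi> w)) \<in> borel_measurable (density (restrict_space lborel W) ?J)"
    using k\<phi> by simp
  have \<phi>': "\<phi> \<in> density (restrict_space lborel W) ?J \<rightarrow>\<^sub>M borel" using J(2) by simp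
  have D: "density ?\<sigma> (\<lambda>x. ennreal (indicator (\<phi> ` W) x)) = patch_measure W \<phi>"
    using P(2) by (simp add: ennreal_indicator)
  have ik: "indicator (\<phi> ` W) y *\<^sub>R k y = k y" for y by (simp add: k_def indicator_def)
  have kW: "indicator W w *\<^sub>R (?J w *\<^sub>R k (\<phi> w)) = indicator W w *\<^sub>R (?J w *\<^sub>R h (\<phi> w))" for w
    by (auto simp: k_def indicator_def)
  have "integrable ?\<sigma> k \<longleftrightarrow> integrable (patch_measure W \<phi>) k"
    using integrable_density[OF k\<sigma> i\<sigma>] by (simp add: D ik)
  also have "\<dots> \<longleftrightarrow> integrable (restrict_space lborel W) (\<lambda>w. ?J w *\<^sub>R k (\<phi> w))"
    unfolding patch_measure_def integrable_distr_eq[OF \<phi>' k]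
    by (rule integrable_density[OF k\<phi> J(1)]) simp
  also have "\<dots> \<longleftrightarrow> integrable lborel (\<lambda>w. indicator W w *\<^sub>R (?J w *\<^sub>R h (\<phi> w)))"
    unfolding integrable_restrict_space[OF W] set_integrable_def kW ..
  finally show "set_integrable ?\<sigma> (\<phi> ` W) h \<longleftrightarrow> set_integrable lborel W (\<lambda>w. ?J w *\<^sub>R h (\<phi> w))"
    unfolding set_integrable_def k_def[abs_def] .
  have "integral\<^sup>L ?\<sigma> k = integral\<^sup>L (patch_measure W \<phi>) k"
    using integral_density[OF k\<sigma> i\<sigma>] by (simp add: D ik)
  also have "\<dots> = integral\<^sup>L (restrict_space lborel W) (\<lambda>w. ?J w *\<^sub>R k (\<phi> w))"
    unfolding patch_measure_def integral_distr[OF \<phi>' k]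
    by (rule integral_density[OF k\<phi> J(1)]) simp
  also have "\<dots> = integral\<^sup>L lborel (\<lambda>w. indicator W w *\<^sub>R (?J w *\<^sub>R h (\<phi> w)))"
    unfolding integral_restrict_space[OF W] set_lebesgue_integral_def kW ..
  finally show "(LINT y:\<phi> ` W|?\<sigma>. h y) = (LINT w:W|lborel. ?J w *\<^sub>R h (\<phi> w))"
    unfolding set_lebesgue_integral_def k_def[abs_def] .
qed

lemma local_param_subset:
  assumes lp: "local_param S W \<phi>" and "open W'" "W' \<subseteq> W"
  shows "local_param S W' \<phi>"
proof -
  obtain \<psi> where hom: "homeomorphism W (\<phi> ` W) \<phi> \<psi>" using lp by (auto simp: local_param_def)
  have "openin (top_of_set (\<phi> ` W)) (\<phi> ` W')"
    using assms local_paramD(1)[OF lp] by (intro homeomorphism_imp_open_map[OF hom]) (simp add: open_openin_trans open_subset)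
  then have "openin (top_of_set S) (\<phi> ` W')"
    using local_paramD(2)[OF lp] openin_trans by blast
  moreover have "homeomorphism W' (\<phi> ` W') \<phi> \<psi>"
    by (rule homeomorphism_of_subsets[OF hom assms(3)]) (use assms(3) in auto)
  ultimately show ?thesis
    using lp assms(2,3) unfolding local_param_def C1_on_def
    by (meson continuous_on_subset subsetD)
qed

subsection \<open>Outward normals\<close>

context straightening
begin

text \<open>The sign \<open>s\<close> is to be \<open>1\<close> or \<open>-1\<close>; one parameter
  lets each argument serve both sides of the surface.\<close>

definition half :: "real \<Rightarrow> quat set" where
  "half s = {z \<in> tube w0 r e. 0 < s * z $ 0}"

lemma half_subset: "half s \<subseteq> tube w0 r e"
  by (auto simp: half_def)

lemma open_half: "open (half s)"
proof -
  have "half s = tube w0 r e \<inter> {z. 0 < s * z $ 0}" by (auto simp: half_def)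
  then show ?thesis by (auto intro!: open_Int open_tube open_Collect_less continuous_intros)
qed

lemma connected_half: "connected (half s)"
proof -
  have h: "half s = (\<lambda>p. join (fst p) (snd p)) ` ({t. 0 < s * t \<and> \<bar>t\<bar> < e} \<times> ball w0 r)"
  proof safe
    fix z assume "z \<in> half s"
    then have "(z $ 0, vpart z) \<in> {t. 0 < s * t \<and> \<bar>t\<bar> < e} \<times> ball w0 r"
      by (auto simp: half_def tube_def)
    then show "z \<in> (\<lambda>p. join (fst p) (snd p)) ` ({t. 0 < s * t \<and> \<bar>t\<bar> < e} \<times> ball w0 r)"
      by (intro image_eqI) auto
  qed (auto simp: half_def)
  have *: "{t. 0 < s * t \<and> \<bar>t\<bar> < e} = (*) s -` {0<..} \<inter> {-e<..<e}" by auto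
  have "convex ((*) s -` {0<..} \<inter> {-e<..<e})"
    by (intro convex_Int convex_linear_vimage) auto
  then have "connected ({t. 0 < s * t \<and> \<bar>t\<bar> < e} \<times> ball w0 r)"
    using * by (simp add: convex_connected convex_Times)
  moreover have "continuous_on X (\<lambda>p. join (fst p) (snd p))" for X by (intro continuous_intros)
  ultimately show ?thesis unfolding h
    by (rule connected_continuous_image[rotated])
qed

text \<open>The frontier is met only at real coordinate \<open>0\<close>, which a half excludes, and
  a connected set that avoids the frontier cannot meet both \<open>G\<close> and its
  complement.\<close>

lemma straight_half_side:
  assumes "straight \<phi> N ` tube w0 r e \<inter> frontier G \<subseteq> \<phi> ` ball w0 r"
  shows "straight \<phi> N ` half s \<subseteq> G \<or> straight \<phi> N ` half s \<inter> G = {}"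
proof -
  have "straight \<phi> N ` half s \<inter> frontier G = {}"
  proof (rule ccontr)
    assume "straight \<phi> N ` half s \<inter> frontier G \<noteq> {}"
    then obtain z where z: "z \<in> half s" "straight \<phi> N z \<in> frontier G" by auto
    then have "straight \<phi> N z \<in> \<phi> ` ball w0 r" using assms half_subset by blast
    then obtain w where w: "w \<in> ball w0 r" "straight \<phi> N z = straight \<phi> N (join 0 w)" by auto
    then have "z = join 0 w" using z(1) half_subset e by (intro inj_onD[OF inj w(2)]) auto
    then show False using z(1) by (simp add: half_def)
  qed
  moreover have "connected (straight \<phi> N ` half s)"
    using continuous_on_subset[OF continuous_straight half_subset] connected_half
    by (rule connected_continuous_image)
  ultimately show ?thesis using connected_Int_frontier[of "straight \<phi> N ` half s" G] by blast
qed

lemma inv_straight_join [simp]: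
  "w \<in> ball w0 r \<Longrightarrow> \<bar>t\<bar> < e \<Longrightarrow> inv_into (tube w0 r e) (straight \<phi> N) (\<phi> w + t *\<^sub>R N) = join t w"
  using inv_into_f_f[OF inj, of "join t w"] by simp

text \<open>The transversal coordinate is a local defining function of the surface: pairing the
  splitting of \<open>v\<close> with \<open>c\<close> removes the tangential part and leaves its
  \<open>N\<close>-component. As tangent vectors and \<open>N\<close> span the space, a vector
  orthogonal to the surface is fixed by its product with \<open>N\<close>.\<close>

lemma straight_normal_coordinate:
  fixes w defines "c \<equiv> cross4 (jacobian \<phi> (at w))"
  assumes w: "w \<in> ball w0 r"
  shows "((\<lambda>x. inv_into (tube w0 r e) (straight \<phi> N) x $ 0) has_derivative (\<lambda>v. (c \<bullet> v) / (c \<bullet> N))) (at (\<phi> w))"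
    "\<And>q. (\<And>v. q \<bullet> (jacobian \<phi> (at w) *v v) = 0) \<Longrightarrow> q = (q \<bullet> N / (c \<bullet> N)) *\<^sub>R c"
proof -
  define A where "A = jacobian \<phi> (at w)"
  have z: "join 0 w \<in> tube w0 r e" using w e by simp
  have cN: "c \<bullet> N \<noteq> 0" using transversal[OF w] by (simp add: c_def)
  from inverse_straight_deriv[OF z, unfolded straight_join vpart_join scaleR_zero_left add_0_right, folded A_def]
  obtain g where "linear g" and g: "(inv_into (tube w0 r e) (straight \<phi> N) has_derivative g) (at (\<phi> w))"
    and "\<And>v. g (A *v v) = join 0 v" "g N = axis 0 1"
    and gA: "\<And>y. A *v vpart (g y) + (g y $ 0) *\<^sub>R N = y" by blast
  have cA: "c \<bullet> (A *v v) = 0" for v by (simp add: c_def A_def cross4_orthogonal)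
  have "g v $ 0 = (c \<bullet> v) / (c \<bullet> N)" for v
    using arg_cong[OF gA[of v], of "\<lambda>y. c \<bullet> y"] cN by (simp add: inner_add_right cA field_simps)
  then show "((\<lambda>x. inv_into (tube w0 r e) (straight \<phi> N) x $ 0) has_derivative (\<lambda>v. (c \<bullet> v) / (c \<bullet> N))) (at (\<phi> w))"
    using bounded_linear.has_derivative[OF bounded_linear_vec_nth g, of 0] by simp
  fix q assume q: "\<And>v. q \<bullet> (jacobian \<phi> (at w) *v v) = 0"
  define q' where "q' = q - (q \<bullet> N / (c \<bullet> N)) *\<^sub>R c"
  have 1: "q' \<bullet> N = 0" using cN by (simp add: q'_def inner_diff_left)
  have 2: "q' \<bullet> (A *v v) = 0" for v using q cA by (simp add: q'_def inner_diff_left A_def)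
  have "q' \<bullet> y = 0" for y
    using 1 2 by (subst gA[of y, symmetric]) (simp add: inner_add_right)
  then have "q' = 0" using inner_eq_zero_iff by blast
  then show "q = (q \<bullet> N / (c \<bullet> N)) *\<^sub>R c" by (simp add: q'_def)
qed

text \<open>The transversal coordinate is \<open>0\<close> at the foot of the ray, and
  \<open>s\<close> times it has positive derivative along the ray.\<close>

lemma eventually_ray_in_half:
  fixes w defines "c \<equiv> cross4 (jacobian \<phi> (at w))"
  assumes w: "w \<in> ball w0 r" and d: "0 < s * ((c \<bullet> d) / (c \<bullet> N))"
  shows "\<forall>\<^sub>F h in at_right 0. \<phi> w + h *\<^sub>R d \<in> straight \<phi> N ` half s"
proof -
  let ?Q = "straight \<phi> N ` tube w0 r e"
  define \<rho> where "\<rho> x = inv_into (tube w0 r e) (straight \<phi> N) x $ 0" for x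
  have der: "((\<lambda>h. \<phi> w + h *\<^sub>R d) has_derivative (\<lambda>h. h *\<^sub>R d)) (at 0)"
    by (auto intro!: derivative_eq_intros)
  have "(\<rho> has_derivative (\<lambda>v. (c \<bullet> v) / (c \<bullet> N))) (at (\<phi> w + 0 *\<^sub>R d))"
    using straight_normal_coordinate(1)[OF w] by (simp add: \<rho>_def[abs_def] c_def)
  from has_derivative_compose[OF der this]
  have "((\<lambda>h. \<rho> (\<phi> w + h *\<^sub>R d)) has_derivative (\<lambda>h. (c \<bullet> (h *\<^sub>R d)) / (c \<bullet> N))) (at 0)" .
  then have "((\<lambda>h. s * \<rho> (\<phi> w + h *\<^sub>R d)) has_real_derivative s * ((c \<bullet> d) / (c \<bullet> N))) (at 0)"
    unfolding has_field_derivative_def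
    by (rule has_derivative_eq_rhs[OF has_derivative_mult_right]) (simp add: fun_eq_iff)
  from has_real_derivative_pos_inc_right[OF this d]
  obtain \<delta> where \<delta>: "\<delta> > 0" "\<And>h. h > 0 \<Longrightarrow> h < \<delta> \<Longrightarrow> s * \<rho> (\<phi> w) < s * \<rho> (\<phi> w + h *\<^sub>R d)" by auto
  have \<rho>0: "\<rho> (\<phi> w) = 0" using inv_straight_join[OF w, of 0] e by (simp add: \<rho>_def)
  have "open ?Q" by (rule open_straight_image[OF open_tube]) simp
  moreover have "\<phi> w \<in> ?Q" using w e by (intro image_eqI[of _ _ "join 0 w"]) auto
  ultimately have "\<forall>\<^sub>F x in nhds (\<phi> w). x \<in> ?Q" by (rule eventually_nhds_in_open)
  moreover have "((\<lambda>h. \<phi> w + h *\<^sub>R d) \<longlongrightarrow> \<phi> w) (at_right 0)"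
    by (auto intro!: tendsto_eq_intros)
  ultimately have "\<forall>\<^sub>F h in at_right 0. \<phi> w + h *\<^sub>R d \<in> ?Q"
    by (rule eventually_compose_filterlim)
  moreover have "\<forall>\<^sub>F h in at_right 0. h \<in> {0<..<\<delta>}"
    using \<delta>(1) by (rule eventually_at_right_real)
  ultimately show ?thesis
  proof eventually_elim
    case (elim h)
    then obtain z where z: "z \<in> tube w0 r e" "\<phi> w + h *\<^sub>R d = straight \<phi> N z" by auto
    then have "\<rho> (\<phi> w + h *\<^sub>R d) = z $ 0" using inj by (simp add: \<rho>_def)
    then have "0 < s * z $ 0" using \<delta>(2)[of h] elim \<rho>0 by simp
    then show ?case using z by (auto simp: half_def)
  qed
qed

text \<open>Along a curve in the surface the transversal coordinate vanishes, and its derivative is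
  a multiple of \<open>c \<bullet> v\<close>.\<close>

lemma tangent_vectors_orthogonal:
  fixes w defines "c \<equiv> cross4 (jacobian \<phi> (at w))"
  assumes w: "w \<in> ball w0 r" and S: "straight \<phi> N ` tube w0 r e \<inter> S = \<phi> ` ball w0 r"
    and v: "v \<in> tangent_vectors S (\<phi> w)"
  shows "c \<bullet> v = 0"
proof -
  let ?Q = "straight \<phi> N ` tube w0 r e"
  define \<rho> where "\<rho> x = inv_into (tube w0 r e) (straight \<phi> N) x $ 0" for x
  obtain k where k: "k 0 = \<phi> w" "\<forall>\<^sub>F h in nhds 0. k h \<in> S" "(k has_vector_derivative v) (at (0::real))"
    using v by (auto simp: tangent_vectors_def)
  have der: "(k has_derivative (\<lambda>h. h *\<^sub>R v)) (at 0)" using k(3) by (simp add: has_vector_derivative_def)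
  have "(\<rho> has_derivative (\<lambda>v. (c \<bullet> v) / (c \<bullet> N))) (at (k 0))"
    using straight_normal_coordinate(1)[OF w] by (simp add: \<rho>_def[abs_def] c_def k(1))
  from has_derivative_compose[OF der this]
  have "((\<lambda>h. \<rho> (k h)) has_derivative (\<lambda>h. (c \<bullet> (h *\<^sub>R v)) / (c \<bullet> N))) (at 0)" .
  moreover have "((\<lambda>h. \<rho> (k h)) has_derivative (\<lambda>h. 0)) (at 0)"
  proof (rule has_derivative_transform_eventually[OF has_derivative_const])
    have "open ?Q" by (rule open_straight_image[OF open_tube]) simp
    moreover have "\<phi> w \<in> ?Q" using w e by (intro image_eqI[of _ _ "join 0 w"]) auto
    ultimately have "\<forall>\<^sub>F x in nhds (k 0). x \<in> ?Q" unfolding k(1) by (rule eventually_nhds_in_open)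
    moreover have "(k \<longlongrightarrow> k 0) (nhds 0)"
      using has_derivative_continuous[OF der] by (simp add: continuous_at tendsto_at_iff_tendsto_nhds)
    ultimately have "\<forall>\<^sub>F h in nhds 0. k h \<in> ?Q" by (rule eventually_compose_filterlim)
    then have ev: "\<forall>\<^sub>F h in nhds 0. 0 = \<rho> (k h)" using k(2)
    proof eventually_elim
      case (elim h)
      then have "k h \<in> \<phi> ` ball w0 r" using S by blast
      then obtain u where "u \<in> ball w0 r" "k h = \<phi> u + 0 *\<^sub>R N" by auto
      then show ?case using e unfolding \<rho>_def by (metis abs_zero inv_straight_join join_nth(1))
    qed
    then show "\<forall>\<^sub>F h in at 0. 0 = \<rho> (k h)" by (simp add: eventually_at_filter eventually_mono)
    show "0 = \<rho> (k 0)" using eventually_nhds_x_imp_x[OF ev] .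
  qed simp
  ultimately have "(\<lambda>h. (c \<bullet> (h *\<^sub>R v)) / (c \<bullet> N)) = (\<lambda>h. 0)" by (rule has_derivative_unique)
  from fun_cong[OF this, of 1] show ?thesis using transversal[OF w] by (simp add: c_def)
qed

lemma jacobian_range_tangent:
  assumes w: "w \<in> ball w0 r" and S: "\<phi> ` ball w0 r \<subseteq> S"
  shows "jacobian \<phi> (at w) *v v \<in> tangent_vectors S (\<phi> w)"
proof -
  have "((\<lambda>h. w + h *\<^sub>R v) has_derivative (\<lambda>h. h *\<^sub>R v)) (at (0::real))"
    by (auto intro!: derivative_eq_intros)
  moreover have "(\<phi> has_derivative (\<lambda>h. jacobian \<phi> (at w) *v h)) (at (w + 0 *\<^sub>R v))"
    using C1_on_has_jacobian[OF C1, of w] w ball_W by auto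
  ultimately have "((\<lambda>h. \<phi> (w + h *\<^sub>R v)) has_derivative (\<lambda>h. jacobian \<phi> (at w) *v (h *\<^sub>R v))) (at 0)"
    by (rule has_derivative_compose)
  then have "((\<lambda>h. \<phi> (w + h *\<^sub>R v)) has_vector_derivative jacobian \<phi> (at w) *v v) (at 0)"
    by (simp add: has_vector_derivative_def matrix_vector_mult_scaleR)
  moreover have "\<forall>\<^sub>F h in nhds 0. \<phi> (w + h *\<^sub>R v) \<in> S"
  proof -
    have "\<forall>\<^sub>F u in nhds w. u \<in> ball w0 r" using w by (intro eventually_nhds_in_open) auto
    moreover have "((\<lambda>h. w + h *\<^sub>R v) \<longlongrightarrow> w) (nhds (0::real))"
      by (auto intro!: tendsto_eq_intros filterlim_ident)
    ultimately have "\<forall>\<^sub>F h in nhds (0::real). w + h *\<^sub>R v \<in> ball w0 r" by (rule eventually_compose_filterlim)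
    then show ?thesis by eventually_elim (use S in blast)
  qed
  ultimately show ?thesis unfolding tangent_vectors_def by (intro CollectI exI[of _ "\<lambda>h. \<phi> (w + h *\<^sub>R v)"]) auto
qed

text \<open>If \<open>G\<close> lies on one side only, the normal is \<open>c\<close> scaled to
  length one and directed away from that side. If \<open>G\<close> lies on both sides or on neither,
  no outward normal exists; the default \<open>0\<close> then matches the vanishing difference on
  the right. The left side is the flux density in the parameter \<open>w\<close>, the right side the
  signed volume density of the straightened chart.\<close>

lemma outward_unit_normal_straight:
  fixes w defines "c \<equiv> cross4 (jacobian \<phi> (at w))"
  defines "\<iota> \<equiv> \<lambda>G s. if straight \<phi> N ` half s \<subseteq> G then 1 else (0::real)"
  assumes G: "open G" and w: "w \<in> ball w0 r"
    and S: "straight \<phi> N ` tube w0 r e \<inter> frontier G = \<phi> ` ball w0 r"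
  shows "norm c * (outward_unit_normal G (\<phi> w) \<bullet> N) = (\<iota> G (-1) - \<iota> G 1) * \<bar>c \<bullet> N\<bar>"
proof -
  let ?y = "\<phi> w" and ?\<Phi> = "straight \<phi> N"
  have cN: "c \<bullet> N \<noteq> 0" using transversal[OF w] by (simp add: c_def)
  then have c0: "norm c > 0" by auto
  \<comment> \<open>A half has open image, so missing \<open>G\<close> already means missing
    \<open>closure G\<close>, as the definition of an outward normal demands.\<close>
  have side: "?\<Phi> ` half s \<subseteq> G \<or> ?\<Phi> ` half s \<inter> closure G = {}" for s
  proof -
    have "open (?\<Phi> ` half s)" by (rule open_straight_image[OF open_half half_subset])
    then show ?thesis
      using straight_half_side[OF equalityD1[OF S], of s] by (simp add: open_Int_closure_eq_empty)
  qed
  have ev_ex: "\<exists>h. P h \<and> Q h" if "\<forall>\<^sub>F h in at_right (0::real). P h" "\<forall>\<^sub>F h in at_right 0. Q h" for P Q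
    using eventually_happens[OF eventually_conj[OF that]] by (simp add: trivial_limit_at_right_real)
  define \<kappa> where "\<kappa> n = n \<bullet> N / (c \<bullet> N)" for n
  \<comment> \<open>Any outward normal is a multiple of \<open>c\<close>, and the sign of
    \<open>n \<bullet> N\<close> tells which half lies in \<open>G\<close>, namely the one behind
    it.\<close>
  have normal: "n = \<kappa> n *\<^sub>R c \<and> \<bar>\<kappa> n\<bar> * norm c = 1 \<and>
      ?\<Phi> ` half (- sgn (n \<bullet> N)) \<subseteq> G \<and> ?\<Phi> ` half (sgn (n \<bullet> N)) \<inter> closure G = {} \<and> n \<bullet> N \<noteq> 0"
    if n: "is_outward_unit_normal G ?y n" for n
  proof -
    have "n \<bullet> (jacobian \<phi> (at w) *v v) = 0" for v
      using n jacobian_range_tangent[OF w, of "frontier G" v] S by (auto simp: is_outward_unit_normal_def)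
    then have n1: "n = \<kappa> n *\<^sub>R c" unfolding \<kappa>_def c_def by (rule straight_normal_coordinate(2)[OF w])
    have n2: "\<bar>\<kappa> n\<bar> * norm c = 1"
      using n n1 by (metis is_outward_unit_normal_def norm_scaleR)
    then have \<kappa>0: "\<kappa> n \<noteq> 0" by auto
    then have nN: "n \<bullet> N \<noteq> 0" by (auto simp: \<kappa>_def)
    have *: "(c \<bullet> n) / (c \<bullet> N) = (norm c)\<^sup>2 * (\<kappa> n)\<^sup>2 / (n \<bullet> N)"
    proof -
      have "c \<bullet> n = \<kappa> n * (norm c)\<^sup>2" by (subst n1) (simp add: power2_norm_eq_inner)
      then show ?thesis using cN nN by (simp add: \<kappa>_def field_simps power2_eq_square)
    qed
    have "0 < sgn (n \<bullet> N) * ((c \<bullet> n) / (c \<bullet> N))"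
      unfolding * using \<kappa>0 c0 nN by (auto simp: sgn_real_def zero_less_divide_iff divide_less_0_iff intro!: mult_pos_pos)
    then have p: "0 < sgn (n \<bullet> N) * ((c \<bullet> n) / (c \<bullet> N))" "0 < - sgn (n \<bullet> N) * ((c \<bullet> - n) / (c \<bullet> N))"
      by simp_all
    from n have o: "\<forall>\<^sub>F h in at_right 0. ?y + h *\<^sub>R (- n) \<in> G" "\<forall>\<^sub>F h in at_right 0. ?y + h *\<^sub>R n \<notin> closure G"
      by (auto simp: is_outward_unit_normal_def eventually_conj_iff)
    have "\<exists>x. x \<in> ?\<Phi> ` half (- sgn (n \<bullet> N)) \<and> x \<in> G"
      using ev_ex[OF eventually_ray_in_half[OF w p(2)[unfolded c_def]] o(1)] by blast
    then have "?\<Phi> ` half (- sgn (n \<bullet> N)) \<subseteq> G" using side closure_subset by blast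
    moreover have "\<exists>x. x \<in> ?\<Phi> ` half (sgn (n \<bullet> N)) \<and> x \<notin> closure G"
      using ev_ex[OF eventually_ray_in_half[OF w p(1)[unfolded c_def]] o(2)] by blast
    then have "?\<Phi> ` half (sgn (n \<bullet> N)) \<inter> closure G = {}" using side closure_subset by blast
    ultimately show ?thesis using n1 n2 nN by blast
  qed
  have half_ne: "?\<Phi> ` half s \<noteq> {}" if "\<bar>s\<bar> = 1" for s
  proof -
    have "join (s * e / 2) w \<in> half s" using that e w by (auto simp: half_def abs_if split: if_splits)
    then show ?thesis by blast
  qed
  have main: "norm c * (outward_unit_normal G ?y \<bullet> N) = s * \<bar>c \<bullet> N\<bar>"
    if s: "\<bar>s\<bar> = 1" and in_G: "?\<Phi> ` half (- s) \<subseteq> G" and out: "?\<Phi> ` half s \<inter> closure G = {}" for s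
  proof -
    \<comment> \<open>The factor \<open>sgn (c \<bullet> N)\<close> gives
      \<open>n \<bullet> N\<close> the sign \<open>s\<close>, so that \<open>n\<close> points into
      the half outside \<open>G\<close>.\<close>
    define n where "n = (s * sgn (c \<bullet> N) / norm c) *\<^sub>R c"
    have cn: "(c \<bullet> n) / (c \<bullet> N) = s * norm c / \<bar>c \<bullet> N\<bar>"
      using cN c0 by (auto simp: n_def power2_norm_eq_inner[symmetric] power2_eq_square sgn_real_def)
    have nN: "n \<bullet> N = s * \<bar>c \<bullet> N\<bar> / norm c"
      using cN by (auto simp: n_def sgn_real_def)
    have ss: "s * s = 1" using s by (auto simp: abs_if split: if_splits)
    have p: "0 < s * ((c \<bullet> n) / (c \<bullet> N))" "0 < - s * ((c \<bullet> - n) / (c \<bullet> N))"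
    proof -
      have "s * ((c \<bullet> n) / (c \<bullet> N)) = norm c / \<bar>c \<bullet> N\<bar>" unfolding cn using ss by simp
      then show "0 < s * ((c \<bullet> n) / (c \<bullet> N))" using cN c0 by simp
      then show "0 < - s * ((c \<bullet> - n) / (c \<bullet> N))" by simp
    qed
    have outn: "is_outward_unit_normal G ?y n"
      unfolding is_outward_unit_normal_def
    proof (intro conjI ballI)
      show "norm n = 1" using s cN c0 by (auto simp: n_def abs_mult abs_sgn_eq)
      show "n \<bullet> v = 0" if "v \<in> tangent_vectors (frontier G) ?y" for v
        using tangent_vectors_orthogonal[OF w S that] by (simp add: n_def c_def)
      have "\<forall>\<^sub>F h in at_right 0. ?y + h *\<^sub>R (- n) \<in> G"
        by (rule eventually_mono[OF eventually_ray_in_half[OF w p(2)[unfolded c_def]]]) (use in_G in blast)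
      moreover have "\<forall>\<^sub>F h in at_right 0. ?y + h *\<^sub>R n \<notin> closure G"
        by (rule eventually_mono[OF eventually_ray_in_half[OF w p(1)[unfolded c_def]]]) (use out in blast)
      ultimately show "\<forall>\<^sub>F h in at_right 0. ?y - h *\<^sub>R n \<in> G \<and> ?y + h *\<^sub>R n \<notin> closure G"
        by eventually_elim simp
    qed
    have uniq: "m = n" if m: "is_outward_unit_normal G ?y m" for m
    proof -
      note M = normal[OF m]
      have "sgn (m \<bullet> N) = s"
      proof (rule ccontr)
        assume "sgn (m \<bullet> N) \<noteq> s"
        then have "sgn (m \<bullet> N) = - s" using M s by (auto simp: sgn_real_def abs_if split: if_splits)
        then have "?\<Phi> ` half (- s) \<inter> closure G = {}" using M by simp
        then show False using in_G half_ne[of "- s"] s closure_subset by fastforce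
      qed
      moreover have "\<bar>\<kappa> m\<bar> = 1 / norm c" using M c0 by (simp add: field_simps)
      moreover have "\<kappa> m = sgn (m \<bullet> N) * sgn (c \<bullet> N) * \<bar>\<kappa> m\<bar>"
        unfolding \<kappa>_def by (auto simp: sgn_real_def abs_if zero_less_divide_iff divide_less_0_iff)
      ultimately have "\<kappa> m = s * sgn (c \<bullet> N) / norm c" by simp
      then show ?thesis using M by (metis n_def)
    qed
    have "(THE m. is_outward_unit_normal G ?y m) = n"
    proof (rule the_equality)
      show "is_outward_unit_normal G ?y n" by (rule outn)
    qed (rule uniq)
    then have "outward_unit_normal G ?y = n"
      unfolding outward_unit_normal_def using outn by metis
    then show ?thesis using c0 by (simp add: nN)
  qed
  \<comment> \<open>An outward normal needs one half inside \<open>G\<close> and the other outside;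
    here that fails, and the default value applies.\<close>
  have zero: "outward_unit_normal G ?y = 0"
    if eqv: "\<And>s. \<bar>s\<bar> = 1 \<Longrightarrow> ?\<Phi> ` half (- s) \<subseteq> G \<longleftrightarrow> ?\<Phi> ` half s \<subseteq> G"
  proof -
    have False if n: "is_outward_unit_normal G ?y n" for n
    proof -
      note M = normal[OF n]
      have s: "\<bar>sgn (n \<bullet> N)\<bar> = 1" using M by (simp add: abs_sgn_eq)
      have "?\<Phi> ` half (sgn (n \<bullet> N)) \<subseteq> G" using M eqv[OF s] by blast
      then show False using M half_ne[OF s] closure_subset by blast
    qed
    then show ?thesis by (auto simp: outward_unit_normal_def)
  qed
  show ?thesis
  proof (cases "?\<Phi> ` half 1 \<subseteq> G \<longleftrightarrow> ?\<Phi> ` half (-1) \<subseteq> G")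
    case True
    have "outward_unit_normal G ?y = 0"
      using True by (intro zero) (auto simp: abs_if split: if_splits)
    then show ?thesis using True by (simp add: \<iota>_def)
  next
    case False
    then consider "?\<Phi> ` half (-1) \<subseteq> G" "\<not> ?\<Phi> ` half 1 \<subseteq> G" | "?\<Phi> ` half 1 \<subseteq> G" "\<not> ?\<Phi> ` half (-1) \<subseteq> G" by blast
    then show ?thesis
    proof cases
      case 1
      then show ?thesis using main[of 1] side[of 1] by (simp add: \<iota>_def)
    next
      case 2
      then show ?thesis using main[of "-1"] side[of "-1"] by (simp add: \<iota>_def)
    qed
  qed
qed

end

subsection \<open>The divergence theorem\<close>

text \<open>The derivative is explicit data and continuous for each fixed direction, so that product
  and chain rules produce it as a plain term. On the boundary it is only the continuous
  extension.\<close>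

definition C1_upto :: "quat set \<Rightarrow> (quat \<Rightarrow> 'b::real_normed_vector) \<Rightarrow> (quat \<Rightarrow> quat \<Rightarrow> 'b) \<Rightarrow> bool" where
  "C1_upto G H H' \<longleftrightarrow> continuous_on (closure G) H \<and> (\<forall>v. continuous_on (closure G) (\<lambda>x. H' x v)) \<and>
     (\<forall>x\<in>G. (H has_derivative H' x) (at x))"

lemma set_integrable_bounded_continuous:
  fixes k :: "'a::euclidean_space \<Rightarrow> 'b::euclidean_space"
  assumes "compact C" "continuous_on C k" "P \<in> sets borel" "P \<subseteq> C"
  shows "set_integrable lborel P k"
proof -
  have "set_integrable lborel C k"
    using borel_integrable_compact[OF assms(1,2)] by (simp add: set_integrable_def indicator_scaleR_eq_if)
  then show ?thesis by (rule set_integrable_subset) (use assms in auto)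
qed

text \<open>The underlying theorem yields integrability with respect to the completed measure; the
  continuity assumption supplies the Borel measurability needed to return to
  \<open>lborel\<close>.\<close>

lemma set_integral_change_of_variables:
  fixes T :: "real^'n::{finite,wellorder} \<Rightarrow> real^'n::_" and f :: "real^'n::_ \<Rightarrow> real^'m"
  assumes S: "S \<in> sets borel" and der: "\<And>x. x \<in> S \<Longrightarrow> (T has_derivative T' x) (at x)" and inj: "inj_on T S"
    and f: "set_integrable lborel (T ` S) f"
    and m: "continuous_on S (\<lambda>x. \<bar>det (matrix (T' x))\<bar> *\<^sub>R f (T x))"
  shows "set_integrable lborel S (\<lambda>x. \<bar>det (matrix (T' x))\<bar> *\<^sub>R f (T x))"
    "(LINT y:T ` S|lborel. f y) = (LINT x:S|lborel. \<bar>det (matrix (T' x))\<bar> *\<^sub>R f (T x))"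
proof -
  let ?h = "\<lambda>x. \<bar>det (matrix (T' x))\<bar> *\<^sub>R f (T x)"
  have S': "S \<in> sets lebesgue" using S by simp
  have f': "f absolutely_integrable_on (T ` S)"
    using f unfolding set_integrable_def
    by (subst integrable_completion) (use borel_measurable_integrable in auto)
  note cv = has_absolute_integral_change_of_variables[OF S' has_derivative_at_withinI[OF der] inj, of f]
  have h: "?h absolutely_integrable_on S" "integral S ?h = integral (T ` S) f"
    using cv f' by blast+
  show hi: "set_integrable lborel S ?h"
    using h(1) borel_measurable_continuous_on_indicator[OF S m] unfolding set_integrable_def
    by (subst (asm) integrable_completion) auto
  show "(LINT y:T ` S|lborel. f y) = (LINT x:S|lborel. ?h x)"
    by (simp add: set_borel_integral_eq_integral(2)[OF f] set_borel_integral_eq_integral(2)[OF hi] h(2))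
qed

section \<open>Integration along the lines in direction \<open>N\<close>\<close>

context straightening
begin

lemma ray_in_half:
  "w \<in> ball w0 r \<Longrightarrow> \<bar>s\<bar> = 1 \<Longrightarrow> 0 < t \<Longrightarrow> t < e \<Longrightarrow> \<phi> w + (s * t) *\<^sub>R N \<in> straight \<phi> N ` half s"
  by (rule image_eqI[of _ _ "join (s * t) w"]) (auto simp: half_def abs_mult abs_if split: if_splits)

lemma base_in_closure_half:
  assumes "w \<in> ball w0 r" "\<bar>s\<bar> = 1"
  shows "\<phi> w \<in> closure (straight \<phi> N ` half s)"
proof (rule Lim_in_closed_set[OF closed_closure])
  have "\<forall>\<^sub>F t in at_right 0. t \<in> {0<..<e}" using e by (rule eventually_at_right_real)
  then show "\<forall>\<^sub>F t in at_right 0. \<phi> w + (s * t) *\<^sub>R N \<in> closure (straight \<phi> N ` half s)"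
    by eventually_elim (use ray_in_half[OF assms] closure_subset in auto)
  show "((\<lambda>t. \<phi> w + (s * t) *\<^sub>R N) \<longlongrightarrow> \<phi> w) (at_right 0)"
    by (auto intro!: tendsto_eq_intros)
qed (simp add: trivial_limit_at_right_real)

text \<open>Of each segment in direction \<open>N\<close> only the foot contributes, since
  \<open>H\<close> vanishes from height \<open>e/2\<close> on. The sign is \<open>- s\<close>
  because \<open>N\<close> leads away from the surface in the half \<open>1\<close> and towards it
  in the half \<open>-1\<close>.\<close>

lemma half_volume:
  fixes H :: "quat \<Rightarrow> quat"
  assumes G: "open G" "bounded G" and H: "C1_upto G H H'"
    and PG: "straight \<phi> N ` half s \<subseteq> G" and s: "\<bar>s\<bar> = 1"
    and supp: "\<And>x. x \<in> closure G \<Longrightarrow> x \<notin> straight \<phi> N ` tube w0 r (e/2) \<Longrightarrow> H x = 0 \<and> H' x N = 0"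
  shows "(LINT x:straight \<phi> N ` half s|lborel. H' x N) =
    - s *\<^sub>R (LINT w:ball w0 r|lborel. \<bar>cross4 (jacobian \<phi> (at w)) \<bullet> N\<bar> *\<^sub>R H (\<phi> w))"
proof -
  let ?\<Phi> = "straight \<phi> N"
  define m where "m w = \<bar>cross4 (jacobian \<phi> (at w)) \<bullet> N\<bar>" for w
  define T' where "T' z h = jacobian \<phi> (at (vpart z)) *v vpart h + (h $ 0) *\<^sub>R N" for z h
  have ss: "s * s = 1" using s by (auto simp: abs_if split: if_splits)
  have Hc: "continuous_on (closure G) H" "\<And>v. continuous_on (closure G) (\<lambda>x. H' x v)"
    and Hd: "\<And>x. x \<in> G \<Longrightarrow> (H has_derivative H' x) (at x)"
    using H by (auto simp: C1_upto_def)
  have cG: "compact (closure G)" using G(2) by simp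
  have PcG: "?\<Phi> ` half s \<subseteq> closure G" using PG closure_subset by blast
  have op: "open (?\<Phi> ` half s)" by (rule open_straight_image[OF open_half half_subset])
  have HP: "set_integrable lborel (?\<Phi> ` half s) (\<lambda>x. H' x N)"
    using op by (intro set_integrable_bounded_continuous[OF cG Hc(2) _ PcG]) simp
  have det: "\<bar>det (matrix (T' z))\<bar> = m (vpart z)" for z
    unfolding T'_def[abs_def] m_def by (simp add: det_matrix_cross4)
  have cm: "continuous_on W m" unfolding m_def by (intro continuous_intros continuous_on_jacobian C1)
  have "continuous_on (half s) (\<lambda>z. m (vpart z))"
    by (rule continuous_on_compose2[OF cm]) (use ball_W in \<open>auto simp: half_def tube_def intro!: continuous_intros\<close>)
  moreover have "continuous_on (half s) (\<lambda>z. H' (?\<Phi> z) N)"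
    by (rule continuous_on_compose2[OF Hc(2) continuous_on_subset[OF continuous_straight half_subset] PcG])
  ultimately have "continuous_on (half s) (\<lambda>z. \<bar>det (matrix (T' z))\<bar> *\<^sub>R H' (?\<Phi> z) N)"
    unfolding det by (intro continuous_intros)
  note cv = set_integral_change_of_variables[OF _ _ inj_on_subset[OF inj half_subset] HP this]
  have der: "(?\<Phi> has_derivative T' z) (at z)" if "z \<in> half s" for z
    using deriv_straight[of z] that half_subset unfolding T'_def by auto
  have hb: "half s \<in> sets borel" using open_half by simp
  have I: "integrable lborel (\<lambda>z. indicator (half s) z *\<^sub>R m (vpart z) *\<^sub>R H' (?\<Phi> z) N)"
    using cv(1)[OF hb der] unfolding det set_integrable_def by simp
  have inner: "(LINT t|lborel. indicator (half s) (join t w) *\<^sub>R m w *\<^sub>R H' (\<phi> w + t *\<^sub>R N) N) =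
      indicator (ball w0 r) w *\<^sub>R (m w *\<^sub>R (- s *\<^sub>R H (\<phi> w)))" for w
  proof (cases "w \<in> ball w0 r")
    case False
    then show ?thesis by (simp add: half_def)
  next
    case w: True
    \<comment> \<open>Substituting \<open>s * t\<close> makes the segment start at the surface and
      run over positive \<open>t\<close> for either sign.\<close>
    define \<gamma> where "\<gamma> t = H (\<phi> w + (s * t) *\<^sub>R N)" for t
    define \<gamma>' where "\<gamma>' t = s *\<^sub>R H' (\<phi> w + (s * t) *\<^sub>R N) N" for t
    have inG: "\<phi> w + (s * t) *\<^sub>R N \<in> G" if "0 < t" "t < e" for t
      using ray_in_half[OF w s that] PG by blast
    have in_closure: "\<phi> w + (s * t) *\<^sub>R N \<in> closure G" if "0 \<le> t" "t < e" for t
    proof (cases "t = 0")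
      case True
      then show ?thesis using base_in_closure_half[OF w s] closure_mono[OF PG] by auto
    next
      case False
      then show ?thesis using inG[of t] that closure_subset by auto
    qed
    have far: "H (\<phi> w + (s * t) *\<^sub>R N) = 0 \<and> H' (\<phi> w + (s * t) *\<^sub>R N) N = 0" if "e/2 \<le> t" "t < e" for t
    proof (rule supp)
      show "\<phi> w + (s * t) *\<^sub>R N \<in> closure G" using that e by (intro in_closure) auto
      show "\<phi> w + (s * t) *\<^sub>R N \<notin> ?\<Phi> ` tube w0 r (e/2)"
      proof
        assume "\<phi> w + (s * t) *\<^sub>R N \<in> ?\<Phi> ` tube w0 r (e/2)"
        then obtain z where z: "z \<in> tube w0 r (e/2)" "?\<Phi> (join (s * t) w) = ?\<Phi> z" by auto
        have "join (s * t) w \<in> tube w0 r e" "z \<in> tube w0 r e"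
          using w that s e z(1) by (auto simp: tube_def abs_mult)
        then have "join (s * t) w = z" by (rule inj_onD[OF inj z(2)])
        then show False using z(1) that s e by (auto simp: abs_mult)
      qed
    qed
    have c\<gamma>: "continuous_on {0..e/2} \<gamma>" unfolding \<gamma>_def
      by (rule continuous_on_compose2[OF Hc(1)]) (use in_closure e in \<open>auto intro!: continuous_intros\<close>)
    have c\<gamma>': "continuous_on {0..e/2} \<gamma>'" unfolding \<gamma>'_def
      by (intro continuous_intros continuous_on_compose2[OF Hc(2)]) (use in_closure e in \<open>auto intro!: continuous_intros\<close>)
    \<comment> \<open>At \<open>t = 0\<close> the point may lie on the boundary of \<open>G\<close>,
      where \<open>H\<close> is only continuous; hence the version that differentiates in the
      interior.\<close>
    have "(\<gamma>' has_integral (\<gamma> (e/2) - \<gamma> 0)) {0..e/2}"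
    proof (rule fundamental_theorem_of_calculus_interior)
      fix t assume t: "t \<in> {0<..<e/2}"
      have d: "((\<lambda>t. \<phi> w + (s * t) *\<^sub>R N) has_derivative (\<lambda>h. (s * h) *\<^sub>R N)) (at t)"
        by (auto intro!: derivative_eq_intros)
      have Hd': "(H has_derivative H' (\<phi> w + (s * t) *\<^sub>R N)) (at (\<phi> w + (s * t) *\<^sub>R N))"
        using t e by (intro Hd inG) auto
      have "H' (\<phi> w + (s * t) *\<^sub>R N) ((s * h) *\<^sub>R N) = h *\<^sub>R \<gamma>' t" for h
        using linear_scale[OF has_derivative_linear[OF Hd']] by (simp add: \<gamma>'_def)
      then show "(\<gamma> has_vector_derivative \<gamma>' t) (at t)"
        using has_derivative_compose[OF d Hd'] by (simp add: has_vector_derivative_def \<gamma>_def[abs_def])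
    qed (use e c\<gamma> in auto)
    moreover have "set_integrable lborel {0..e/2} \<gamma>'"
      by (rule set_integrable_bounded_continuous[OF _ c\<gamma>']) auto
    ultimately have "(LINT t:{0..e/2}|lborel. \<gamma>' t) = \<gamma> (e/2) - \<gamma> 0"
      by (simp add: set_borel_integral_eq_integral(2) integral_unique)
    also have "\<gamma> (e/2) = 0" using far[of "e/2"] e by (simp add: \<gamma>_def)
    finally have ftc: "(LINT t:{0..e/2}|lborel. \<gamma>' t) = - H (\<phi> w)" by (simp add: \<gamma>_def)
    have "(LINT t|lborel. indicator (half s) (join t w) *\<^sub>R m w *\<^sub>R H' (\<phi> w + t *\<^sub>R N) N) =
       (LINT t|lborel. indicator (half s) (join (s * t) w) *\<^sub>R m w *\<^sub>R H' (\<phi> w + (s * t) *\<^sub>R N) N)"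
      using lborel_integral_real_affine[of s "\<lambda>t. indicator (half s) (join t w) *\<^sub>R m w *\<^sub>R H' (\<phi> w + t *\<^sub>R N) N" 0]
        s by auto
    also have "\<dots> = (LINT t|lborel. (m w * s) *\<^sub>R (indicator {0..e/2} t *\<^sub>R \<gamma>' t))"
    proof (intro integral_cong_AE)
      \<comment> \<open>The closed interval contains \<open>0\<close> and the half does not, so the
        integrands may differ at this single point.\<close>
      have "AE t in lborel. t \<noteq> (0::real)" by (rule AE_lborel_singleton)
      then show "AE t in lborel. indicator (half s) (join (s * t) w) *\<^sub>R m w *\<^sub>R H' (\<phi> w + (s * t) *\<^sub>R N) N
        = (m w * s) *\<^sub>R (indicator {0..e/2} t *\<^sub>R \<gamma>' t)"
      proof eventually_elim
        case (elim t)
        have "join (s * t) w \<in> half s \<longleftrightarrow> 0 < t \<and> t < e"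
          using w s ss e by (auto simp: half_def abs_mult mult.assoc[symmetric])
        then show ?case using elim far[of t] e ss by (auto simp: \<gamma>'_def indicator_def)
      qed
      have "(\<lambda>t. indicator {0<..<e} t *\<^sub>R (m w *\<^sub>R H' (\<phi> w + (s * t) *\<^sub>R N) N)) \<in> borel_measurable borel"
        by (rule borel_measurable_continuous_on_indicator)
          (use in_closure in \<open>auto intro!: continuous_intros continuous_on_compose2[OF Hc(2)]\<close>)
      moreover have "join (s * t) w \<in> half s \<longleftrightarrow> t \<in> {0<..<e}" for t
        using w s ss e by (auto simp: half_def abs_mult mult.assoc[symmetric])
      ultimately show "(\<lambda>t. indicator (half s) (join (s * t) w) *\<^sub>R m w *\<^sub>R H' (\<phi> w + (s * t) *\<^sub>R N) N)
          \<in> borel_measurable lborel"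
        by (simp add: indicator_def)
      show "(\<lambda>t. (m w * s) *\<^sub>R (indicator {0..e/2} t *\<^sub>R \<gamma>' t)) \<in> borel_measurable lborel"
        using borel_measurable_scaleR[OF borel_measurable_const borel_measurable_continuous_on_indicator[OF _ c\<gamma>']]
        by (simp del: scaleR_scaleR)
    qed
    also have "\<dots> = (m w * s) *\<^sub>R (- H (\<phi> w))"
      using ftc by (simp add: set_lebesgue_integral_def del: scaleR_scaleR)
    finally show ?thesis using w by simp
  qed
  have "(LINT x:?\<Phi> ` half s|lborel. H' x N) = (LINT z|lborel. indicator (half s) z *\<^sub>R m (vpart z) *\<^sub>R H' (?\<Phi> z) N)"
    using cv(2)[OF hb der] unfolding det set_lebesgue_integral_def by simp
  also have "\<dots> = (LINT w|lborel. LINT t|lborel. indicator (half s) (join t w) *\<^sub>R m w *\<^sub>R H' (\<phi> w + t *\<^sub>R N) N)"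
    using integral_lborel_quat[OF I] by simp
  also have "\<dots> = (LINT w|lborel. - s *\<^sub>R (indicator (ball w0 r) w *\<^sub>R (m w *\<^sub>R H (\<phi> w))))"
    unfolding inner by (simp add: mult_ac)
  also have "\<dots> = - s *\<^sub>R (LINT w:ball w0 r|lborel. m w *\<^sub>R H (\<phi> w))"
    unfolding set_lebesgue_integral_def by (rule integral_scaleR_right)
  finally show ?thesis unfolding m_def .
qed

end

text \<open>With the direction fixed, both sides are linear in the field and in \<open>N\<close>, as
  the partition of unity and the spanning argument require. Integrability is included because
  additivity of the surface integral depends on it.\<close>

definition gauss_at :: "quat set \<Rightarrow> quat \<Rightarrow> (quat \<Rightarrow> quat) \<Rightarrow> (quat \<Rightarrow> quat \<Rightarrow> quat) \<Rightarrow> bool" where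
  "gauss_at G N H H' \<longleftrightarrow>
     set_integrable (surface_measure (frontier G)) (frontier G) (\<lambda>y. (outward_unit_normal G y \<bullet> N) *\<^sub>R H y) \<and>
     (LINT x:G|lborel. H' x N) =
       (LINT y:frontier G|surface_measure (frontier G). (outward_unit_normal G y \<bullet> N) *\<^sub>R H y)"

context straightening
begin

text \<open>The position of the halves is a hypothesis, so that the statement serves boundary points
  as well as interior points, where both halves lie in \<open>G\<close> and the right side is
  \<open>0\<close>.\<close>

lemma volume_integral:
  fixes H :: "quat \<Rightarrow> quat"
  defines "\<iota> \<equiv> \<lambda>G s. if straight \<phi> N ` half s \<subseteq> G then 1 else (0::real)"
  assumes G: "open G" "bounded G" and H: "C1_upto G H H'"
    and side: "\<And>s. straight \<phi> N ` half s \<subseteq> G \<or> straight \<phi> N ` half s \<inter> G = {}"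
    and supp: "\<And>x. x \<in> closure G \<Longrightarrow> x \<notin> straight \<phi> N ` tube w0 r (e/2) \<Longrightarrow> H x = 0 \<and> H' x N = 0"
  shows "(LINT x:G|lborel. H' x N) =
    (\<iota> G (-1) - \<iota> G 1) *\<^sub>R (LINT w:ball w0 r|lborel. \<bar>cross4 (jacobian \<phi> (at w)) \<bullet> N\<bar> *\<^sub>R H (\<phi> w))"
proof -
  let ?\<Phi> = "straight \<phi> N"
  define B where "B = (LINT w:ball w0 r|lborel. \<bar>cross4 (jacobian \<phi> (at w)) \<bullet> N\<bar> *\<^sub>R H (\<phi> w))"
  define I where "I s x = \<iota> G s *\<^sub>R (indicator (?\<Phi> ` half s) x *\<^sub>R H' x N)" for s x
  have cG: "compact (closure G)" using G(2) by simp
  have Hc: "continuous_on (closure G) (\<lambda>x. H' x N)" using H by (simp add: C1_upto_def)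
  have I: "integrable lborel (I s) \<and> integral\<^sup>L lborel (I s) = \<iota> G s *\<^sub>R (- s *\<^sub>R B)" if s: "\<bar>s\<bar> = 1" for s
  proof (cases "?\<Phi> ` half s \<subseteq> G")
    case True
    have "open (?\<Phi> ` half s)" by (rule open_straight_image[OF open_half half_subset])
    then have "set_integrable lborel (?\<Phi> ` half s) (\<lambda>x. H' x N)"
      using True closure_subset by (intro set_integrable_bounded_continuous[OF cG Hc]) auto
    moreover note half_volume[OF G H True s supp, folded B_def]
    ultimately show ?thesis
      unfolding I_def[abs_def] set_integrable_def set_lebesgue_integral_def by (simp del: scaleR_scaleR)
  next
    case False
    then have "I s = (\<lambda>_. 0)" by (simp add: I_def[abs_def] \<iota>_def)
    then show ?thesis using False by (simp add: \<iota>_def)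
  qed
  \<comment> \<open>The slice between the two halves is a differentiable image of part of a
    hyperplane and can be ignored.\<close>
  have "negligible (?\<Phi> ` {z \<in> tube w0 r e. z $ 0 = 0})"
  proof (rule negligible_differentiable_image_negligible)
    have "negligible {z::quat. axis 0 1 \<bullet> z = 0}" by (rule negligible_hyperplane) (simp add: axis_eq_0_iff)
    then show "negligible {z \<in> tube w0 r e. z $ 0 = 0}"
      by (rule negligible_subset) (auto simp: inner_axis')
    show "?\<Phi> differentiable_on {z \<in> tube w0 r e. z $ 0 = 0}"
      using deriv_straight unfolding differentiable_on_def differentiable_def
      by (blast intro: has_derivative_at_withinI)
  qed simp
  then have "AE x in lborel. x \<notin> ?\<Phi> ` {z \<in> tube w0 r e. z $ 0 = 0}"
    using AE_not_in[of _ lebesgue] by (simp add: negligible_iff_null_sets AE_completion_iff)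
  then have "AE x in lborel. indicator G x *\<^sub>R H' x N = I (-1) x + I 1 x"
  proof eventually_elim
    case (elim x)
    show ?case
    proof (cases "x \<in> ?\<Phi> ` tube w0 r e")
      case False
      then have "x \<notin> ?\<Phi> ` half s" for s using half_subset by blast
      moreover have "?\<Phi> ` tube w0 r (e/2) \<subseteq> ?\<Phi> ` tube w0 r e" using e by (intro image_mono tube_mono) auto
      then have "x \<in> G \<Longrightarrow> H' x N = 0" using supp[of x] False closure_subset by blast
      ultimately show ?thesis by (auto simp: I_def indicator_def)
    next
      case True
      then obtain z where z: "z \<in> tube w0 r e" "x = ?\<Phi> z" by blast
      then have z0: "z $ 0 \<noteq> 0" using elim by blast
      have x: "x \<in> ?\<Phi> ` half s \<longleftrightarrow> 0 < s * z $ 0" for s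
      proof
        assume "x \<in> ?\<Phi> ` half s"
        then obtain z' where z': "z' \<in> half s" "?\<Phi> z' = ?\<Phi> z" using z by auto
        then have "z' = z" using half_subset z(1) by (intro inj_onD[OF inj z'(2)]) auto
        then show "0 < s * z $ 0" using z' by (simp add: half_def)
      qed (use z in \<open>auto simp: half_def\<close>)
      have xG: "x \<in> ?\<Phi> ` half s \<Longrightarrow> x \<in> G \<longleftrightarrow> \<iota> G s = 1" for s
        using side[of s] by (auto simp: \<iota>_def)
      have \<iota>: "\<iota> G s = 0 \<or> \<iota> G s = 1" for s by (simp add: \<iota>_def)
      show ?thesis
        using z0 x[of 1] x[of "-1"] xG[of 1] xG[of "-1"] \<iota>[of 1] \<iota>[of "-1"]
        by (cases "z $ 0 > 0") (auto simp: I_def indicator_def)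
    qed
  qed
  then have "(LINT x:G|lborel. H' x N) = (LINT x|lborel. I (-1) x + I 1 x)"
    unfolding set_lebesgue_integral_def
  proof (rule integral_cong_AE[rotated 2])
    show "(\<lambda>x. indicator G x *\<^sub>R H' x N) \<in> borel_measurable lborel"
      using borel_measurable_continuous_on_indicator[OF _ continuous_on_subset[OF Hc closure_subset]] G(1) by simp
    show "(\<lambda>x. I (-1) x + I 1 x) \<in> borel_measurable lborel"
      using I[of 1] I[of "-1"] by (intro borel_measurable_add borel_measurable_integrable) auto
  qed
  also have "\<dots> = \<iota> G (-1) *\<^sub>R B - \<iota> G 1 *\<^sub>R B"
    using I[of 1] I[of "-1"] by simp
  finally show ?thesis by (simp add: B_def scaleR_diff_left)
qed

end

text \<open>Both sides reduce to one integral over the parameter ball, by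
  \<open>volume_integral\<close> and \<open>outward_unit_normal_straight\<close> respectively. The
  radius is chosen before the field, which compactness needs later.\<close>

lemma gauss_boundary_transversal:
  assumes G: "open G" "bounded G" and S: "smooth_surface (frontier G)"
    and lp: "local_param (frontier G) W \<phi>" and w0: "w0 \<in> W"
    and N: "cross4 (jacobian \<phi> (at w0)) \<bullet> N \<noteq> 0"
  obtains d where "d > 0" "\<And>H H'. C1_upto G H H' \<Longrightarrow>
    (\<And>x. x \<in> closure G \<Longrightarrow> x \<notin> ball (\<phi> w0) d \<Longrightarrow> H x = 0 \<and> H' x N = 0) \<Longrightarrow> gauss_at G N H H'"
proof -
  obtain r where s: "straightening W \<phi> N w0 r r" and im: "straight \<phi> N ` tube w0 r r \<inter> frontier G = \<phi> ` ball w0 r"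
    using surface_straightening[OF lp w0 N] .
  interpret straightening W \<phi> N w0 r r by fact
  let ?\<Phi> = "straight \<phi> N" and ?\<sigma> = "surface_measure (frontier G)"
  have cS: "compact (frontier G)" using G(2) by (rule compact_frontier_bounded)
  have cG: "compact (closure G)" using G(2) by simp
  have "open (?\<Phi> ` tube w0 r (r/2))"
    using r by (intro open_straight_image open_tube tube_mono) auto
  moreover have "\<phi> w0 \<in> ?\<Phi> ` tube w0 r (r/2)"
    using r by (intro image_eqI[of _ _ "join 0 w0"]) auto
  ultimately obtain d where d: "d > 0" "ball (\<phi> w0) d \<subseteq> ?\<Phi> ` tube w0 r (r/2)"
    using open_contains_ball by blast
  define \<iota> where "\<iota> = (if ?\<Phi> ` half (-1) \<subseteq> G then 1 else (0::real)) - (if ?\<Phi> ` half 1 \<subseteq> G then 1 else 0)"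
  define J where "J w = norm (cross4 (jacobian \<phi> (at w)))" for w
  define m where "m w = \<bar>cross4 (jacobian \<phi> (at w)) \<bullet> N\<bar>" for w
  have lpb: "local_param (frontier G) (ball w0 r) \<phi>"
    by (rule local_param_subset[OF lp open_ball ball_W])
  have J0: "J w \<noteq> 0" if "w \<in> ball w0 r" for w
    using transversal[OF that] by (auto simp: J_def)
  have normal: "J w * (outward_unit_normal G (\<phi> w) \<bullet> N) = \<iota> * m w" if "w \<in> ball w0 r" for w
    using outward_unit_normal_straight[OF G(1) that im] by (simp add: J_def m_def \<iota>_def)
  have cJ: "continuous_on W J" and cm: "continuous_on W m"
    unfolding J_def m_def by (intro continuous_intros continuous_on_jacobian C1)+
  have \<phi>S: "\<phi> ` cball w0 r \<subseteq> closure G"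
    using local_paramD(2)[OF lp] openin_imp_subset cball_W by (fastforce simp: frontier_def)
  have c\<phi>: "continuous_on (cball w0 r) \<phi>"
    using continuous_on_subset[OF local_paramD(5)[OF lp] cball_W] .
  show thesis
  proof (rule that[OF d(1)])
    fix H :: "quat \<Rightarrow> quat" and H' assume H: "C1_upto G H H'"
      and "\<And>x. x \<in> closure G \<Longrightarrow> x \<notin> ball (\<phi> w0) d \<Longrightarrow> H x = 0 \<and> H' x N = 0"
    then have supp: "H x = 0 \<and> H' x N = 0" if "x \<in> closure G" "x \<notin> ?\<Phi> ` tube w0 r (r/2)" for x
      using that d(2) by blast
    have Hc: "continuous_on (closure G) H" using H by (simp add: C1_upto_def)
    define h where "h y = (outward_unit_normal G y \<bullet> N) *\<^sub>R H y" for y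
    have supp': "h y = 0" if "y \<in> frontier G" "y \<notin> \<phi> ` ball w0 r" for y
    proof -
      have "y \<notin> ?\<Phi> ` tube w0 r r" using that im by blast
      then have "y \<notin> ?\<Phi> ` tube w0 r (r/2)"
        using tube_mono[of r r "r/2" r w0] r by auto
      then show ?thesis using supp[of y] that(1) by (simp add: h_def frontier_def)
    qed
    have inS: "\<phi> ` ball w0 r \<subseteq> frontier G" using im by blast
    have ind: "indicator (frontier G) y *\<^sub>R h y = indicator (\<phi> ` ball w0 r) y *\<^sub>R h y" for y
      using supp'[of y] inS by (auto simp: indicator_def)
    \<comment> \<open>Continuity of the normal is not known in advance. On the patch its
      \<open>N\<close>-component is the quotient \<open>\<iota> * m / J\<close> read through the
      inverse parametrization, which is visibly continuous.\<close>
    have "continuous_on (\<phi> ` ball w0 r) (\<lambda>y. (\<iota> * m (inv_into (ball w0 r) \<phi> y) / J (inv_into (ball w0 r) \<phi> y)) *\<^sub>R H y)"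
    proof (intro continuous_intros)
      note ci = local_paramD(6)[OF lpb]
      have inv: "inv_into (ball w0 r) \<phi> y \<in> W" if "y \<in> \<phi> ` ball w0 r" for y
        using inv_into_into[OF that] ball_W by blast
      show "continuous_on (\<phi> ` ball w0 r) (\<lambda>y. m (inv_into (ball w0 r) \<phi> y))"
        by (rule continuous_on_compose2[OF cm ci]) (use inv in blast)
      show "continuous_on (\<phi> ` ball w0 r) (\<lambda>y. J (inv_into (ball w0 r) \<phi> y))"
        by (rule continuous_on_compose2[OF cJ ci]) (use inv in blast)
      show "continuous_on (\<phi> ` ball w0 r) H"
        using \<phi>S by (intro continuous_on_subset[OF Hc]) force
      show "\<forall>y\<in>\<phi> ` ball w0 r. J (inv_into (ball w0 r) \<phi> y) \<noteq> 0"
        by (intro ballI J0 inv_into_into)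
    qed
    moreover have "(\<iota> * m (inv_into (ball w0 r) \<phi> y) / J (inv_into (ball w0 r) \<phi> y)) *\<^sub>R H y = h y"
      if "y \<in> \<phi> ` ball w0 r" for y
    proof -
      obtain w where w: "w \<in> ball w0 r" "y = \<phi> w" using \<open>y \<in> _\<close> by blast
      then show ?thesis
        using normal[OF w(1)] J0[OF w(1)] local_paramD(4)[OF lpb] by (simp add: h_def field_simps)
    qed
    ultimately have hc: "continuous_on (\<phi> ` ball w0 r) h"
      by (simp cong: continuous_on_cong)
    have Jh: "J w *\<^sub>R h (\<phi> w) = \<iota> *\<^sub>R (m w *\<^sub>R H (\<phi> w))" if "w \<in> ball w0 r" for w
      using normal[OF that] by (simp add: h_def)
    note patch = surface_integral_patch[OF cS S lpb hc, folded J_def]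
    have "set_integrable lborel (ball w0 r) (\<lambda>w. \<iota> *\<^sub>R (m w *\<^sub>R H (\<phi> w)))"
      by (rule set_integrable_bounded_continuous[OF compact_cball[of w0 r]])
        (use cball_W \<phi>S in \<open>auto intro!: continuous_intros continuous_on_subset[OF cm] continuous_on_compose2[OF Hc c\<phi>]\<close>)
    then have "set_integrable lborel (ball w0 r) (\<lambda>w. J w *\<^sub>R h (\<phi> w))"
      by (subst set_integrable_cong[OF refl refl Jh]) auto
    then have "set_integrable ?\<sigma> (\<phi> ` ball w0 r) h" using patch(1) by simp
    then have 1: "set_integrable ?\<sigma> (frontier G) h" by (simp add: set_integrable_def ind)
    have "(LINT y:frontier G|?\<sigma>. h y) = (LINT w:ball w0 r|lborel. J w *\<^sub>R h (\<phi> w))"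
      using patch(2) by (simp add: set_lebesgue_integral_def ind)
    also have "\<dots> = (LINT w:ball w0 r|lborel. \<iota> *\<^sub>R (m w *\<^sub>R H (\<phi> w)))"
      by (intro set_lebesgue_integral_cong) (auto simp: Jh)
    also have "\<dots> = \<iota> *\<^sub>R (LINT w:ball w0 r|lborel. m w *\<^sub>R H (\<phi> w))"
      by (rule set_integral_scaleR_right)
    also have "\<dots> = (LINT x:G|lborel. H' x N)"
      unfolding \<iota>_def m_def
      by (rule volume_integral[OF G H straight_half_side[OF equalityD1[OF im]] supp, symmetric])
    finally show "gauss_at G N H H'" using 1 by (simp add: gauss_at_def h_def[abs_def])
  qed
qed

text \<open>An artificial flat sheet through \<open>y0\<close>, orthogonal to the real axis,
  replaces the surface. Both of its sides lie in \<open>G\<close>, so the volume integral cancels,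
  and the field vanishes on the true frontier.\<close>

lemma gauss_interior_transversal:
  assumes G: "open G" "bounded G" and y0: "y0 \<in> G" and N: "N $ 0 \<noteq> 0"
  obtains d where "d > 0" "\<And>H H'. C1_upto G H H' \<Longrightarrow>
    (\<And>x. x \<in> closure G \<Longrightarrow> x \<notin> ball y0 d \<Longrightarrow> H x = 0 \<and> H' x N = 0) \<Longrightarrow> gauss_at G N H H'"
proof -
  define \<phi> where "\<phi> w = y0 + join 0 w" for w
  have bl: "bounded_linear (join 0)"
    by (auto simp: linear_conv_bounded_linear[symmetric] linear_iff quat_eq_iff)
  have der: "(\<phi> has_derivative blinfun_apply (Blinfun (join 0))) (at w)" for w
    unfolding \<phi>_def[abs_def] bounded_linear_Blinfun_apply[OF bl]
    by (auto intro!: derivative_eq_intros)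
  have C1: "C1_on UNIV \<phi>"
    unfolding C1_on_def by (intro exI[of _ "\<lambda>_. Blinfun (join 0)"]) (simp add: der)
  have "jacobian \<phi> (at w) = matrix (join 0)" for w
    using frechet_derivative_at[OF der[of w]] by (simp add: jacobian_def bounded_linear_Blinfun_apply[OF bl])
  then have "cross4 (jacobian \<phi> (at 0)) \<bullet> N \<noteq> 0"
    using N by (simp add: cross4_def matrix_def inner_vec_def sum_quat axis_def)
  note ex = straightening_exists[OF open_UNIV C1 UNIV_I this]
  have "open (straight \<phi> N -` G)"
    unfolding straight_def \<phi>_def by (intro open_vimage[OF G(1)] continuous_intros)
  moreover have "join 0 0 \<in> straight \<phi> N -` G"
  proof -
    have "join 0 0 = 0" by (simp add: quat_eq_iff)
    moreover have "vpart 0 = 0" by (simp add: vec_eq_iff forall_3)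
    ultimately show ?thesis using y0 by (simp add: \<phi>_def straight_def)
  qed
  ultimately obtain r where s: "straightening UNIV \<phi> N 0 r r" and sub: "tube 0 r r \<subseteq> straight \<phi> N -` G"
    using ex by metis
  interpret straightening UNIV \<phi> N 0 r r by fact
  let ?\<Phi> = "straight \<phi> N"
  have half_G: "?\<Phi> ` half s \<subseteq> G" for s using sub half_subset by blast
  have sub2: "tube 0 r (r/2) \<subseteq> tube 0 r r" using r by (intro tube_mono) auto
  have "open (?\<Phi> ` tube 0 r (r/2))"
    using sub2 by (intro open_straight_image open_tube)
  moreover have "y0 \<in> ?\<Phi> ` tube 0 r (r/2)"
    using r by (intro image_eqI[of _ _ "join 0 0"]) (auto simp: \<phi>_def quat_eq_iff)
  ultimately obtain d where d: "d > 0" "ball y0 d \<subseteq> ?\<Phi> ` tube 0 r (r/2)"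
    using open_contains_ball by blast
  show thesis
  proof (rule that[OF d(1)])
    fix H :: "quat \<Rightarrow> quat" and H' assume H: "C1_upto G H H'"
      and sH: "\<And>x. x \<in> closure G \<Longrightarrow> x \<notin> ball y0 d \<Longrightarrow> H x = 0 \<and> H' x N = 0"
    then have supp: "H x = 0 \<and> H' x N = 0" if "x \<in> closure G" "x \<notin> ?\<Phi> ` tube 0 r (r/2)" for x
      using that d(2) by blast
    have "?\<Phi> ` half s \<subseteq> G \<or> ?\<Phi> ` half s \<inter> G = {}" for s using half_G by blast
    from volume_integral[of G H H', OF G H this supp] have 0: "(LINT x:G|lborel. H' x N) = 0" by (simp add: half_G)
    have "H y = 0" if "y \<in> frontier G" for y
    proof -
      have "y \<notin> G" using that G(1) by (simp add: frontier_def interior_open)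
      then have "y \<notin> ball y0 d" using d(2) sub sub2 by blast
      then show ?thesis using sH that by (simp add: frontier_def)
    qed
    then have z: "indicator (frontier G) y *\<^sub>R ((outward_unit_normal G y \<bullet> N) *\<^sub>R H y) = 0" for y
      by (simp add: indicator_def)
    show "gauss_at G N H H'"
      unfolding gauss_at_def set_integrable_def set_lebesgue_integral_def[of "surface_measure _"] z using 0 by simp
  qed
qed

section \<open>Linearity and localization of the Gauss formula\<close>

lemma C1_upto_set_integrable:
  fixes H :: "quat \<Rightarrow> 'b::euclidean_space"
  assumes "open G" "bounded G" "C1_upto G H H'"
  shows "set_integrable lborel G (\<lambda>x. H' x N)"
  using assms by (intro set_integrable_bounded_continuous[of "closure G"]) (auto simp: C1_upto_def closure_subset)

lemma gauss_at_add:
  assumes G: "open G" "bounded G" and H: "C1_upto G H H'" "C1_upto G K K'"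
    and g: "gauss_at G N H H'" "gauss_at G N K K'"
  shows "gauss_at G N (\<lambda>x. H x + K x) (\<lambda>x v. H' x v + K' x v)"
  using g C1_upto_set_integrable[OF G H(1), of N] C1_upto_set_integrable[OF G H(2), of N]
  by (simp add: gauss_at_def scaleR_add_right set_integral_add)

lemma gauss_at_direction_diff:
  assumes G: "open G" "bounded G" and H: "C1_upto G H H'"
    and g: "gauss_at G M H H'" "gauss_at G N H H'"
  shows "gauss_at G (M - N) H H'"
proof -
  have "H' x (M - N) = H' x M - H' x N" if "x \<in> G" for x
    using H that by (intro linear_diff has_derivative_linear) (auto simp: C1_upto_def)
  then have "(LINT x:G|lborel. H' x (M - N)) = (LINT x:G|lborel. H' x M - H' x N)"
    using G(1) by (intro set_lebesgue_integral_cong) auto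
  then show ?thesis
    using g C1_upto_set_integrable[OF G H, of M] C1_upto_set_integrable[OF G H, of N]
    by (simp add: gauss_at_def inner_diff_right scaleR_diff_left set_integral_diff)
qed

lemma gauss_at_cong:
  assumes "open G" "\<And>x. x \<in> closure G \<Longrightarrow> H x = K x" "\<And>x. x \<in> G \<Longrightarrow> H' x N = K' x N"
  shows "gauss_at G N H H' \<longleftrightarrow> gauss_at G N K K'"
proof -
  have 1: "(LINT x:G|lborel. H' x N) = (LINT x:G|lborel. K' x N)"
    using assms by (intro set_lebesgue_integral_cong) auto
  have 2: "indicator (frontier G) y *\<^sub>R ((outward_unit_normal G y \<bullet> N) *\<^sub>R H y) =
      indicator (frontier G) y *\<^sub>R ((outward_unit_normal G y \<bullet> N) *\<^sub>R K y)" for y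
    using assms(2)[of y] by (auto simp: indicator_def frontier_def)
  show ?thesis
    unfolding gauss_at_def set_integrable_def set_lebesgue_integral_def[of "surface_measure _"] 1 2 ..
qed

text \<open>The vector \<open>c\<close> unifies the cases: the surface normal at a boundary point,
  the real axis at an interior point. The support condition covers every direction \<open>v\<close>,
  so that it applies to both transversal directions into which \<open>N\<close> is split.\<close>

lemma gauss_local:
  assumes G: "open G" "bounded G" and S: "smooth_surface (frontier G)" and y0: "y0 \<in> closure G"
  obtains d where "d > 0" "\<And>H H'. C1_upto G H H' \<Longrightarrow>
    (\<And>x v. x \<in> closure G \<Longrightarrow> x \<notin> ball y0 d \<Longrightarrow> H x = 0 \<and> H' x v = 0) \<Longrightarrow> gauss_at G N H H'"
proof -
  have "\<exists>c. c \<noteq> 0 \<and> (\<forall>M. c \<bullet> M \<noteq> 0 \<longrightarrow> (\<exists>d>0. \<forall>H H'. C1_upto G H H' \<longrightarrow>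
    (\<forall>x\<in>closure G. x \<notin> ball y0 d \<longrightarrow> H x = 0 \<and> H' x M = 0) \<longrightarrow> gauss_at G M H H'))"
  proof (cases "y0 \<in> G")
    case True
    show ?thesis
    proof (intro exI[of _ "axis 0 1"] conjI allI impI)
      fix M :: quat assume "axis 0 1 \<bullet> M \<noteq> 0"
      then have "M $ 0 \<noteq> 0" by (simp add: inner_axis')
      from gauss_interior_transversal[OF G True this]
      show "\<exists>d>0. \<forall>H H'. C1_upto G H H' \<longrightarrow>
        (\<forall>x\<in>closure G. x \<notin> ball y0 d \<longrightarrow> H x = 0 \<and> H' x M = 0) \<longrightarrow> gauss_at G M H H'" by metis
    qed (simp add: axis_eq_0_iff)
  next
    case False
    then have "y0 \<in> frontier G" using y0 G(1) by (simp add: frontier_def interior_open)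
    then obtain W \<phi> w0 where lp: "local_param (frontier G) W \<phi>" and w0: "w0 \<in> W" "y0 = \<phi> w0"
      using S by (auto simp: smooth_surface_def)
    show ?thesis
    proof (intro exI[of _ "cross4 (jacobian \<phi> (at w0))"] conjI allI impI)
      show "cross4 (jacobian \<phi> (at w0)) \<noteq> 0" by (rule local_param_cross4_nonzero[OF lp w0(1)])
      fix M assume "cross4 (jacobian \<phi> (at w0)) \<bullet> M \<noteq> 0"
      from gauss_boundary_transversal[OF G S lp w0(1) this]
      show "\<exists>d>0. \<forall>H H'. C1_upto G H H' \<longrightarrow>
        (\<forall>x\<in>closure G. x \<notin> ball y0 d \<longrightarrow> H x = 0 \<and> H' x M = 0) \<longrightarrow> gauss_at G M H H'"
        unfolding w0(2) by metis
    qed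
  qed
  then obtain c where c: "c \<noteq> 0" and *: "\<And>M. c \<bullet> M \<noteq> 0 \<Longrightarrow> \<exists>d>0. \<forall>H H'. C1_upto G H H' \<longrightarrow>
    (\<forall>x\<in>closure G. x \<notin> ball y0 d \<longrightarrow> H x = 0 \<and> H' x M = 0) \<longrightarrow> gauss_at G M H H'" by blast
  \<comment> \<open>Either \<open>N\<close> is orthogonal to \<open>c\<close> and equals
    \<open>(N + c) - c\<close>, or it is transversal itself and equals
    \<open>(N + N) - N\<close>.\<close>
  have "\<exists>M1 M2. c \<bullet> M1 \<noteq> 0 \<and> c \<bullet> M2 \<noteq> 0 \<and> N = M1 - M2"
  proof (cases "c \<bullet> N = 0")
    case True
    then show ?thesis using c by (intro exI[of _ "N + c"] exI[of _ c]) (simp add: inner_add_right)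
  next
    case False
    then have "c \<bullet> (N + N) \<noteq> 0" unfolding inner_add_right by simp
    moreover have "N = (N + N) - N" by (rule add_diff_cancel_right'[symmetric])
    ultimately show ?thesis using False by blast
  qed
  then obtain M1 M2 where M: "c \<bullet> M1 \<noteq> 0" "c \<bullet> M2 \<noteq> 0" "N = M1 - M2" by blast
  obtain d1 where d1: "d1 > 0" "\<And>H H'. C1_upto G H H' \<Longrightarrow>
    (\<forall>x\<in>closure G. x \<notin> ball y0 d1 \<longrightarrow> H x = 0 \<and> H' x M1 = 0) \<Longrightarrow> gauss_at G M1 H H'"
    using *[OF M(1)] by blast
  obtain d2 where d2: "d2 > 0" "\<And>H H'. C1_upto G H H' \<Longrightarrow>
    (\<forall>x\<in>closure G. x \<notin> ball y0 d2 \<longrightarrow> H x = 0 \<and> H' x M2 = 0) \<Longrightarrow> gauss_at G M2 H H'"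
    using *[OF M(2)] by blast
  show thesis
  proof (rule that[of "min d1 d2"])
    fix H :: "quat \<Rightarrow> quat" and H' assume H: "C1_upto G H H'"
      and s: "\<And>x v. x \<in> closure G \<Longrightarrow> x \<notin> ball y0 (min d1 d2) \<Longrightarrow> H x = 0 \<and> H' x v = 0"
    have "gauss_at G M1 H H'" "gauss_at G M2 H H'"
      using s by (auto intro!: d1(2)[OF H] d2(2)[OF H])
    then show "gauss_at G N H H'" unfolding M(3) by (rule gauss_at_direction_diff[OF G H])
  qed (use d1 d2 in simp)
qed

section \<open>Partition of unity and the global Gauss formula\<close>

definition bump :: "'a::euclidean_space \<Rightarrow> real \<Rightarrow> 'a \<Rightarrow> real" where
  "bump y d x = (max 0 (d\<^sup>2 - (x - y) \<bullet> (x - y)))\<^sup>2"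

definition bump' :: "'a::euclidean_space \<Rightarrow> real \<Rightarrow> 'a \<Rightarrow> 'a \<Rightarrow> real" where
  "bump' y d x v = 2 * max 0 (d\<^sup>2 - (x - y) \<bullet> (x - y)) * - (2 * ((x - y) \<bullet> v))"

text \<open>Squaring removes the kink of the truncation, so that \<open>bump\<close> is of class C1.
  At the origin the difference quotient is bounded by \<open>\<bar>h\<bar>\<close>.\<close>

lemma DERIV_max_0_square: "((\<lambda>u::real. (max 0 u)\<^sup>2) has_real_derivative 2 * max 0 u) (at u)"
proof -
  consider "u > 0" | "u < 0" | "u = 0" by linarith
  then show ?thesis
  proof cases
    case 1
    have "((\<lambda>u::real. u\<^sup>2) has_real_derivative 2 * max 0 u) (at u)"
      using 1 by (auto intro!: derivative_eq_intros)
    then show ?thesis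
      by (rule has_field_derivative_transform_within_open[of _ _ _ "{0<..}"]) (use 1 in auto)
  next
    case 2
    have "((\<lambda>u::real. 0) has_real_derivative 2 * max 0 u) (at u)"
      using 2 by (auto intro!: derivative_eq_intros)
    then show ?thesis
      by (rule has_field_derivative_transform_within_open[of _ _ _ "{..<0}"]) (use 2 in auto)
  next
    case 3
    have "(\<lambda>h::real. \<bar>h\<bar>) \<midarrow>0\<rightarrow> 0" by (auto intro!: tendsto_eq_intros)
    then have "(\<lambda>h::real. (max 0 h)\<^sup>2 / h) \<midarrow>0\<rightarrow> 0"
      by (rule Lim_null_comparison[rotated])
        (auto simp: max_def power2_eq_square intro!: always_eventually)
    then show ?thesis using 3 by (simp add: DERIV_def)
  qed
qed

lemma has_derivative_bump: "(bump y d has_derivative bump' y d x) (at x)"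
proof -
  have "((\<lambda>x. d\<^sup>2 - (x - y) \<bullet> (x - y)) has_derivative (\<lambda>v. - (2 * ((x - y) \<bullet> v)))) (at x)"
    by (auto intro!: derivative_eq_intros simp: inner_commute)
  from has_derivative_compose[OF this DERIV_max_0_square[THEN has_field_derivative_imp_has_derivative]]
  show ?thesis unfolding bump_def[abs_def] bump'_def[abs_def] .
qed

lemma continuous_on_bump: "continuous_on S (bump y d)" "continuous_on S (\<lambda>x. bump' y d x v)"
  unfolding bump_def[abs_def] bump'_def by (intro continuous_intros)+

lemma bump_support: "x \<notin> ball y d \<Longrightarrow> 0 < d \<Longrightarrow> bump y d x = 0 \<and> bump' y d x v = 0"
  and bump_pos: "x \<in> ball y d \<Longrightarrow> bump y d x > 0"
  and bump_nonneg: "bump y d x \<ge> 0"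
proof -
  have n: "(x - y) \<bullet> (x - y) = (dist y x)\<^sup>2" by (simp add: dist_norm norm_minus_commute power2_norm_eq_inner)
  show "bump y d x = 0 \<and> bump' y d x v = 0" if "x \<notin> ball y d" "0 < d"
    using that power_mono[of d "dist y x" 2] unfolding bump_def bump'_def n by (simp add: max_def)
  show "bump y d x > 0" if "x \<in> ball y d"
    using that power_strict_mono[of "dist y x" d 2] unfolding bump_def n by (simp add: max_def)
  show "bump y d x \<ge> 0" by (simp add: bump_def)
qed

lemma C1_upto_scaleR:
  fixes b :: "quat \<Rightarrow> real"
  assumes "C1_upto G b b'" "C1_upto G H H'"
  shows "C1_upto G (\<lambda>x. b x *\<^sub>R H x) (\<lambda>x v. b x *\<^sub>R H' x v + b' x v *\<^sub>R H x)"
  using assms unfolding C1_upto_def by (auto intro!: continuous_intros has_derivative_scaleR)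

lemma C1_upto_sum:
  assumes "\<And>i. i \<in> F \<Longrightarrow> C1_upto G (H i) (H' i)"
  shows "C1_upto G (\<lambda>x. \<Sum>i\<in>F. H i x) (\<lambda>x v. \<Sum>i\<in>F. H' i x v)"
  using assms unfolding C1_upto_def by (auto intro!: continuous_intros has_derivative_sum)

lemma C1_upto_inverse:
  fixes b :: "quat \<Rightarrow> real"
  assumes b: "C1_upto G b b'" and nz: "\<And>x. x \<in> closure G \<Longrightarrow> b x \<noteq> 0"
  shows "C1_upto G (\<lambda>x. inverse (b x)) (\<lambda>x v. - (inverse (b x) * b' x v * inverse (b x)))"
  using b nz subsetD[OF closure_subset, THEN nz] unfolding C1_upto_def
  by (auto intro!: continuous_intros Deriv.has_derivative_inverse)

lemma gauss_at_sum:
  assumes G: "open G" "bounded G" and "finite F" and "\<And>i. i \<in> F \<Longrightarrow> C1_upto G (H i) (H' i)"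
    and "\<And>i. i \<in> F \<Longrightarrow> gauss_at G N (H i) (H' i)"
  shows "gauss_at G N (\<lambda>x. \<Sum>i\<in>F. H i x) (\<lambda>x v. \<Sum>i\<in>F. H' i x v)"
  using assms(3-5)
proof (induction F rule: finite_induct)
  case empty
  show ?case by (simp add: gauss_at_def set_integrable_def set_lebesgue_integral_def)
next
  case (insert i F)
  then have "gauss_at G N (\<lambda>x. H i x + (\<Sum>i\<in>F. H i x)) (\<lambda>x v. H' i x v + (\<Sum>i\<in>F. H' i x v))"
    by (intro gauss_at_add[OF G] C1_upto_sum) auto
  then show ?case using insert by simp
qed

text \<open>The local radii do not depend on the field, so a finite cover of
  \<open>closure G\<close> can be fixed before the field is cut into pieces.\<close>

theorem gauss_divergence:
  assumes G: "open G" "bounded G" and S: "smooth_surface (frontier G)" and H: "C1_upto G H H'"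
  shows "gauss_at G N H H'"
proof -
  have "\<exists>d>0. \<forall>H H'. C1_upto G H H' \<longrightarrow>
    (\<forall>x\<in>closure G. x \<notin> ball y d \<longrightarrow> (\<forall>v. H x = 0 \<and> H' x v = 0)) \<longrightarrow> gauss_at G N H H'"
    if "y \<in> closure G" for y
    using gauss_local[OF G S that, of N] by metis
  then obtain d where d: "\<And>y. y \<in> closure G \<Longrightarrow> d y > 0"
    "\<And>y H H'. y \<in> closure G \<Longrightarrow> C1_upto G H H' \<Longrightarrow>
      (\<forall>x\<in>closure G. x \<notin> ball y (d y) \<longrightarrow> (\<forall>v. H x = 0 \<and> H' x v = 0)) \<Longrightarrow> gauss_at G N H H'"
    by metis
  have "compact (closure G)" using G(2) by simp
  then obtain F where F: "F \<subseteq> closure G" "finite F" "closure G \<subseteq> (\<Union>y\<in>F. ball y (d y))"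
    by (rule compactE_image[of _ "closure G" "\<lambda>y. ball y (d y)"]) (use d(1) in force)+
  define b where "b y = bump y (d y)" for y
  define b' where "b' y = bump' y (d y)" for y
  define s where "s x = (\<Sum>y\<in>F. b y x)" for x
  define s' where "s' x v = (\<Sum>y\<in>F. b' y x v)" for x v
  have Cb: "C1_upto G (b y) (b' y)" for y
    unfolding C1_upto_def b_def b'_def by (auto intro!: continuous_on_bump has_derivative_bump)
  have Cs: "C1_upto G s s'" unfolding s_def[abs_def] s'_def[abs_def] by (rule C1_upto_sum[OF Cb])
  have s0: "s x \<noteq> 0" if x: "x \<in> closure G" for x
  proof -
    obtain y where "y \<in> F" "x \<in> ball y (d y)" using F(3) x by blast
    then have "s x > 0" unfolding s_def b_def using F(2)
      by (intro sum_pos2[of F y]) (auto simp: bump_nonneg intro: bump_pos)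
    then show ?thesis by simp
  qed
  \<comment> \<open>Normalization: dividing by the sum of the bumps first makes the products of the
    bumps with \<open>K\<close> add up to \<open>H\<close>, and by the product rule their
    derivatives to \<open>H'\<close>.\<close>
  define K where "K x = inverse (s x) *\<^sub>R H x" for x
  define K' where "K' x v = inverse (s x) *\<^sub>R H' x v + (- (inverse (s x) * s' x v * inverse (s x))) *\<^sub>R H x" for x v
  have CK: "C1_upto G K K'"
    unfolding K_def[abs_def] K'_def[abs_def] by (rule C1_upto_scaleR[OF C1_upto_inverse[OF Cs s0] H])
  define L where "L y x = b y x *\<^sub>R K x" for y x
  define L' where "L' y x v = b y x *\<^sub>R K' x v + b' y x v *\<^sub>R K x" for y x v
  have CL: "C1_upto G (L y) (L' y)" for y
    unfolding L_def[abs_def] L'_def[abs_def] by (rule C1_upto_scaleR[OF Cb CK])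
  have "gauss_at G N (L y) (L' y)" if y: "y \<in> F" for y
  proof (rule d(2)[OF _ CL])
    show y': "y \<in> closure G" using F y by blast
    show "\<forall>x\<in>closure G. x \<notin> ball y (d y) \<longrightarrow> (\<forall>v. L y x = 0 \<and> L' y x v = 0)"
      using bump_support[of _ y "d y"] d(1)[OF y'] by (auto simp: L_def L'_def b_def b'_def)
  qed
  then have "gauss_at G N (\<lambda>x. \<Sum>y\<in>F. L y x) (\<lambda>x v. \<Sum>y\<in>F. L' y x v)"
    by (intro gauss_at_sum[OF G F(2)] CL)
  moreover have "(\<Sum>y\<in>F. L y x) = H x" if "x \<in> closure G" for x
  proof -
    have "(\<Sum>y\<in>F. L y x) = s x *\<^sub>R K x" by (simp add: L_def s_def scaleR_sum_left)
    then show ?thesis using s0[OF that] by (simp add: K_def)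
  qed
  moreover have "(\<Sum>y\<in>F. L' y x v) = H' x v" if "x \<in> G" for x v
  proof -
    have "(\<Sum>y\<in>F. L' y x v) = s x *\<^sub>R K' x v + s' x v *\<^sub>R K x"
      by (simp add: L'_def s_def s'_def scaleR_sum_left sum.distrib)
    moreover have "s x \<noteq> 0" using s0 that closure_subset by blast
    ultimately show ?thesis by (simp add: K'_def K_def scaleR_diff_right mult.assoc[symmetric])
  qed
  ultimately show ?thesis by (subst (asm) gauss_at_cong[OF G(1)]) auto
qed

subsection \<open>The form \<open>\<nu>\<close> and the change of variables\<close>

lemma bounded_bilinear_qmul: "bounded_bilinear (\<odot>)"
  by (simp add: bilinear_conv_bounded_bilinear[symmetric] bilinear_def linear_iff quat_eq_iff qmul_def algebra_simps)

interpretation qmul: bounded_bilinear "(\<odot>)"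
  by (rule bounded_bilinear_qmul)

lemma bounded_linear_pure: "bounded_linear pure"
  by (simp add: linear_conv_bounded_linear[symmetric] linear_iff quat_eq_iff pure_def)

lemma pure_nth [simp]: "pure v $ 0 = 0" "pure v $ 1 = v $ 1" "pure v $ 2 = v $ 2" "pure v $ 3 = v $ 3"
  by (simp_all add: pure_def)

lemma pure_square: "pure v \<odot> pure v = - ((norm v)\<^sup>2 *\<^sub>R qone)"
  by (simp add: quat_eq_iff qmul_def qone_def power2_norm_eq_inner inner_vec_def sum_3)

lemma vpart_nonzero: "y \<notin> qreals \<Longrightarrow> vpart y \<noteq> 0"
proof
  assume "y \<notin> qreals" "vpart y = 0"
  then have "y = (y $ 0) *\<^sub>R qone"
    using vpart_nth[of y] by (simp add: quat_eq_iff qone_def)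
  then show False using \<open>y \<notin> qreals\<close> unfolding qreals_def by blast
qed

lemma C1_upto_qmul:
  assumes "C1_upto G P P'" "C1_upto G Q Q'"
  shows "C1_upto G (\<lambda>x. P x \<odot> Q x) (\<lambda>x v. P x \<odot> Q' x v + P' x v \<odot> Q x)"
  using assms unfolding C1_upto_def
  by (auto intro!: continuous_intros qmul.continuous_on qmul.FDERIV)

lemma C1_upto_linear:
  assumes "bounded_linear L"
  shows "C1_upto G L (\<lambda>x. L)"
  unfolding C1_upto_def
  using bounded_linear.has_derivative[OF assms has_derivative_ident] linear_continuous_on[OF assms] by simp

text \<open>By \<open>pure_square\<close> this is minus the quaternionic inverse of the vector part,
  wherever that part is nonzero.\<close>

definition vinv :: "quat \<Rightarrow> quat" where
  "vinv y = (1 / (norm (vpart y))\<^sup>2) *\<^sub>R pure (vpart y)"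

text \<open>Only the radial derivative is made available: in the divergence the three partial
  derivatives, weighted by the coordinates, combine into it. Its value is Euler's relation.\<close>

lemma C1_upto_vinv:
  assumes "closure G \<subseteq> - qreals"
  obtains w' where "C1_upto G vinv w'" "\<And>y. y \<in> G \<Longrightarrow> w' y (pure (vpart y)) = - vinv y"
proof -
  define n where "n y = vpart y \<bullet> vpart y" for y
  define n' where "n' y v = vpart y \<bullet> vpart v + vpart v \<bullet> vpart y" for y v
  define w' where "w' y v = inverse (n y) *\<^sub>R pure (vpart v) +
      (- (inverse (n y) * n' y v * inverse (n y))) *\<^sub>R pure (vpart y)" for y v
  have n0: "n y \<noteq> 0" if "y \<in> closure G" for y using vpart_nonzero[of y] assms that by (auto simp: n_def)
  have "C1_upto G n n'"
    unfolding C1_upto_def n_def[abs_def] n'_def[abs_def]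
    by (auto intro!: continuous_intros derivative_eq_intros has_derivative_vpart has_derivative_ident)
  from C1_upto_scaleR[OF C1_upto_inverse[OF this n0] C1_upto_linear[OF bounded_linear_compose[OF bounded_linear_pure bounded_linear_vpart]]]
  have "C1_upto G (\<lambda>y. inverse (n y) *\<^sub>R pure (vpart y)) w'" unfolding w'_def[abs_def] .
  moreover have "(\<lambda>y. inverse (n y) *\<^sub>R pure (vpart y)) = vinv"
    by (simp add: vinv_def fun_eq_iff n_def power2_norm_eq_inner inverse_eq_divide)
  moreover have "w' y (pure (vpart y)) = - vinv y" if "y \<in> G" for y
  proof -
    have y: "n y \<noteq> 0" using n0 that closure_subset by blast
    have "vpart (pure (vpart y)) = vpart y" by (simp add: pure_def)
    then have "w' y (pure (vpart y)) = (inverse (n y) - inverse (n y) * (2 * n y) * inverse (n y)) *\<^sub>R pure (vpart y)"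
      by (simp add: w'_def n'_def n_def scaleR_diff_left)
    also have "inverse (n y) - inverse (n y) * (2 * n y) * inverse (n y) = - inverse (n y)"
      using y by (simp add: field_simps)
    finally show ?thesis by (simp add: vinv_def n_def power2_norm_eq_inner inverse_eq_divide)
  qed
  ultimately show thesis using that by metis
qed

text \<open>One coordinate direction per summand, the shape to which \<open>gauss_divergence\<close>
  applies.\<close>

lemma nu_density_axis:
  "nu_density n y = (n \<bullet> axis 0 1) *\<^sub>R (2 *\<^sub>R qone) + (\<Sum>k\<in>{1,2,3}. (n \<bullet> axis k 1) *\<^sub>R ((2 * y $ k) *\<^sub>R vinv y))"
proof -
  have "(\<Sum>k\<in>{1,2,3}. (n \<bullet> axis k 1) *\<^sub>R ((2 * y $ k) *\<^sub>R vinv y)) = (2 * (\<Sum>k\<in>{1,2,3}. y $ k * n $ k)) *\<^sub>R vinv y"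
    by (simp add: inner_axis algebra_simps)
  then show ?thesis by (simp add: nu_density_def inner_axis vinv_def mult_ac)
qed

theorem nu_integral_eq_volume_integral:
  assumes G: "open G" "bounded G" and S: "smooth_surface (frontier G)" and nonreal: "closure G \<subseteq> - qreals"
    and P: "C1_upto G P P'" and Q: "C1_upto G Q Q'"
  shows "nu_integral G P Q = (LINT y:G|lborel.
      4 *\<^sub>R (P y \<odot> vinv y \<odot> Q y)
      + 2 *\<^sub>R (P' y (axis 0 1) \<odot> Q y + P y \<odot> Q' y (axis 0 1))
      + 2 *\<^sub>R (P' y (pure (vpart y)) \<odot> vinv y \<odot> Q y + P y \<odot> vinv y \<odot> Q' y (pure (vpart y))))"
proof -
  obtain w' where w: "C1_upto G vinv w'" and wr: "\<And>y. y \<in> G \<Longrightarrow> w' y (pure (vpart y)) = - vinv y"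
    using C1_upto_vinv[OF nonreal] by blast
  define H0 where "H0 y = 2 *\<^sub>R (P y \<odot> Q y)" for y
  define H0' where "H0' y v = 2 *\<^sub>R (P y \<odot> Q' y v + P' y v \<odot> Q y)" for y v
  define R where "R y = P y \<odot> vinv y \<odot> Q y" for y
  define R' where "R' y v = (P y \<odot> vinv y) \<odot> Q' y v + (P y \<odot> w' y v + P' y v \<odot> vinv y) \<odot> Q y" for y v
  define H where "H k y = (2 * y $ k) *\<^sub>R R y" for k y
  define H' where "H' k y v = (2 * y $ k) *\<^sub>R R' y v + (2 * v $ k) *\<^sub>R R y" for k y v
  have R: "C1_upto G R R'"
    unfolding R_def[abs_def] R'_def[abs_def] by (intro C1_upto_qmul P Q w)
  have H: "C1_upto G (H k) (H' k)" for k
    unfolding H_def[abs_def] H'_def[abs_def]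
    by (intro C1_upto_scaleR R C1_upto_linear bounded_linear_const_mult bounded_linear_vec_nth)
  have H0: "C1_upto G H0 H0'"
    using C1_upto_scaleR[OF _ C1_upto_qmul[OF P Q], of "\<lambda>_. 2" "\<lambda>_ _. 0"]
    by (simp add: H0_def[abs_def] H0'_def[abs_def] C1_upto_def[of G "\<lambda>_. 2"])
  let ?\<sigma> = "surface_measure (frontier G)" and ?n = "outward_unit_normal G"
  have "gauss_at G (axis 0 1) H0 H0'" by (rule gauss_divergence[OF G S H0])
  note g0 = this[unfolded gauss_at_def]
  have "gauss_at G (axis k 1) (H k) (H' k)" for k by (rule gauss_divergence[OF G S H])
  note g = this[unfolded gauss_at_def]
  have split: "P y \<odot> nu_density (?n y) y \<odot> Q y =
      (?n y \<bullet> axis 0 1) *\<^sub>R H0 y + ((?n y \<bullet> axis 1 1) *\<^sub>R H 1 y + ((?n y \<bullet> axis 2 1) *\<^sub>R H 2 y + (?n y \<bullet> axis 3 1) *\<^sub>R H 3 y))" for y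
    unfolding nu_density_axis H0_def H_def R_def
    by (simp add: qmul.add_left qmul.add_right qmul.scaleR_left qmul.scaleR_right qmul_qone)
  have "nu_integral G P Q = (LINT x:G|lborel. H0' x (axis 0 1)) + ((LINT x:G|lborel. H' 1 x (axis 1 1)) +
      ((LINT x:G|lborel. H' 2 x (axis 2 1)) + (LINT x:G|lborel. H' 3 x (axis 3 1))))"
    unfolding nu_integral_def split using g0 g[of 1] g[of 2] g[of 3]
    by (simp add: set_integral_add)
  also have "\<dots> = (LINT x:G|lborel. H0' x (axis 0 1) + (H' 1 x (axis 1 1) + (H' 2 x (axis 2 1) + H' 3 x (axis 3 1))))"
    using C1_upto_set_integrable[OF G H0, of "axis 0 1"] C1_upto_set_integrable[OF G H[of 1], of "axis 1 1"]
      C1_upto_set_integrable[OF G H[of 2], of "axis 2 1"] C1_upto_set_integrable[OF G H[of 3], of "axis 3 1"]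
    by (simp add: set_integral_add)
  also have "\<dots> = (LINT y:G|lborel.
      4 *\<^sub>R (P y \<odot> vinv y \<odot> Q y)
      + 2 *\<^sub>R (P' y (axis 0 1) \<odot> Q y + P y \<odot> Q' y (axis 0 1))
      + 2 *\<^sub>R (P' y (pure (vpart y)) \<odot> vinv y \<odot> Q y + P y \<odot> vinv y \<odot> Q' y (pure (vpart y))))"
  proof (intro set_lebesgue_integral_cong allI impI)
    fix y assume y: "y \<in> G"
    have "linear (R' y)" using R y by (auto simp: C1_upto_def intro: has_derivative_linear)
    moreover have "pure (vpart y) = y $ 1 *\<^sub>R axis 1 1 + (y $ 2 *\<^sub>R axis 2 1 + y $ 3 *\<^sub>R axis 3 1)"
      by (simp add: quat_eq_iff axis_def)
    ultimately have "R' y (pure (vpart y)) = y $ 1 *\<^sub>R R' y (axis 1 1) + (y $ 2 *\<^sub>R R' y (axis 2 1) + y $ 3 *\<^sub>R R' y (axis 3 1))"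
      by (simp add: linear_add linear_scale)
    moreover have "H' k y (axis k 1) = 2 *\<^sub>R (y $ k *\<^sub>R R' y (axis k 1)) + 2 *\<^sub>R R y" for k
      by (simp add: H'_def axis_def)
    \<comment> \<open>Differentiating the factors \<open>2 * y $ k\<close> gives
      \<open>2 *\<^sub>R R y\<close> three times, hence the \<open>6\<close>. The radial derivative
      of \<open>vinv\<close> takes off \<open>2\<close>, which leaves the \<open>4\<close> of the
      claim.\<close>
    ultimately have "H' 1 y (axis 1 1) + (H' 2 y (axis 2 1) + H' 3 y (axis 3 1)) = 2 *\<^sub>R R' y (pure (vpart y)) + 6 *\<^sub>R R y"
      by (simp add: vec_eq_iff algebra_simps)
    moreover have "R' y (pure (vpart y)) = P' y (pure (vpart y)) \<odot> vinv y \<odot> Q y + P y \<odot> vinv y \<odot> Q' y (pure (vpart y)) - R y"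
      by (simp add: R'_def R_def wr[OF y] qmul.add_left qmul.diff_left qmul.minus_left qmul.minus_right)
    ultimately show "H0' y (axis 0 1) + (H' 1 y (axis 1 1) + (H' 2 y (axis 2 1) + H' 3 y (axis 3 1))) =
      4 *\<^sub>R (P y \<odot> vinv y \<odot> Q y)
      + 2 *\<^sub>R (P' y (axis 0 1) \<odot> Q y + P y \<odot> Q' y (axis 0 1))
      + 2 *\<^sub>R (P' y (pure (vpart y)) \<odot> vinv y \<odot> Q y + P y \<odot> vinv y \<odot> Q' y (pure (vpart y)))"
      by (simp add: H0'_def R_def[symmetric] vec_eq_iff algebra_simps)
  qed (use G(1) in simp)
  finally show ?thesis .
qed

section \<open>Boundedness of the image and transport by the lifted map\<close>

lemma bounded_if_avoids_qreals:
  assumes "compact (frontier G)" "closure G \<subseteq> - qreals"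
  shows "bounded G"
proof -
  obtain R where R: "R > 0" "frontier G \<subseteq> ball 0 R"
    using compact_imp_bounded[OF assms(1)] bounded_subset_ballD by blast
  have q: "R *\<^sub>R qone \<in> - ball 0 R"
  proof -
    have "norm qone = 1" by (simp add: qone_def norm_eq_sqrt_inner inner_vec_def sum_quat)
    then show ?thesis using R(1) by simp
  qed
  have "R *\<^sub>R qone \<in> qreals" unfolding qreals_def by (rule rangeI)
  then have "R *\<^sub>R qone \<notin> G" using assms(2) closure_subset by blast
  then have "- ball 0 R - G \<noteq> {}" using q by blast
  \<comment> \<open>The exterior of the ball misses the frontier, so by connectedness
    \<open>G\<close> contains all of it or none; the real point of modulus \<open>R\<close> excludes
    the former.\<close>
  moreover have "connected (- ball (0::quat) R)"
    by (rule connected_complement_bounded_convex) auto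
  ultimately have "- ball 0 R \<inter> G = {}"
    using connected_Int_frontier[of "- ball 0 R" G] R(2) by blast
  then have "G \<subseteq> ball 0 R" by blast
  then show ?thesis by (rule bounded_subset[OF bounded_ball])
qed

lemma pderiv_at_eq:
  assumes "(f has_derivative f') (at x)"
  shows "pderiv_at j f x = f' (axis j 1)"
proof -
  have "((\<lambda>h. x + h *\<^sub>R axis j 1) has_derivative (\<lambda>h. h *\<^sub>R axis j 1)) (at (0::real))"
    by (auto intro!: derivative_eq_intros)
  moreover have "(f has_derivative f') (at (x + 0 *\<^sub>R axis j 1))" using assms by simp
  ultimately have "((\<lambda>h. f (x + h *\<^sub>R axis j 1)) has_derivative (\<lambda>h. f' (h *\<^sub>R axis j 1))) (at 0)"
    by (rule has_derivative_compose)
  then have "((\<lambda>h. f (x + h *\<^sub>R axis j 1)) has_vector_derivative f' (axis j 1)) (at 0)"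
    using linear_scale[OF has_derivative_linear[OF assms]] by (simp add: has_vector_derivative_def)
  then show ?thesis unfolding pderiv_at_def by (rule vector_derivative_at)
qed

lemma lift_nth_0 [simp]: "lift a x $ 0 = x $ 0" and vpart_lift [simp]: "vpart (lift a x) = a (vpart x)"
  by (simp_all add: lift_def)

lemma lift_in_cylinder: "lift a x \<in> cylinder s t V \<longleftrightarrow> x $ 0 \<in> einterval s t \<and> a (vpart x) \<in> V"
  by (simp add: cylinder_def)

lemma has_derivative_lift:
  assumes "(a has_derivative a') (at (vpart x))"
  shows "(lift a has_derivative (\<lambda>h. join (h $ 0) (a' (vpart h)))) (at x)"
proof -
  have "((\<lambda>x. x $ 0) has_derivative (\<lambda>h. h $ 0)) (at x)"
    by (rule bounded_linear.has_derivative[OF bounded_linear_vec_nth has_derivative_ident])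
  from has_derivative_join[OF this has_derivative_compose[OF has_derivative_vpart[OF has_derivative_ident] assms]]
  show ?thesis unfolding lift_def[abs_def] .
qed

lemma continuous_on_det_quat:
  assumes "\<And>i j. continuous_on S (\<lambda>x. (M x :: real^4^4) $ i $ j)"
  shows "continuous_on S (\<lambda>x. det (M x))"
  unfolding det_quat by (intro continuous_on_diff continuous_on_add continuous_on_mult assms)

lemma continuous_on_vinv [continuous_intros]:
  "continuous_on S h \<Longrightarrow> (\<And>x. x \<in> S \<Longrightarrow> vpart (h x) \<noteq> 0) \<Longrightarrow> continuous_on S (\<lambda>x. vinv (h x))"
  unfolding vinv_def by (intro continuous_intros bounded_linear.continuous_on[OF bounded_linear_pure]) auto

lemma nu_integral_cong:
  assumes "\<And>y. y \<in> frontier G \<Longrightarrow> P y = P' y" "\<And>y. y \<in> frontier G \<Longrightarrow> Q y = Q' y"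
  shows "nu_integral G P Q = nu_integral G P' Q'"
  unfolding nu_integral_def set_lebesgue_integral_def
  by (intro Bochner_Integration.integral_cong refl) (auto simp: assms indicator_def)

text \<open>Since \<open>p \<odot> p\<close> is \<open>- W\<close>, multiplying \<open>p\<close> by
  \<open>qone + p\<close> yields \<open>p - W\<close>. The \<open>W\<close> cancels the denominator
  and restores the terms without \<open>p\<close>; the remaining \<open>p\<close> cancels the
  derivatives \<open>g0\<close> and \<open>f0\<close> contained in the last bracket.\<close>

lemma nu_density_identity:
  assumes "v \<noteq> 0"
  shows "J *\<^sub>R (4 *\<^sub>R (g \<odot> ((1 / (norm v)\<^sup>2) *\<^sub>R pure v) \<odot> f) + 2 *\<^sub>R (g0 \<odot> f + g \<odot> f0)
      + 2 *\<^sub>R (gv \<odot> ((1 / (norm v)\<^sup>2) *\<^sub>R pure v) \<odot> f + g \<odot> ((1 / (norm v)\<^sup>2) *\<^sub>R pure v) \<odot> fv)) =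
    4 *\<^sub>R (J *\<^sub>R (g \<odot> ((1 / (norm v)\<^sup>2) *\<^sub>R pure v) \<odot> f))
    - 2 *\<^sub>R ((J / (norm v)\<^sup>2) *\<^sub>R (g0 \<odot> (qone + pure v) \<odot> pure v \<odot> f + g \<odot> pure v \<odot> (qone + pure v) \<odot> f0))
    + 2 *\<^sub>R ((J / (norm v)\<^sup>2) *\<^sub>R ((g0 + gv) \<odot> pure v \<odot> f + g \<odot> pure v \<odot> (f0 + fv)))"
proof -
  define p where "p = pure v"
  define W where "W = (norm v)\<^sup>2"
  have W: "W \<noteq> 0" using assms by (simp add: W_def)
  have pp: "p \<odot> p = - (W *\<^sub>R qone)" by (simp add: p_def W_def pure_square)
  have 1: "g0 \<odot> (qone + p) \<odot> p = g0 \<odot> p - W *\<^sub>R g0"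
    by (simp add: qmul_assoc qmul.add_left qmul.add_right pp qmul.minus_right qmul.scaleR_right qmul_qone)
  have 2: "g \<odot> p \<odot> (qone + p) = g \<odot> p - W *\<^sub>R g"
    by (simp add: qmul_assoc qmul.add_left qmul.add_right pp qmul.minus_right qmul.scaleR_right qmul_qone)
  show ?thesis
    unfolding p_def[symmetric] W_def[symmetric] 1 2
    unfolding qmul.scaleR_left qmul.scaleR_right qmul.add_left qmul.add_right qmul.diff_left
    using W by (simp add: vec_eq_iff field_simps)
qed

theorem corollary3p26:
  fixes U V :: "(real^3) set" and s t :: ereal
    and a :: "real^3 \<Rightarrow> real^3"
    and \<Omega> :: "quat set" and f g :: "quat \<Rightarrow> quat"
  assumes U: "open U" "connected U" "U \<noteq> {}"
    and V: "open V" "connected V" "V \<noteq> {}"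
    and st: "s < t"
    and a: "C1_diffeo U V a"
    and \<Omega>: "open \<Omega>" "connected \<Omega>" "\<Omega> \<noteq> {}" "\<Omega> \<subseteq> cylinder s t U"
    and closure_in_V: "closure (lift a ` \<Omega>) \<subseteq> cylinder s t V"
    and bd: "compact (frontier \<Omega>)" "smooth_surface (frontier \<Omega>)"
    and bd_image: "compact (frontier (lift a ` \<Omega>))" "smooth_surface (frontier (lift a ` \<Omega>))"
    and nonreal: "closure (lift a ` \<Omega>) \<subseteq> - qreals"
    and f: "C1_closure \<Omega> f" and g: "C1_closure \<Omega> g"
  shows "transported_nu_integral (cylinder s t U) (lift a) \<Omega> g f =
      4 *\<^sub>R (LINT x : \<Omega> | lborel. abs_jac (lift a) x *\<^sub>R
        (g x \<odot> ((1 / (norm (a (vpart x)))\<^sup>2) *\<^sub>R pure (a (vpart x))) \<odot> f x))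
    - 2 *\<^sub>R (LINT x : \<Omega> | lborel. (abs_jac (lift a) x / (norm (a (vpart x)))\<^sup>2) *\<^sub>R
        (pderiv_at 0 g x \<odot> (qone + pure (a (vpart x))) \<odot> pure (a (vpart x)) \<odot> f x
         + g x \<odot> pure (a (vpart x)) \<odot> (qone + pure (a (vpart x))) \<odot> pderiv_at 0 f x))
    + 2 *\<^sub>R (LINT x : \<Omega> | lborel. (abs_jac (lift a) x / (norm (a (vpart x)))\<^sup>2) *\<^sub>R
        (D_u U a g x \<odot> pure (a (vpart x)) \<odot> f x
         + g x \<odot> pure (a (vpart x)) \<odot> D_u U a f x))"
proof -
  define b where "b = inv_into U a"
  define A where "A = lift a"
  define B where "B = lift b"
  define G where "G = A ` \<Omega>"
  define X where "X = cylinder s t U"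
  define Y where "Y = cylinder s t V"
  have bij: "bij_betw a U V" using a by (simp add: C1_diffeo_def)
  obtain a' where a': "continuous_on U a'" "\<And>x. x \<in> U \<Longrightarrow> (a has_derivative blinfun_apply (a' x)) (at x)"
    using a by (auto simp: C1_diffeo_def C1_on_def)
  obtain b' where b': "continuous_on V b'" "\<And>y. y \<in> V \<Longrightarrow> (b has_derivative blinfun_apply (b' y)) (at y)"
    using a by (auto simp: C1_diffeo_def C1_on_def b_def)
  obtain f' where f': "continuous_on (closure \<Omega>) f" "continuous_on (closure \<Omega>) f'"
    "\<And>x. x \<in> \<Omega> \<Longrightarrow> (f has_derivative blinfun_apply (f' x)) (at x)"
    using f by (auto simp: C1_closure_def)
  obtain g' where g': "continuous_on (closure \<Omega>) g" "continuous_on (closure \<Omega>) g'"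
    "\<And>x. x \<in> \<Omega> \<Longrightarrow> (g has_derivative blinfun_apply (g' x)) (at x)"
    using g by (auto simp: C1_closure_def)
  have ab: "x \<in> U \<Longrightarrow> a x \<in> V" "x \<in> U \<Longrightarrow> b (a x) = x" "y \<in> V \<Longrightarrow> b y \<in> U" "y \<in> V \<Longrightarrow> a (b y) = y" for x y
    using bij by (auto simp: b_def bij_betw_def inv_into_into f_inv_into_f)
  have XU: "x \<in> X \<Longrightarrow> vpart x \<in> U" and YV: "y \<in> Y \<Longrightarrow> vpart y \<in> V" for x y
    by (auto simp: X_def Y_def cylinder_def)
  have AX: "A x \<in> Y" "B (A x) = x" if "x \<in> X" for x
    using that ab by (auto simp: A_def B_def X_def Y_def lift_in_cylinder) (auto simp: cylinder_def lift_def ab)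
  have BY: "B y \<in> X" "A (B y) = y" if "y \<in> Y" for y
    using that ab by (auto simp: A_def B_def X_def Y_def lift_in_cylinder) (auto simp: cylinder_def lift_def ab)
  define A' where "A' x h = join (h $ 0) (blinfun_apply (a' (vpart x)) (vpart h))" for x h
  define B' where "B' y h = join (h $ 0) (blinfun_apply (b' (vpart y)) (vpart h))" for y h
  have derA: "(A has_derivative A' x) (at x)" if "x \<in> X" for x
    unfolding A_def A'_def[abs_def] by (rule has_derivative_lift[OF a'(2)[OF XU[OF that]]])
  have derB: "(B has_derivative B' y) (at y)" if "y \<in> Y" for y
    unfolding B_def B'_def[abs_def] by (rule has_derivative_lift[OF b'(2)[OF YV[OF that]]])
  have cA: "continuous_on X A" and cB: "continuous_on Y B"
    by (rule has_derivative_continuous_on[OF has_derivative_at_withinI[OF derA]], assumption)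
       (rule has_derivative_continuous_on[OF has_derivative_at_withinI[OF derB]], assumption)
  have ca: "continuous_on U a"
    by (rule has_derivative_continuous_on[OF has_derivative_at_withinI[OF a'(2)]])
  have injA: "inj_on A X" by (rule inj_on_inverseI) (rule AX(2))
  have \<Omega>X: "\<Omega> \<subseteq> X" using \<Omega>(4) by (simp add: X_def)
  have K: "closure G \<subseteq> Y" using closure_in_V by (simp add: G_def A_def Y_def)
  have nonreal': "closure G \<subseteq> - qreals" using nonreal by (simp add: G_def A_def)
  have S: "compact (frontier G)" "smooth_surface (frontier G)" using bd_image by (simp_all add: G_def A_def)
  have G: "open G" "bounded G"
  proof -
    show "open G" unfolding G_def
      using continuous_on_subset[OF cA \<Omega>X] inj_on_subset[OF injA \<Omega>X] by (intro invariance_of_domain \<Omega>(1))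
    show "bounded G" by (rule bounded_if_avoids_qreals[OF S(1) nonreal'])
  qed
  have cG: "compact (closure G)" using G(2) by simp
  have BG: "B ` G = \<Omega>"
    using AX(2) \<Omega>X by (force simp: G_def image_image)
  \<comment> \<open>The hypotheses place \<open>\<Omega>\<close> and the closure of its image in the
    cylinders. Compactness of the latter closure shows that \<open>closure \<Omega>\<close> stays in
    \<open>X\<close> as well, so that data continuous up to the boundary can be pulled back to
    \<open>closure G\<close>.\<close>
  have cl\<Omega>: "closure \<Omega> = B ` closure G"
  proof
    have "compact (B ` closure G)"
      by (rule compact_continuous_image[OF continuous_on_subset[OF cB K] cG])
    moreover have "\<Omega> \<subseteq> B ` closure G" using BG closure_subset by blast
    ultimately show "closure \<Omega> \<subseteq> B ` closure G" by (simp add: closure_minimal compact_imp_closed)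
    show "B ` closure G \<subseteq> closure \<Omega>"
    proof (rule image_closure_subset[OF continuous_on_subset[OF cB K]])
      show "B ` G \<subseteq> closure \<Omega>" unfolding BG by (rule closure_subset)
    qed simp
  qed
  have compact_cl\<Omega>: "compact (closure \<Omega>)" unfolding cl\<Omega>
    by (rule compact_continuous_image[OF continuous_on_subset[OF cB K] cG])
  have clX: "x \<in> X" "A x \<in> closure G" if "x \<in> closure \<Omega>" for x
    using that K BY by (auto simp: cl\<Omega> subset_iff)
  have v0: "vpart y \<noteq> 0" if "y \<in> closure G" for y
    using that nonreal' by (intro vpart_nonzero) auto
  have a0: "a (vpart x) \<noteq> 0" if "x \<in> closure \<Omega>" for x
    using v0[OF clX(2)[OF that]] by (simp add: A_def)
  have C1: "C1_upto G (\<lambda>y. h (B y)) (\<lambda>y v. blinfun_apply (h' (B y)) (B' y v))"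
    if h: "continuous_on (closure \<Omega>) h" "continuous_on (closure \<Omega>) h'"
      "\<And>x. x \<in> \<Omega> \<Longrightarrow> (h has_derivative blinfun_apply (h' x)) (at x)" for h :: "quat \<Rightarrow> quat" and h'
    unfolding C1_upto_def
  proof (intro conjI allI ballI)
    note cB' = continuous_on_subset[OF cB K]
    show "continuous_on (closure G) (\<lambda>y. h (B y))"
      by (rule continuous_on_compose2[OF h(1) cB']) (simp add: cl\<Omega>)
    have "continuous_on (closure G) (\<lambda>y. h' (B y))"
      by (rule continuous_on_compose2[OF h(2) cB']) (simp add: cl\<Omega>)
    moreover have "continuous_on (closure G) (\<lambda>y. b' (vpart y))"
      by (rule continuous_on_compose2[OF b'(1)]) (use K YV in \<open>auto intro!: continuous_intros\<close>)
    ultimately show "continuous_on (closure G) (\<lambda>y. blinfun_apply (h' (B y)) (B' y v))" for v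
      unfolding B'_def by (intro continuous_intros)
    fix y assume "y \<in> G"
    then have "y \<in> Y" "B y \<in> \<Omega>" using K closure_subset BG by blast+
    then show "((\<lambda>y. h (B y)) has_derivative (\<lambda>v. blinfun_apply (h' (B y)) (B' y v))) (at y)"
      using has_derivative_compose[OF derB h(3)] by blast
  qed
  define P' where "P' y v = blinfun_apply (g' (B y)) (B' y v)" for y v
  define Q' where "Q' y v = blinfun_apply (f' (B y)) (B' y v)" for y v
  define dv where "dv y = 4 *\<^sub>R (g (B y) \<odot> vinv y \<odot> f (B y))
      + 2 *\<^sub>R (P' y (axis 0 1) \<odot> f (B y) + g (B y) \<odot> Q' y (axis 0 1))
      + 2 *\<^sub>R (P' y (pure (vpart y)) \<odot> vinv y \<odot> f (B y) + g (B y) \<odot> vinv y \<odot> Q' y (pure (vpart y)))" for y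
  define J where "J x = \<bar>det (matrix (A' x))\<bar>" for x
  have cJ: "continuous_on (closure \<Omega>) J"
  proof -
    have "continuous_on (closure \<Omega>) (\<lambda>x. a' (vpart x))"
      by (rule continuous_on_compose2[OF a'(1)]) (use clX XU in \<open>auto intro!: continuous_intros\<close>)
    then have "continuous_on (closure \<Omega>) (\<lambda>x. A' x v)" for v
      unfolding A'_def by (intro continuous_intros)
    then have "continuous_on (closure \<Omega>) (\<lambda>x. matrix (A' x) $ i $ j)" for i j
      unfolding matrix_def by (simp add: continuous_on_component)
    then show ?thesis unfolding J_def by (intro continuous_on_rabs continuous_on_det_quat)
  qed
  have jac: "abs_jac A x = J x" if "x \<in> \<Omega>" for x
    using frechet_derivative_at[OF derA[OF subsetD[OF \<Omega>X that]]] by (simp add: abs_jac_def jacobian_def J_def)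
  \<comment> \<open>This is the radial vector at \<open>A x\<close> carried back by the derivative
    of \<open>B\<close>. Its components are the coefficients \<open>u_coeff\<close>, so
    \<open>D_u\<close> is differentiation in the direction \<open>axis 0 1 + u x\<close>.\<close>
  define u where "u x = join 0 (blinfun_apply (b' (a (vpart x))) (a (vpart x)))" for x
  have Du: "D_u U a h x = blinfun_apply (h' x) (axis 0 1) + blinfun_apply (h' x) (u x)"
    if h: "\<And>x. x \<in> \<Omega> \<Longrightarrow> (h has_derivative blinfun_apply (h' x)) (at x)" and x: "x \<in> \<Omega>" for h :: "quat \<Rightarrow> quat" and h' x
  proof -
    define v where "v = a (vpart x)"
    have v: "v \<in> V" using x \<Omega>X XU ab(1) by (auto simp: v_def)
    have "pderiv_at j (\<lambda>y. inv_into U a y $ i) v = blinfun_apply (b' v) (axis j 1) $ i" for i j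
      using pderiv_at_eq[OF bounded_linear.has_derivative[OF bounded_linear_vec_nth b'(2)[OF v]]] by (simp add: b_def)
    then have "u_coeff U a i x = (\<Sum>j\<in>UNIV. v $ j * blinfun_apply (b' v) (axis j 1) $ i)" for i
      by (simp add: u_coeff_def v_def)
    also have "\<dots> i = blinfun_apply (b' v) (\<Sum>j\<in>UNIV. v $ j *\<^sub>R axis j 1) $ i" for i
      by (simp add: blinfun.sum_right blinfun.scaleR_right)
    also have "(\<Sum>j\<in>UNIV. v $ j *\<^sub>R axis j 1) = v" using basis_expansion[of v] by (simp add: scalar_mult_eq_scaleR)
    finally have u: "u_coeff U a i x = blinfun_apply (b' v) v $ i" for i .
    have "u x = u_coeff U a 1 x *\<^sub>R axis 1 1 + u_coeff U a 2 x *\<^sub>R axis 2 1 + u_coeff U a 3 x *\<^sub>R axis 3 1"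
      by (simp add: u u_def v_def[symmetric] quat_eq_iff axis_def)
    then show ?thesis
      by (simp add: D_u_def pderiv_at_eq[OF h[OF x]] blinfun.add_right blinfun.scaleR_right)
  qed
  \<comment> \<open>The integrands are written with \<open>f'\<close> and \<open>g'\<close>, which
    extend continuously to the compact closure; this makes the three integrals exist
    separately.\<close>
  define E1 where "E1 x = J x *\<^sub>R (g x \<odot> ((1 / (norm (a (vpart x)))\<^sup>2) *\<^sub>R pure (a (vpart x))) \<odot> f x)" for x
  define E2 where "E2 x = (J x / (norm (a (vpart x)))\<^sup>2) *\<^sub>R
        (blinfun_apply (g' x) (axis 0 1) \<odot> (qone + pure (a (vpart x))) \<odot> pure (a (vpart x)) \<odot> f x
         + g x \<odot> pure (a (vpart x)) \<odot> (qone + pure (a (vpart x))) \<odot> blinfun_apply (f' x) (axis 0 1))" for x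
  define E3 where "E3 x = (J x / (norm (a (vpart x)))\<^sup>2) *\<^sub>R
        ((blinfun_apply (g' x) (axis 0 1) + blinfun_apply (g' x) (u x)) \<odot> pure (a (vpart x)) \<odot> f x
         + g x \<odot> pure (a (vpart x)) \<odot> (blinfun_apply (f' x) (axis 0 1) + blinfun_apply (f' x) (u x)))" for x
  have cE: "continuous_on (closure \<Omega>) E1" "continuous_on (closure \<Omega>) E2" "continuous_on (closure \<Omega>) E3"
  proof -
    have c1: "continuous_on (closure \<Omega>) (\<lambda>x. a (vpart x))"
      by (rule continuous_on_compose2[OF ca]) (use clX XU in \<open>auto intro!: continuous_intros\<close>)
    have "continuous_on (closure \<Omega>) (\<lambda>x. b' (a (vpart x)))"
      by (rule continuous_on_compose2[OF b'(1) c1]) (use clX XU ab(1) in auto)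
    then have c2: "continuous_on (closure \<Omega>) u"
      unfolding u_def[abs_def] by (intro continuous_intros c1)
    note c3 = bounded_linear.continuous_on[OF bounded_linear_pure c1]
    have n0: "\<forall>x\<in>closure \<Omega>. (norm (a (vpart x)))\<^sup>2 \<noteq> 0" using a0 by simp
    show "continuous_on (closure \<Omega>) E1" unfolding E1_def[abs_def]
      by (intro continuous_intros qmul.continuous_on c1 c3 cJ f'(1) g'(1) n0)
    show "continuous_on (closure \<Omega>) E2" unfolding E2_def[abs_def]
      by (intro continuous_intros qmul.continuous_on c1 c3 cJ f'(1,2) g'(1,2) n0)
    show "continuous_on (closure \<Omega>) E3" unfolding E3_def[abs_def]
      by (intro continuous_intros qmul.continuous_on c1 c2 c3 cJ f'(1,2) g'(1,2) n0)
  qed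
  have "transported_nu_integral X A \<Omega> g f = nu_integral G (\<lambda>y. g (B y)) (\<lambda>y. f (B y))"
    unfolding transported_nu_integral_def G_def[symmetric]
  proof (rule nu_integral_cong)
    fix y assume "y \<in> frontier G"
    then have y: "y \<in> Y" using K by (auto simp: frontier_def)
    \<comment> \<open>Outside the image of \<open>X\<close> the left side is arbitrary, but the
      frontier lies in \<open>Y\<close>, where both inverses agree.\<close>
    have "inv_into X A y = B y" by (rule inv_into_f_eq[OF injA BY[OF y]])
    then show "(g \<circ> inv_into X A) y = g (B y)" "(f \<circ> inv_into X A) y = f (B y)" by simp_all
  qed
  also have "\<dots> = (LINT y:G|lborel. dv y)"
    unfolding dv_def P'_def Q'_def
    by (rule nu_integral_eq_volume_integral[OF G S(2) nonreal' C1[OF g'] C1[OF f']])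
  also have "\<dots> = (LINT x:\<Omega>|lborel. J x *\<^sub>R dv (A x))"
  proof -
    have c: "continuous_on (closure G) (\<lambda>y. g (B y))" "continuous_on (closure G) (\<lambda>y. f (B y))"
      "\<And>v. continuous_on (closure G) (\<lambda>y. P' y v)" "\<And>v. continuous_on (closure G) (\<lambda>y. Q' y v)"
      using C1[OF g'] C1[OF f'] by (simp_all add: C1_upto_def P'_def Q'_def)
    \<comment> \<open>Continuity of \<open>P'\<close> and \<open>Q'\<close> is available for fixed
      directions only, so the moving radial direction is expanded in the basis.\<close>
    have "pure (vpart y) = y $ 1 *\<^sub>R axis 1 1 + (y $ 2 *\<^sub>R axis 2 1 + y $ 3 *\<^sub>R axis 3 1)" for y :: quat
      by (simp add: quat_eq_iff axis_def)
    then have e: "L y (pure (vpart y)) = y $ 1 *\<^sub>R L y (axis 1 1) + (y $ 2 *\<^sub>R L y (axis 2 1) + y $ 3 *\<^sub>R L y (axis 3 1))"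
      if "linear (L y)" for L :: "quat \<Rightarrow> quat \<Rightarrow> quat" and y using that by (simp add: linear_add linear_scale)
    have linB: "linear (B' y)" for y
      by (auto simp: B'_def[abs_def] linear_iff quat_eq_iff vpart_add vpart_scaleR blinfun.add_right blinfun.scaleR_right)
    have lin: "linear (P' y)" "linear (Q' y)" for y
      using linB[of y] by (auto simp: P'_def[abs_def] Q'_def[abs_def] linear_iff blinfun.add_right blinfun.scaleR_right)
    have cdv: "continuous_on (closure G) dv"
      unfolding dv_def[abs_def] e[of P', OF lin(1)] e[of Q', OF lin(2)]
      by (intro continuous_intros qmul.continuous_on c v0)
    have dvG: "set_integrable lborel (A ` \<Omega>) dv"
      using G(1) closure_subset by (intro set_integrable_bounded_continuous[OF cG cdv]) (auto simp: G_def[symmetric])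
    have "continuous_on \<Omega> J" using continuous_on_subset[OF cJ closure_subset] .
    moreover have "continuous_on \<Omega> (\<lambda>x. dv (A x))"
      by (rule continuous_on_compose2[OF cdv continuous_on_subset[OF cA \<Omega>X]])
        (use closure_subset[of G] in \<open>auto simp: G_def\<close>)
    ultimately have cJdv: "continuous_on \<Omega> (\<lambda>x. \<bar>det (matrix (A' x))\<bar> *\<^sub>R dv (A x))"
      unfolding J_def by (rule continuous_on_scaleR)
    show ?thesis unfolding G_def J_def
      by (rule set_integral_change_of_variables(2)[OF _ _ inj_on_subset[OF injA \<Omega>X] dvG cJdv])
        (use \<Omega>(1) \<Omega>X derA in auto)
  qed
  also have "\<dots> = (LINT x:\<Omega>|lborel. 4 *\<^sub>R E1 x - 2 *\<^sub>R E2 x + 2 *\<^sub>R E3 x)"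
  proof (intro set_lebesgue_integral_cong allI impI)
    fix x assume x: "x \<in> \<Omega>"
    then have xX: "x \<in> X" using \<Omega>X by blast
    \<comment> \<open>The lifted map leaves the real coordinate alone, so the derivative in the real
      direction is transported unchanged.\<close>
    have "B' (A x) (axis 0 1) = axis 0 1"
    proof -
      have "vpart (axis 0 1) = 0" by (simp add: vec_eq_iff forall_3 axis_def)
      then show ?thesis by (simp add: B'_def quat_eq_iff axis_def blinfun.zero_right)
    qed
    moreover have "B' (A x) (pure (a (vpart x))) = join 0 (blinfun_apply (b' (a (vpart x))) (a (vpart x)))"
      by (simp add: B'_def pure_def A_def)
    ultimately have "dv (A x) = 4 *\<^sub>R (g x \<odot> ((1 / (norm (a (vpart x)))\<^sup>2) *\<^sub>R pure (a (vpart x))) \<odot> f x)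
      + 2 *\<^sub>R (blinfun_apply (g' x) (axis 0 1) \<odot> f x + g x \<odot> blinfun_apply (f' x) (axis 0 1))
      + 2 *\<^sub>R (blinfun_apply (g' x) (u x) \<odot> ((1 / (norm (a (vpart x)))\<^sup>2) *\<^sub>R pure (a (vpart x))) \<odot> f x
         + g x \<odot> ((1 / (norm (a (vpart x)))\<^sup>2) *\<^sub>R pure (a (vpart x))) \<odot> blinfun_apply (f' x) (u x))"
      by (simp add: dv_def P'_def Q'_def AX(2)[OF xX] vinv_def u_def) (simp add: A_def)
    then show "J x *\<^sub>R dv (A x) = 4 *\<^sub>R E1 x - 2 *\<^sub>R E2 x + 2 *\<^sub>R E3 x"
      unfolding E1_def E2_def E3_def using x closure_subset[of \<Omega>]
      by (simp only: nu_density_identity[OF a0[OF subsetD[OF closure_subset x]]])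
  qed (use \<Omega>(1) in simp)
  also have "\<dots> = 4 *\<^sub>R (LINT x:\<Omega>|lborel. E1 x) - 2 *\<^sub>R (LINT x:\<Omega>|lborel. E2 x) + 2 *\<^sub>R (LINT x:\<Omega>|lborel. E3 x)"
  proof -
    have i: "set_integrable lborel \<Omega> E1" "set_integrable lborel \<Omega> E2" "set_integrable lborel \<Omega> E3"
      using \<Omega>(1) by (auto intro!: set_integrable_bounded_continuous[OF compact_cl\<Omega>] cE closure_subset)
    then show ?thesis by (simp add: set_integral_add set_integral_diff)
  qed
  also have "(LINT x:\<Omega>|lborel. E1 x) = (LINT x:\<Omega>|lborel. abs_jac A x *\<^sub>R
        (g x \<odot> ((1 / (norm (a (vpart x)))\<^sup>2) *\<^sub>R pure (a (vpart x))) \<odot> f x))"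
    using \<Omega>(1) by (intro set_lebesgue_integral_cong) (simp_all add: E1_def jac)
  also have "(LINT x:\<Omega>|lborel. E2 x) = (LINT x:\<Omega>|lborel. (abs_jac A x / (norm (a (vpart x)))\<^sup>2) *\<^sub>R
        (pderiv_at 0 g x \<odot> (qone + pure (a (vpart x))) \<odot> pure (a (vpart x)) \<odot> f x
         + g x \<odot> pure (a (vpart x)) \<odot> (qone + pure (a (vpart x))) \<odot> pderiv_at 0 f x))"
    using \<Omega>(1) by (intro set_lebesgue_integral_cong) (simp_all add: E2_def jac pderiv_at_eq[OF f'(3)] pderiv_at_eq[OF g'(3)])
  also have "(LINT x:\<Omega>|lborel. E3 x) = (LINT x:\<Omega>|lborel. (abs_jac A x / (norm (a (vpart x)))\<^sup>2) *\<^sub>R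
        (D_u U a g x \<odot> pure (a (vpart x)) \<odot> f x
         + g x \<odot> pure (a (vpart x)) \<odot> D_u U a f x))"
    using \<Omega>(1) by (intro set_lebesgue_integral_cong) (simp_all add: E3_def jac Du[OF f'(3)] Du[OF g'(3)])
  finally show ?thesis unfolding A_def X_def .
qed

end
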